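(* Let $U,V\in\mathcal{L}_2(\mathbb{R}^m)$, $Y:=(U,V)$, $\nu:=\mathrm{Law}(Y)$, $S$ the standard form on $\mathbb{R}^{2m}$, and let $(R,f)$ and $(Q,g)$ be $Y$-equilibria. (a) $\langle R-U,V-f(R)\rangle=\langle Q-U,V-g(Q)\rangle$ a.s. (b) If $\operatorname{supp}\nu=\mathbb{R}^{2m}$, then there exists a unique $H\in\mathcal{M}(S)$ optimal for the dual problem; the graphs of $f$ and $g$ are contained in $H$; in particular $C(f)=C(g)$ and $f(u)=g(u)$ for $u\in C(f)$. (c) Assume that the interior of the convex hull of $\operatorname{supp}\nu$ is non-empty and that conditions (A1), (A2), (A3) below hold. Then $f(R)=g(Q)$ a.s. If, in addition, $f$ and $g$ are monotone or $Y\in\operatorname{int}(\operatorname{supp}\nu)$ a.s., then $R=Q$ a.s.; in this case $X:=(R,f(R))$ is the unique optimal map and $\mathrm{Law}(X,Y)$ is the unique optimal plan. Conditions: (A1) $h(SY)\ne0$ a.s. for every $h\in\mathcal{H}^j_C$ with $j\in\{1,\dots,2m\}$ and compact $C\subset\{x:x^j=1,\ S(x,x)>0\}$; (A2) if $m=1$, then for every $S$-isotropic $w$ the random variable $S(Y,w)$ has a continuous distribution function; (A3) if $m>1$, then $\nu(D)=0$ for every $D\in\mathcal{E}_0(S)$.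
   Context: Standard form on $\mathbb{R}^{2m}$: $S((r,s),(u,v)):=\langle s,u\rangle+\langle r,v\rangle$. $w$ is $S$-isotropic if $|w|>0$ and $S(w,w)=0$. $G$ is $S$-monotone if $S(x-y,x-y)\ge0$ for $x,y\in G$; maximal if not a strict subset of another $S$-monotone set; $\mathcal{M}(S)$ = family of maximal $S$-monotone sets; $\psi_G(y):=\sup_{x\in G}(S(x,y)-\frac12S(x,x))$. For $x\in\mathbb{R}^{2m}$, $x^{-j}$ is $x$ without its $j$-th coordinate; for compact $C$ with $y^j=1$ on $C$, $\mathcal{H}^j_C$ is the family of $h(x)=x^j+g_1(x^{-j})-g_2(x^{-j})$ with $g_1,g_2$ convex of linear growth and $\nabla h(x)\in C$ whenever $g_1,g_2$ differentiable at $x^{-j}$. $\mathcal{E}_0(S)$: Borel sets $D$ such that for every $\delta>0$ there are $j_n$, compact $C_n\subset\{x:x^{j_n}=1,\ 0\le S(x,x)\le\delta\}$ and $h_n\in\mathcal{H}^{j_n}_{C_n}$ with $D\subset\bigcup_n\{x:h_n(Sx)=0\}$. $\mathcal{X}(Y):=\{X\in\mathcal{L}_2(\mathbb{R}^{2m}):X\ Y\text{-measurable},\ \mathbb{E}[Y|X]=X\}$; optimal map: maximizer of $\frac12\mathbb{E}[S(X,Y)]$ over $\mathcal{X}(Y)$. $\Gamma(\nu)$: Borel probability measures on $\mathbb{R}^{2m}\times\mathbb{R}^{2m}$ (coordinates $(x,y)$) with finite second moments, second marginal $\nu$, conditional expectation of $y$ given $x$ equal to $x$; optimal plan: maximizer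 of $\frac12\int S d\gamma$. Optimal set of dual problem: minimizer of $\int\psi_G d\nu$ over $\mathcal{M}(S)$. $f$ monotone: $\langle u-r,f(u)-f(r)\rangle\ge0$. $C(f)$: set of points where $f$ is continuous. For $R\in\mathcal{L}_2(\mathbb{R}^m)$ $Y$-measurable and Borel $f:\mathbb{R}^m\to\mathbb{R}^m$, $(R,f)$ is a $Y$-equilibrium if $f(R)=\mathbb{E}[V|R]$ and a.s. $R\in\operatorname{argmax}_{r}\langle r-U,V-f(r)\rangle$. *)

theory Defs
  imports "HOL-Probability.Probability"
begin

text \<open>Points of R^{2m} are represented as pairs (r,s) with r,s in R^m; coordinates
  of R^{2m} are indexed by the sum type 'm + 'm (2m indices).\<close>

type_synonym ('m) pt = "(real^('m::finite)) \<times> (real^'m)"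

definition coord :: "('m::finite) pt \<Rightarrow> ('m + 'm) \<Rightarrow> real" where
  "coord x j = (case j of Inl i \<Rightarrow> fst x $ i | Inr i \<Rightarrow> snd x $ i)"

text \<open>x^{-j}: x with its j-th coordinate removed, represented as the point of the
  hyperplane {coord j = 0} obtained by zeroing that coordinate.\<close>
definition drop_coord :: "('m + 'm) \<Rightarrow> ('m::finite) pt \<Rightarrow> ('m::finite) pt" where
  "drop_coord j x =
     (case j of Inl i \<Rightarrow> ((\<chi> k. if k = i then 0 else fst x $ k), snd x)
              | Inr i \<Rightarrow> (fst x, (\<chi> k. if k = i then 0 else snd x $ k)))"

definition hyperplane :: "('m + 'm) \<Rightarrow> ('m::finite) pt set" where
  "hyperplane j = {x. coord x j = 0}"

definition Sform :: "('m::finite) pt \<Rightarrow> ('m::finite) pt \<Rightarrow> real" where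
  "Sform x y = inner (snd x) (fst y) + inner (fst x) (snd y)"

definition Smap :: "('m::finite) pt \<Rightarrow> ('m::finite) pt" where
  "Smap x = (snd x, fst x)"

definition S_isotropic :: "('m::finite) pt \<Rightarrow> bool" where
  "S_isotropic w \<longleftrightarrow> norm w > 0 \<and> Sform w w = 0"

definition S_monotone :: "('m::finite) pt set \<Rightarrow> bool" where
  "S_monotone G \<longleftrightarrow> (\<forall>x\<in>G. \<forall>y\<in>G. Sform (x - y) (x - y) \<ge> 0)"

definition maxS :: "('m::finite) pt set set" where
  "maxS = {G. S_monotone G \<and> (\<forall>G'. S_monotone G' \<and> G \<subseteq> G' \<longrightarrow> G' = G)}"

definition psi :: "('m::finite) pt set \<Rightarrow> ('m::finite) pt \<Rightarrow> ereal" where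
  "psi G y = (SUP x\<in>G. ereal (Sform x y - Sform x x / 2))"

definition eintegral :: "'b measure \<Rightarrow> ('b \<Rightarrow> ereal) \<Rightarrow> ereal" where
  "eintegral N \<phi> = enn2ereal (\<integral>\<^sup>+ x. e2ennreal (\<phi> x) \<partial>N)
                  - enn2ereal (\<integral>\<^sup>+ x. e2ennreal (- \<phi> x) \<partial>N)"

definition dual_optimal :: "('m::finite) pt measure \<Rightarrow> ('m::finite) pt set \<Rightarrow> bool" where
  "dual_optimal \<nu> H \<longleftrightarrow> H \<in> maxS \<and>
     (\<forall>G\<in>maxS. eintegral \<nu> (psi H) \<le> eintegral \<nu> (psi G))"

definition lin_growth_convex :: "('m + 'm) \<Rightarrow> (('m::finite) pt \<Rightarrow> real) \<Rightarrow> bool" where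
  "lin_growth_convex j g \<longleftrightarrow> convex_on (hyperplane j) g \<and>
     (\<exists>c. \<forall>z\<in>hyperplane j. \<bar>g z\<bar> \<le> c * (1 + norm z))"

definition in_H :: "('m + 'm) \<Rightarrow> ('m::finite) pt set \<Rightarrow> (('m::finite) pt \<Rightarrow> real) \<Rightarrow> bool" where
  "in_H j C h \<longleftrightarrow> compact C \<and> C \<subseteq> {y. coord y j = 1} \<and>
     (\<exists>g1 g2. lin_growth_convex j g1 \<and> lin_growth_convex j g2 \<and>
        h = (\<lambda>x. coord x j + g1 (drop_coord j x) - g2 (drop_coord j x)) \<and>
        (\<forall>x. g1 differentiable (at (drop_coord j x) within hyperplane j) \<and>
             g2 differentiable (at (drop_coord j x) within hyperplane j) \<longrightarrow>
             (\<exists>D\<in>C. (h has_derivative (\<lambda>v. inner D v)) (at x))))"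

definition E0 :: "('m::finite) pt set set" where
  "E0 = {D. D \<in> sets borel \<and>
     (\<forall>\<delta>>0. \<exists>(js :: nat \<Rightarrow> 'm + 'm) (Cs :: nat \<Rightarrow> ('m::finite) pt set) (hs :: nat \<Rightarrow> ('m::finite) pt \<Rightarrow> real).
        (\<forall>n. compact (Cs n) \<and>
             Cs n \<subseteq> {x. coord x (js n) = 1 \<and> 0 \<le> Sform x x \<and> Sform x x \<le> \<delta>} \<and>
             in_H (js n) (Cs n) (hs n)) \<and>
        D \<subseteq> (\<Union>n. {x. hs n (Smap x) = 0}))}"

definition msupp :: "'b::metric_space measure \<Rightarrow> 'b set" where
  "msupp N = {x. \<forall>e>0. emeasure N (ball x e) > 0}"

definition L2 :: "'a measure \<Rightarrow> ('a \<Rightarrow> 'b::euclidean_space) \<Rightarrow> bool" where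
  "L2 M X \<longleftrightarrow> X \<in> borel_measurable M \<and> integrable M (\<lambda>\<omega>. (norm (X \<omega>))\<^sup>2)"

definition sigma_of :: "'a measure \<Rightarrow> ('a \<Rightarrow> 'b::topological_space) \<Rightarrow> 'a measure" where
  "sigma_of M Z = vimage_algebra (space M) Z borel"

definition meas_wrt :: "'a measure \<Rightarrow> ('a \<Rightarrow> 'b::topological_space) \<Rightarrow> ('a \<Rightarrow> 'c::topological_space) \<Rightarrow> bool" where
  "meas_wrt M Z X \<longleftrightarrow> X \<in> measurable (sigma_of M Z) borel"

definition cond_exp_is :: "'a measure \<Rightarrow> 'a measure \<Rightarrow> ('a \<Rightarrow> 'b::euclidean_space) \<Rightarrow> ('a \<Rightarrow> 'b) \<Rightarrow> bool" where
  "cond_exp_is M F Z W \<longleftrightarrow>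
     (\<forall>i\<in>Basis. AE \<omega> in M. real_cond_exp M F (\<lambda>\<omega>. Z \<omega> \<bullet> i) \<omega> = W \<omega> \<bullet> i)"

definition Y_equilibrium :: "'a measure \<Rightarrow> ('a \<Rightarrow> real^'m) \<Rightarrow> ('a \<Rightarrow> real^'m)
     \<Rightarrow> ('a \<Rightarrow> real^'m) \<Rightarrow> (real^'m \<Rightarrow> real^'m) \<Rightarrow> bool" where
  "Y_equilibrium M U V R f \<longleftrightarrow>
     L2 M R \<and> meas_wrt M (\<lambda>\<omega>. (U \<omega>, V \<omega>)) R \<and> f \<in> borel_measurable borel \<and>
     cond_exp_is M (sigma_of M R) V (\<lambda>\<omega>. f (R \<omega>)) \<and>
     (AE \<omega> in M. \<forall>r. inner (r - U \<omega>) (V \<omega> - f r) \<le> inner (R \<omega> - U \<omega>) (V \<omega> - f (R \<omega>)))"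

definition admissible_maps :: "'a measure \<Rightarrow> ('a \<Rightarrow> ('m::finite) pt) \<Rightarrow> ('a \<Rightarrow> ('m::finite) pt) set" where
  "admissible_maps M Y = {X. L2 M X \<and> meas_wrt M Y X \<and> cond_exp_is M (sigma_of M X) Y X}"

definition optimal_map :: "'a measure \<Rightarrow> ('a \<Rightarrow> ('m::finite) pt) \<Rightarrow> ('a \<Rightarrow> ('m::finite) pt) \<Rightarrow> bool" where
  "optimal_map M Y X \<longleftrightarrow> X \<in> admissible_maps M Y \<and>
     (\<forall>X'\<in>admissible_maps M Y.
        (\<integral>\<omega>. Sform (X' \<omega>) (Y \<omega>) \<partial>M) / 2 \<le> (\<integral>\<omega>. Sform (X \<omega>) (Y \<omega>) \<partial>M) / 2)"

definition Gamma :: "('m::finite) pt measure \<Rightarrow> (('m::finite) pt \<times> ('m::finite) pt) measure set" where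
  "Gamma \<nu> = {\<gamma>. prob_space \<gamma> \<and> sets \<gamma> = sets borel \<and>
      integrable \<gamma> (\<lambda>p. (norm (fst p))\<^sup>2 + (norm (snd p))\<^sup>2) \<and>
      distr \<gamma> borel snd = \<nu> \<and>
      cond_exp_is \<gamma> (sigma_of \<gamma> fst) snd fst}"

definition optimal_plan :: "('m::finite) pt measure \<Rightarrow> (('m::finite) pt \<times> ('m::finite) pt) measure \<Rightarrow> bool" where
  "optimal_plan \<nu> \<gamma> \<longleftrightarrow> \<gamma> \<in> Gamma \<nu> \<and>
     (\<forall>\<gamma>'\<in>Gamma \<nu>. (\<integral>p. Sform (fst p) (snd p) \<partial>\<gamma>') / 2 \<le> (\<integral>p. Sform (fst p) (snd p) \<partial>\<gamma>) / 2)"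

definition monotone_map :: "(real^'m \<Rightarrow> real^'m) \<Rightarrow> bool" where
  "monotone_map f \<longleftrightarrow> (\<forall>u r. inner (u - r) (f u - f r) \<ge> 0)"

definition graph :: "(real^'m \<Rightarrow> real^'m) \<Rightarrow> ('m::finite) pt set" where
  "graph f = {(u, f u) | u. True}"

definition cont_points :: "(real^'m \<Rightarrow> real^'m) \<Rightarrow> (real^'m) set" where
  "cont_points f = {u. isCont f u}"

end

theory Submission
  imports Defs
begin

text \<open>
  Write \<open>q y = S(y,y)/2\<close>. For \<open>A = graph f\<close> the convex function \<open>psi A\<close> dominates \<open>q\<close> everywhere, because
  \<open>f\<close> is defined at every point. Jensen's inequality for \<open>psi A\<close> then gives weak duality between
  \<open>E q(X)\<close>, where \<open>E[Y|X] = X\<close>, and \<open>E psi A(Y)\<close>. An equilibrium closes this duality gap with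
  \<open>X = (E[U|R], f(R)) = E[Y|R]\<close>, so that \<open>X\<close> lies in the contact set \<open>{psi A = q}\<close> and the insider's
  optimal profit is the affine minorant of \<open>psi A\<close> at \<open>X\<close>. This yields (a), and (b) because with full
  support almost sure equality of finite convex functions is equality.

  For (c), every point of \<open>graph f\<close> is in monotone relation to every point of the contact set. So \<open>X\<close>
  and \<open>(R, f(R))\<close> are two maximizers, over sets in monotone relation, of the affine minorants at \<open>Y\<close>.
  Where two such maximizers differ, \<open>Y\<close> lies on countably many surfaces on which two conjugates of
  separated compact sets agree. Such a surface is the graph of a difference of convex functions whose
  normals are normalized differences of the points of these sets, hence is null by (A1) and (A3). For
  \<open>m = 1\<close> the isotropic differences are confined to countably many lines, null by (A2). Therefore
  \<open>X = (R, f(R))\<close> almost surely, for every equilibrium and every optimizer.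
\<close>

section \<open>Surfaces on which two separated conjugates agree\<close>

text \<open>The obstacle is that \<open>f\<close> is only Borel: its graph need not be monotone, so
  the form may be negative on differences of its points. What survives is a relation between two
  sets, the graph and the contact set, and the uniqueness argument is therefore built for a pair
  \<open>A\<close>, \<open>B\<close> with \<open>S(a - b, a - b)\<close> nonnegative across the
  pair. Pairs of distinct maximizers are uncountable. Small closed balls with centers in a countable
  dense set reduce them to countably many pairs of compact pieces, each pair separated by one
  coordinate. Compactness supplies what \<open>in_H\<close> asks for: the conjugates are finite with
  linear growth, the set of normalized differences is compact, and the slab between the pieces makes
  the surface of equality a graph along that coordinate. The function behind this graph is obtained
  from two partial minima whose slopes are the two faces of the slab. Passing from \<open>y\<close>
  to \<open>Smap y\<close> turns \<open>S(x,y)\<close> into an inner product, hence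
  \<open>h (Smap y)\<close> in the conditions.\<close>

definition conjugate_on :: "('a::euclidean_space \<Rightarrow> real) \<Rightarrow> 'a set \<Rightarrow> 'a \<Rightarrow> real" where
  "conjugate_on k K z = (SUP x\<in>K. x \<bullet> z - k x)"

lemma conjugate_on_attained:
  assumes "compact K" "K \<noteq> {}" "continuous_on K k"
  obtains x where "x \<in> K" "conjugate_on k K z = x \<bullet> z - k x" "\<And>y. y \<in> K \<Longrightarrow> y \<bullet> z - k y \<le> x \<bullet> z - k x"
proof -
  have "continuous_on K (\<lambda>x. x \<bullet> z - k x)"
    by (intro continuous_intros assms)
  then obtain x where x: "x \<in> K" "\<forall>y\<in>K. y \<bullet> z - k y \<le> x \<bullet> z - k x"
    using continuous_attains_sup[OF assms(1,2)] by blast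
  have "conjugate_on k K z = x \<bullet> z - k x"
    unfolding conjugate_on_def using x by (intro cSup_eq_maximum) auto
  with x show ?thesis using that by blast
qed

lemma conjugate_on_upper:
  assumes "compact K" "continuous_on K k" "x \<in> K"
  shows "x \<bullet> z - k x \<le> conjugate_on k K z"
  using conjugate_on_attained[of K k z] assms by (metis empty_iff)

lemma conjugate_on_convex:
  assumes "compact K" "K \<noteq> {}" "continuous_on K k"
  shows "convex_on UNIV (conjugate_on k K)"
proof (intro convex_onI)
  fix t :: real and y z :: 'a assume t: "0 < t" "t < 1"
  obtain x where x: "x \<in> K"
    "conjugate_on k K ((1 - t) *\<^sub>R y + t *\<^sub>R z) = x \<bullet> ((1 - t) *\<^sub>R y + t *\<^sub>R z) - k x"
    using conjugate_on_attained[OF assms] by metis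
  have "x \<bullet> ((1 - t) *\<^sub>R y + t *\<^sub>R z) - k x = (1 - t) * (x \<bullet> y - k x) + t * (x \<bullet> z - k x)"
    by (simp add: inner_simps algebra_simps)
  also have "\<dots> \<le> (1 - t) * conjugate_on k K y + t * conjugate_on k K z"
    using t x(1) assms by (intro add_mono mult_left_mono conjugate_on_upper) auto
  finally show "conjugate_on k K ((1 - t) *\<^sub>R y + t *\<^sub>R z) \<le> (1 - t) * conjugate_on k K y + t * conjugate_on k K z"
    using x(2) by simp
qed auto

lemma conjugate_on_linear_growth:
  assumes "compact K" "K \<noteq> {}" "continuous_on K k"
  obtains c where "c \<ge> 0" "\<And>z. \<bar>conjugate_on k K z\<bar> \<le> c * (1 + norm z)"
proof -
  obtain b where b: "b > 0" "\<And>x. x \<in> K \<Longrightarrow> norm x \<le> b"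
    using compact_imp_bounded[OF assms(1)] bounded_pos by metis
  obtain b' where b': "b' > 0" "\<And>x. x \<in> K \<Longrightarrow> norm (k x) \<le> b'"
    using compact_imp_bounded[OF compact_continuous_image[OF assms(3,1)]]
    unfolding bounded_pos by auto
  have "\<bar>conjugate_on k K z\<bar> \<le> (b + b') * (1 + norm z)" for z
  proof -
    obtain x where x: "x \<in> K" "conjugate_on k K z = x \<bullet> z - k x"
      using conjugate_on_attained[OF assms] by metis
    have "\<bar>x \<bullet> z\<bar> \<le> b * norm z"
      using Cauchy_Schwarz_ineq2[of x z] b(2)[OF x(1)] by (meson mult_right_mono norm_ge_zero order_trans)
    moreover have "\<bar>k x\<bar> \<le> b'" using b'(2)[OF x(1)] by simp
    moreover have "0 \<le> b' * norm z" using b' by simp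
    ultimately have "\<bar>conjugate_on k K z\<bar> \<le> b * norm z + b' + b + b' * norm z" using x(2) b(1) by linarith
    then show ?thesis by (simp add: algebra_simps)
  qed
  then show ?thesis using that[of "b + b'"] b b' by auto
qed

text \<open>The hyperplanes \<open>x \<bullet> e = \<alpha>\<close> and
  \<open>x \<bullet> e = \<beta>\<close> bound a slab between the two sets. Along \<open>e\<close>
  the first conjugate rises at rate at least \<open>\<beta>\<close> and the second at rate at most
  \<open>\<alpha>\<close>, so they agree exactly once on each line parallel to \<open>e\<close>. In
  the application \<open>k\<close> is half the quadratic form and \<open>e\<close> a coordinate
  vector.\<close>

locale separated_conjugates =
  fixes K1 K2 :: "'a::euclidean_space set" and k :: "'a \<Rightarrow> real" and e :: 'a and \<alpha> \<beta> :: real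
  assumes compact: "compact K1" "compact K2" and nonempty: "K1 \<noteq> {}" "K2 \<noteq> {}"
    and cont: "continuous_on UNIV k"
    and sep: "\<And>x. x \<in> K1 \<Longrightarrow> \<beta> \<le> x \<bullet> e" "\<And>x. x \<in> K2 \<Longrightarrow> x \<bullet> e \<le> \<alpha>" "\<alpha> < \<beta>"
begin

lemma cont_on: "continuous_on A k"
  using cont continuous_on_subset by blast

abbreviation "\<phi>1 \<equiv> conjugate_on k K1"
abbreviation "\<phi>2 \<equiv> conjugate_on k K2"

lemmas attained1 = conjugate_on_attained[OF compact(1) nonempty(1) cont_on]
lemmas attained2 = conjugate_on_attained[OF compact(2) nonempty(2) cont_on]
lemmas upper1 = conjugate_on_upper[OF compact(1) cont_on]
lemmas upper2 = conjugate_on_upper[OF compact(2) cont_on]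

text \<open>A maximizer at the starting point competes at the end point; in \<open>slope2\<close> it
  is a maximizer at the end point that competes at the start.\<close>

lemma slope1: "0 \<le> s \<Longrightarrow> \<phi>1 z + \<beta> * s \<le> \<phi>1 (z + s *\<^sub>R e)"
proof -
  assume s: "0 \<le> s"
  obtain x where x: "x \<in> K1" "\<phi>1 z = x \<bullet> z - k x" using attained1 by metis
  have "\<beta> * s \<le> (x \<bullet> e) * s" using sep(1)[OF x(1)] s by (rule mult_right_mono)
  with upper1[OF x(1), of "z + s *\<^sub>R e"] x(2) show ?thesis
    by (simp add: inner_simps algebra_simps)
qed

lemma slope2: "0 \<le> s \<Longrightarrow> \<phi>2 (z + s *\<^sub>R e) \<le> \<phi>2 z + \<alpha> * s"
proof -
  assume s: "0 \<le> s"
  obtain x where x: "x \<in> K2" "\<phi>2 (z + s *\<^sub>R e) = x \<bullet> (z + s *\<^sub>R e) - k x" using attained2 by metis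
  have "(x \<bullet> e) * s \<le> \<alpha> * s" using sep(2)[OF x(1)] s by (rule mult_right_mono)
  with upper2[OF x(1), of z] x(2) show ?thesis
    by (simp add: inner_simps algebra_simps)
qed

definition gap :: "'a \<Rightarrow> real" where "gap z = \<phi>1 z - \<phi>2 z"

lemma gap_slope: "s \<le> t \<Longrightarrow> gap (z + s *\<^sub>R e) + (\<beta> - \<alpha>) * (t - s) \<le> gap (z + t *\<^sub>R e)"
  using slope1[of "t - s" "z + s *\<^sub>R e"] slope2[of "t - s" "z + s *\<^sub>R e"]
  by (simp add: gap_def algebra_simps)

lemma continuous_gap: "continuous_on UNIV gap"
  unfolding gap_def
  by (intro continuous_intros convex_on_continuous conjugate_on_convex compact nonempty cont_on) auto

lemma gap_crossing_ex1: "\<exists>!t. gap (z + t *\<^sub>R e) = 0"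
proof -
  let ?c = "\<beta> - \<alpha>" and ?F = "\<lambda>t. gap (z + t *\<^sub>R e)"
  \<comment> \<open>At distance \<open>b\<close> the slope \<open>\<beta> - \<alpha>\<close> has
    used up the whole value of \<open>gap z\<close>, so the sign has changed by then.\<close>
  define b where "b = \<bar>gap z\<bar> / ?c"
  have c: "?c > 0" and b: "0 \<le> b" "?c * b = \<bar>gap z\<bar>" using sep(3) by (auto simp: b_def)
  have "?F (- b) \<le> 0" using gap_slope[of "- b" 0 z] b by simp
  moreover have "0 \<le> ?F b" using gap_slope[of 0 b z] b by simp
  moreover have "continuous_on {-b..b} ?F"
    by (intro continuous_on_compose2[OF continuous_gap] continuous_intros) auto
  ultimately obtain t where t: "?F t = 0" using IVT'[of ?F "-b" 0 b] b by auto
  moreover have "t' = t" if "?F t' = 0" for t'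
  proof (rule ccontr)
    assume "t' \<noteq> t"
    then have "?c * \<bar>t' - t\<bar> > 0" using c by simp
    then show False using gap_slope[of t t' z] gap_slope[of t' t z] t that
      by (cases "t \<le> t'") auto
  qed
  ultimately show ?thesis by blast
qed

text \<open>Signed distance along \<open>e\<close> from \<open>z\<close> to the surface
  \<open>gap = 0\<close>, which is thus the zero set of \<open>crossing\<close>. By
  \<open>crossing_shift\<close> its negative will be a coordinate plus a function of the other
  coordinates.\<close>

definition crossing :: "'a \<Rightarrow> real" where "crossing z = (THE t. gap (z + t *\<^sub>R e) = 0)"

lemma gap_crossing: "gap (z + crossing z *\<^sub>R e) = 0"
  unfolding crossing_def by (rule theI'[OF gap_crossing_ex1])

lemma crossing_unique: "gap (z + t *\<^sub>R e) = 0 \<Longrightarrow> crossing z = t"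
  using gap_crossing_ex1[of z] gap_crossing[of z] by blast

lemma crossing_shift: "crossing (z + s *\<^sub>R e) = crossing z - s"
  using gap_crossing[of z] by (intro crossing_unique) (simp add: algebra_simps)

lemma crossing_bound: "(\<beta> - \<alpha>) * \<bar>crossing z\<bar> \<le> \<bar>gap z\<bar>"
  using gap_slope[of 0 "crossing z" z] gap_slope[of "crossing z" 0 z] gap_crossing[of z]
  by (cases "0 \<le> crossing z") auto

definition level :: "'a \<Rightarrow> real" where "level z = \<phi>1 (z + crossing z *\<^sub>R e)"

lemma level_eq2: "level z = \<phi>2 (z + crossing z *\<^sub>R e)"
  using gap_crossing[of z] by (simp add: level_def gap_def)

lemma level_shift: "level (z + s *\<^sub>R e) = level z"
  by (simp add: level_def crossing_shift algebra_simps)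

text \<open>This is the partial minimum over \<open>t\<close> of the jointly convex function
  \<open>max (\<phi>1 (z + t e)) (\<phi>2 (z + t e)) - \<mu> t\<close>. Having it convex for two
  different slopes \<open>\<mu>\<close> exhibits \<open>crossing\<close> as a difference of convex functions.\<close>

definition tilt :: "real \<Rightarrow> 'a \<Rightarrow> real" where "tilt \<mu> z = level z - \<mu> * crossing z"

text \<open>Subtracting \<open>\<mu> * t\<close> with \<open>\<mu>\<close> between the two rates
  keeps the crossing a minimizer: beyond it \<open>\<phi>1\<close> has risen at rate at least
  \<open>\<beta>\<close>, and before it \<open>\<phi>2\<close>, which rises at rate at most
  \<open>\<alpha>\<close>, is still high enough.\<close>

lemma tilt_le:
  assumes "\<alpha> \<le> \<mu>" "\<mu> \<le> \<beta>"
  shows "tilt \<mu> z \<le> max (\<phi>1 (z + t *\<^sub>R e)) (\<phi>2 (z + t *\<^sub>R e)) - \<mu> * t"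
proof (cases "crossing z \<le> t")
  case True
  then have "\<mu> * (t - crossing z) \<le> \<beta> * (t - crossing z)" using assms by (intro mult_right_mono) auto
  moreover have "level z + \<beta> * (t - crossing z) \<le> \<phi>1 (z + t *\<^sub>R e)"
    using slope1[of "t - crossing z" "z + crossing z *\<^sub>R e"] True by (simp add: level_def algebra_simps)
  ultimately show ?thesis by (simp add: tilt_def algebra_simps)
next
  case False
  then have "\<alpha> * (crossing z - t) \<le> \<mu> * (crossing z - t)" using assms by (intro mult_right_mono) auto
  moreover have "level z \<le> \<phi>2 (z + t *\<^sub>R e) + \<alpha> * (crossing z - t)"
    using slope2[of "crossing z - t" "z + t *\<^sub>R e"] False by (simp add: level_eq2 algebra_simps)
  ultimately show ?thesis by (simp add: tilt_def algebra_simps)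
qed

text \<open>A partial minimum of a jointly convex function is convex. The competitor is the convex
  combination \<open>?r\<close> of the two crossings, where both conjugates lie below the same
  combination of the levels.\<close>

lemma tilt_convex:
  assumes "\<alpha> \<le> \<mu>" "\<mu> \<le> \<beta>"
  shows "convex_on UNIV (tilt \<mu>)"
proof (intro convex_onI)
  fix t :: real and y z :: 'a assume t: "0 < t" "t < 1"
  let ?w = "(1 - t) *\<^sub>R y + t *\<^sub>R z" and ?r = "(1 - t) * crossing y + t * crossing z"
  have eq: "?w + ?r *\<^sub>R e = (1 - t) *\<^sub>R (y + crossing y *\<^sub>R e) + t *\<^sub>R (z + crossing z *\<^sub>R e)"
    by (simp add: algebra_simps)
  have "\<phi>1 (?w + ?r *\<^sub>R e) \<le> (1 - t) * level y + t * level z"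
    unfolding eq level_def
    using t by (intro convex_onD[where A = UNIV] conjugate_on_convex compact nonempty cont_on) auto
  moreover have "\<phi>2 (?w + ?r *\<^sub>R e) \<le> (1 - t) * level y + t * level z"
    unfolding eq level_eq2
    using t by (intro convex_onD[where A = UNIV] conjugate_on_convex compact nonempty cont_on) auto
  ultimately show "tilt \<mu> ?w \<le> (1 - t) * tilt \<mu> y + t * tilt \<mu> z"
    using tilt_le[OF assms, of ?w ?r] by (simp add: tilt_def algebra_simps)
qed auto

lemma tilt_linear_growth: "\<exists>c. \<forall>z. \<bar>tilt \<mu> z\<bar> \<le> c * (1 + norm z)"
proof -
  obtain c1 where c1: "c1 \<ge> 0" "\<And>z. \<bar>\<phi>1 z\<bar> \<le> c1 * (1 + norm z)"
    using conjugate_on_linear_growth[OF compact(1) nonempty(1) cont_on] by blast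
  obtain c2 where c2: "c2 \<ge> 0" "\<And>z. \<bar>\<phi>2 z\<bar> \<le> c2 * (1 + norm z)"
    using conjugate_on_linear_growth[OF compact(2) nonempty(2) cont_on] by blast
  define d where "d = (c1 + c2) / (\<beta> - \<alpha>)"
  have d: "0 \<le> d" using c1 c2 sep(3) by (simp add: d_def)
  have crossing: "\<bar>crossing z\<bar> \<le> d * (1 + norm z)" for z
  proof -
    have "(\<beta> - \<alpha>) * \<bar>crossing z\<bar> \<le> (c1 + c2) * (1 + norm z)"
      using crossing_bound[of z] c1(2)[of z] c2(2)[of z] by (simp add: gap_def algebra_simps)
    then show ?thesis using sep(3) by (simp add: d_def field_simps)
  qed
  have "\<bar>tilt \<mu> z\<bar> \<le> (c1 * (1 + d * norm e) + \<bar>\<mu>\<bar> * d) * (1 + norm z)" for z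
  proof -
    have "norm (z + crossing z *\<^sub>R e) \<le> norm z + \<bar>crossing z\<bar> * norm e"
      using norm_triangle_ineq[of z "crossing z *\<^sub>R e"] by simp
    also have "\<dots> \<le> norm z + d * (1 + norm z) * norm e"
      using crossing by (intro add_left_mono mult_right_mono) auto
    finally have "1 + norm (z + crossing z *\<^sub>R e) \<le> (1 + d * norm e) * (1 + norm z)"
      by (simp add: algebra_simps)
    then have "\<bar>level z\<bar> \<le> c1 * ((1 + d * norm e) * (1 + norm z))"
      unfolding level_def using c1 by (meson mult_left_mono order_trans)
    moreover have "\<bar>\<mu> * crossing z\<bar> \<le> \<bar>\<mu>\<bar> * (d * (1 + norm z))"
      unfolding abs_mult using crossing by (intro mult_left_mono) auto
    ultimately show ?thesis by (simp add: tilt_def algebra_simps)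
  qed
  then show ?thesis by blast
qed

lemma crossing_eq_tilt: "crossing z = (tilt \<alpha> z - tilt \<beta> z) / (\<beta> - \<alpha>)"
  using sep(3) by (simp add: tilt_def field_simps)

lemma continuous_crossing: "continuous_on UNIV crossing"
  unfolding crossing_eq_tilt
  using sep(3) by (intro continuous_intros convex_on_continuous tilt_convex) auto

text \<open>Envelope argument. For a maximizer \<open>x\<close> at the crossing point,
  \<open>x \<bullet> (y + crossing y *\<^sub>R e) - k x\<close> lies below \<open>level y\<close>
  and touches it at \<open>y = z\<close>, so the derivatives agree there. Using a maximizer from
  each set eliminates the derivative of \<open>level\<close> and leaves that of
  \<open>crossing\<close>.\<close>

lemma crossing_derivative:
  assumes crossing: "(crossing has_derivative r') (at z)" and level: "(level has_derivative l') (at z)"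
  obtains x1 x2 where "x1 \<in> K1" "x2 \<in> K2" "\<And>v. - r' v = ((x1 - x2) /\<^sub>R ((x1 - x2) \<bullet> e)) \<bullet> v"
proof -
  have touch: "l' v = x \<bullet> (v + r' v *\<^sub>R e)"
    if x: "\<And>y. x \<bullet> (y + crossing y *\<^sub>R e) - k x \<le> level y" "level z = x \<bullet> (z + crossing z *\<^sub>R e) - k x" for x v
  proof -
    define E where "E y = level y - (x \<bullet> (y + crossing y *\<^sub>R e) - k x)" for y
    have "(E has_derivative (\<lambda>v. l' v - x \<bullet> (v + r' v *\<^sub>R e))) (at z)"
      unfolding E_def by (auto intro!: derivative_eq_intros crossing level)
    moreover have "\<forall>y\<in>UNIV. E z \<le> E y" using x by (simp add: E_def)
    ultimately have "(\<lambda>v. l' v - x \<bullet> (v + r' v *\<^sub>R e)) = (\<lambda>v. 0)"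
      using differential_zero_maxmin[of z UNIV E] by auto
    then show ?thesis by (metis right_minus_eq)
  qed
  obtain x1 where x1: "x1 \<in> K1" "\<phi>1 (z + crossing z *\<^sub>R e) = x1 \<bullet> (z + crossing z *\<^sub>R e) - k x1" using attained1 by metis
  obtain x2 where x2: "x2 \<in> K2" "\<phi>2 (z + crossing z *\<^sub>R e) = x2 \<bullet> (z + crossing z *\<^sub>R e) - k x2" using attained2 by metis
  have "l' v = x1 \<bullet> (v + r' v *\<^sub>R e)" for v
    using touch[of x1 v] upper1[OF x1(1)] x1(2) by (auto simp: level_def)
  moreover have "l' v = x2 \<bullet> (v + r' v *\<^sub>R e)" for v
    using touch[of x2 v] upper2[OF x2(1)] x2(2) by (auto simp: level_eq2)
  ultimately have eq: "(x1 - x2) \<bullet> v = - r' v * ((x1 - x2) \<bullet> e)" for v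
    by (simp add: inner_simps algebra_simps)
  have "(x1 - x2) \<bullet> e > 0"
    using sep(1)[OF x1(1)] sep(2)[OF x2(1)] sep(3) by (simp add: inner_simps)
  then have "- r' v = ((x1 - x2) /\<^sub>R ((x1 - x2) \<bullet> e)) \<bullet> v" for v
    using eq[of v] by simp
  then show ?thesis using x1(1) x2(1) that by blast
qed

end

section \<open>Coordinates of R^{2m} and surfaces with normalized differences as normals\<close>

definition unit_vec :: "('m + 'm) \<Rightarrow> ('m::finite) pt" where
  "unit_vec j = (case j of Inl i \<Rightarrow> (axis i 1, 0) | Inr i \<Rightarrow> (0, axis i 1))"

lemma coord_eq_inner: "coord x j = x \<bullet> unit_vec j"
  by (cases x) (simp add: coord_def unit_vec_def inner_axis split: sum.split)

lemma coord_unit_vec [simp]: "coord (unit_vec j) j = 1"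
  by (simp add: coord_def unit_vec_def split: sum.split)

lemma drop_coord_eq: "drop_coord j x = x - coord x j *\<^sub>R unit_vec j"
  by (cases x)
    (auto simp: drop_coord_def coord_def unit_vec_def vec_eq_iff axis_def split: sum.split)

lemma drop_coord_in_hyperplane: "drop_coord j x \<in> hyperplane j"
  by (simp add: hyperplane_def drop_coord_eq coord_eq_inner inner_simps)
     (simp flip: coord_eq_inner)

lemma pt_eq_iff_coord: "x = y \<longleftrightarrow> (\<forall>j. coord x j = coord y j)"
proof
  assume eq: "\<forall>j. coord x j = coord y j"
  have "fst x $ i = fst y $ i" "snd x $ i = snd y $ i" for i
    using eq[THEN spec, of "Inl i"] eq[THEN spec, of "Inr i"] by (auto simp: coord_def)
  then show "x = y" by (auto simp: prod_eq_iff vec_eq_iff)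
qed simp

lemma Sform_eq_inner: "Sform x y = x \<bullet> Smap y"
  by (cases x, cases y) (simp add: Sform_def Smap_def)

lemma continuous_on_Smap [continuous_intros]: "continuous_on A f \<Longrightarrow> continuous_on A (\<lambda>x. Smap (f x))"
  unfolding Smap_def by (intro continuous_intros)

lemma continuous_on_Sform [continuous_intros]:
  "continuous_on A f \<Longrightarrow> continuous_on A g \<Longrightarrow> continuous_on A (\<lambda>x. Sform (f x) (g x))"
  unfolding Sform_def by (intro continuous_intros)

lemma continuous_on_coord [continuous_intros]:
  "continuous_on A f \<Longrightarrow> continuous_on A (\<lambda>x. coord (f x) j)"
  unfolding coord_eq_inner by (intro continuous_intros)

lemma Sform_scaleR: "Sform (c *\<^sub>R x) (d *\<^sub>R y) = c * d * Sform x y"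
  by (simp add: Sform_def algebra_simps)

lemma Sform_minus_commute: "Sform (x - y) (x - y) = Sform (y - x) (y - x)"
  by (simp add: Sform_def inner_simps)

text \<open>As a function of \<open>y\<close> this is the tangent of half the quadratic form at
  \<open>x\<close>, so \<open>psi A\<close> is the supremum of the tangents at the points of
  \<open>A\<close>.\<close>

definition minorant :: "('m::finite) pt \<Rightarrow> 'm pt \<Rightarrow> real" where
  "minorant x y = Sform x y - Sform x x / 2"

text \<open>The gradient found in \<open>crossing_derivative\<close> for
  \<open>e = unit_vec j\<close>; the scaling makes its \<open>j\<close>-th coordinate 1, as
  \<open>in_H\<close> demands of normals.\<close>

definition unit_slope :: "('m + 'm) \<Rightarrow> ('m::finite) pt \<Rightarrow> 'm pt \<Rightarrow> 'm pt" where
  "unit_slope j x1 x2 = (x1 - x2) /\<^sub>R (coord x1 j - coord x2 j)"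

lemma unit_slope_commute: "unit_slope j x1 x2 = unit_slope j x2 x1"
proof -
  have "(x1 - x2) /\<^sub>R (coord x1 j - coord x2 j) = (- (x2 - x1)) /\<^sub>R (- (coord x2 j - coord x1 j))"
    by simp
  also have "\<dots> = (x2 - x1) /\<^sub>R (coord x2 j - coord x1 j)"
    by (simp only: inverse_minus_eq scaleR_minus_left scaleR_minus_right minus_minus)
  finally show ?thesis by (simp add: unit_slope_def)
qed

text \<open>By \<open>crossing_shift\<close> and \<open>crossing_eq_tilt\<close>, minus the crossing
  is the \<open>j\<close>-th coordinate plus a difference of convex functions of the remaining ones:
  the tilts with slopes \<open>\<beta>\<close> and \<open>\<alpha>\<close>, divided by
  \<open>\<beta> - \<alpha>\<close>.\<close>

lemma in_H_crossing:
  fixes K1 K2 :: "('m::finite) pt set"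
  assumes "separated_conjugates K1 K2 k (unit_vec j) \<alpha> \<beta>"
  shows "in_H j ((\<lambda>(x1, x2). unit_slope j x1 x2) ` (K1 \<times> K2))
    (\<lambda>z. - separated_conjugates.crossing K1 K2 k (unit_vec j) z)"
proof -
  interpret separated_conjugates K1 K2 k "unit_vec j" \<alpha> \<beta> by fact
  let ?D = "drop_coord j" and ?C = "(\<lambda>(x1, x2). unit_slope j x1 x2) ` (K1 \<times> K2)"
  have ne: "coord x1 j > coord x2 j" if "x1 \<in> K1" "x2 \<in> K2" for x1 x2
    using sep(1)[OF that(1)] sep(2)[OF that(2)] sep(3) by (simp add: coord_eq_inner)
  have "continuous_on (K1 \<times> K2) (\<lambda>(x1, x2). unit_slope j x1 x2)"
    unfolding unit_slope_def case_prod_unfold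
    by (intro continuous_intros) (use ne in force)
  then have "compact ?C"
    using compact by (intro compact_continuous_image compact_Times)
  moreover have "?C \<subseteq> {y. coord y j = 1}"
  proof -
    have "coord (unit_slope j x1 x2) j = 1" if "x1 \<in> K1" "x2 \<in> K2" for x1 x2
      using ne[OF that] by (simp add: unit_slope_def coord_eq_inner inner_simps)
    then show ?thesis by auto
  qed
  moreover
  let ?g = "\<lambda>\<mu> z. tilt \<mu> z / (\<beta> - \<alpha>)"
  have "lin_growth_convex j (?g \<mu>)" if "\<alpha> \<le> \<mu>" "\<mu> \<le> \<beta>" for \<mu>
    unfolding lin_growth_convex_def
  proof
    have "convex_on UNIV (\<lambda>z. inverse (\<beta> - \<alpha>) * tilt \<mu> z)"
      using tilt_convex[OF that] sep(3) by (intro convex_on_cmul) auto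
    moreover have "convex (hyperplane j)"
      unfolding hyperplane_def coord_eq_inner inner_commute[of _ "unit_vec j"] by (rule convex_hyperplane)
    ultimately show "convex_on (hyperplane j) (?g \<mu>)"
      by (auto intro: convex_on_subset simp: field_simps)
    obtain c where c: "\<And>z. \<bar>tilt \<mu> z\<bar> \<le> c * (1 + norm z)" using tilt_linear_growth by blast
    have "\<bar>?g \<mu> z\<bar> \<le> c / (\<beta> - \<alpha>) * (1 + norm z)" for z
      using divide_right_mono[OF c[of z], of "\<beta> - \<alpha>"] sep(3) by simp
    then show "\<exists>c. \<forall>z\<in>hyperplane j. \<bar>?g \<mu> z\<bar> \<le> c * (1 + norm z)" by blast
  qed
  moreover
  have crossing_drop: "crossing z = ?g \<alpha> (?D z) - ?g \<beta> (?D z) - coord z j" for z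
    using crossing_shift[of z "- coord z j"] crossing_eq_tilt[of "?D z"]
    by (simp add: drop_coord_eq diff_divide_distrib)
  have level_drop: "level z = level (?D z)" for z
    using level_shift[of z "- coord z j"] by (simp add: drop_coord_eq)
  have "(\<lambda>z. - crossing z) = (\<lambda>x. coord x j + ?g \<beta> (?D x) - ?g \<alpha> (?D x))"
    by (rule ext) (simp add: crossing_drop)
  moreover have "\<exists>D\<in>?C. ((\<lambda>z. - crossing z) has_derivative (\<lambda>v. D \<bullet> v)) (at x)"
    if d: "?g \<beta> differentiable (at (?D x) within hyperplane j)"
      "?g \<alpha> differentiable (at (?D x) within hyperplane j)" for x
  proof -
    have lin: "?D differentiable (at x)"
      unfolding drop_coord_eq coord_eq_inner by (intro derivative_intros) auto
    \<comment> \<open>Differentiability within the hyperplane is enough, because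
      \<open>drop_coord j\<close> maps everything into it.\<close>
    have comp: "(\<lambda>z. ?g \<mu> (?D z)) differentiable (at x)"
      if "?g \<mu> differentiable (at (?D x) within hyperplane j)" for \<mu>
    proof (rule differentiable_in_compose[where f = "?g \<mu>", OF _ lin])
      show "?g \<mu> differentiable (at (?D x) within range ?D)"
        by (rule differentiable_within_subset[OF that]) (use drop_coord_in_hyperplane in blast)
    qed
    have eq: "crossing = (\<lambda>z. ?g \<alpha> (?D z) - ?g \<beta> (?D z) - z \<bullet> unit_vec j)"
      by (rule ext) (simp add: crossing_drop coord_eq_inner)
    have "crossing differentiable (at x)"
      unfolding eq by (intro derivative_intros comp d) auto
    then obtain r' where r': "(crossing has_derivative r') (at x)"
      by (auto simp: differentiable_def)
    \<comment> \<open>\<open>crossing_derivative\<close> also wants \<open>level\<close>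
      differentiable; eliminating \<open>crossing\<close> between the two tilts expresses
      \<open>level\<close> by them.\<close>
    have "level w = \<beta> * ?g \<alpha> w - \<alpha> * ?g \<beta> w" for w
      using sep(3) by (simp add: tilt_def divide_simps) (simp add: algebra_simps)
    then have eq: "level = (\<lambda>z. \<beta> * ?g \<alpha> (?D z) - \<alpha> * ?g \<beta> (?D z))"
      using level_drop by fastforce
    have "level differentiable (at x)"
      unfolding eq by (intro differentiable_diff differentiable_mult differentiable_const comp d)
    then obtain l' where l': "(level has_derivative l') (at x)"
      by (auto simp: differentiable_def)
    obtain x1 x2 where x: "x1 \<in> K1" "x2 \<in> K2" "\<And>v. - r' v = ((x1 - x2) /\<^sub>R ((x1 - x2) \<bullet> unit_vec j)) \<bullet> v"
      using crossing_derivative[OF r' l'] by blast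
    have "((\<lambda>z. - crossing z) has_derivative (\<lambda>v. unit_slope j x1 x2 \<bullet> v)) (at x)"
      using has_derivative_minus[OF r'] unfolding x(3) by (simp add: unit_slope_def coord_eq_inner inner_diff_left)
    then show ?thesis using x(1,2) by blast
  qed
  ultimately show ?thesis
    unfolding in_H_def using sep(3) by (intro conjI exI[of _ "?g \<beta>"] exI[of _ "?g \<alpha>"]) auto
qed

section \<open>Countably many surfaces that carry all pairs of distinct maximizers\<close>

definition co_maximizers :: "('m::finite) pt set \<Rightarrow> 'm pt set \<Rightarrow> 'm pt \<Rightarrow> 'm pt \<Rightarrow> 'm pt \<Rightarrow> bool" where
  "co_maximizers A B y a b \<longleftrightarrow> a \<in> A \<and> b \<in> B \<and> minorant a y = minorant b y \<and>
     (\<forall>x\<in>A \<union> B. minorant x y \<le> minorant a y)"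

lemma co_maximizers_commute: "co_maximizers A B y a b \<longleftrightarrow> co_maximizers B A y b a"
  by (auto simp: co_maximizers_def)

definition cross_monotone :: "('m::finite) pt set \<Rightarrow> 'm pt set \<Rightarrow> bool" where
  "cross_monotone A B \<longleftrightarrow> (\<forall>a\<in>A. \<forall>b\<in>B. Sform (a - b) (a - b) \<ge> 0)"

lemma cross_monotone_commute: "cross_monotone A B \<longleftrightarrow> cross_monotone B A"
  unfolding cross_monotone_def by (metis Sform_minus_commute)

text \<open>Compact pieces have to be cut from the closures of \<open>A\<close> and
  \<open>B\<close>; the relation is a closed condition and survives.\<close>

lemma cross_monotone_closure:
  assumes "cross_monotone A B" shows "cross_monotone (closure A) (closure B)"
proof -
  have "closed {p :: 'a pt \<times> 'a pt. 0 \<le> Sform (fst p - snd p) (fst p - snd p)}"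
    by (intro closed_Collect_le continuous_intros)
  moreover have "A \<times> B \<subseteq> {p. 0 \<le> Sform (fst p - snd p) (fst p - snd p)}"
    using assms by (simp add: cross_monotone_def subset_iff mem_Times_iff)
  ultimately have "closure (A \<times> B) \<subseteq> {p. 0 \<le> Sform (fst p - snd p) (fst p - snd p)}"
    by (rule closure_minimal[rotated])
  then show ?thesis by (auto simp: cross_monotone_def closure_Times)
qed

text \<open>With \<open>k x = Sform x x / 2\<close> the minorant of \<open>x\<close> at
  \<open>y\<close> is \<open>x \<bullet> Smap y - k x\<close>. If \<open>a\<close> and
  \<open>b\<close> maximize over \<open>A \<union> B\<close> and lie in the two balls, both
  conjugates at \<open>Smap y\<close> equal the common maximum, so the crossing there is 0.\<close>

lemma separating_surface:
  fixes A B :: "('m::finite) pt set"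
  assumes cross: "cross_monotone A B"
    and good: "\<And>x1 x2. x1 \<in> cball c1 r \<Longrightarrow> x2 \<in> cball c2 r \<Longrightarrow> coord x2 j < coord x1 j \<and> unit_slope j x1 x2 \<in> P"
    and ne: "A \<inter> cball c1 r \<noteq> {}" "B \<inter> cball c2 r \<noteq> {}"
  shows "\<exists>C h. in_H j C h \<and> continuous_on UNIV h \<and> C \<subseteq> {x. coord x j = 1 \<and> Sform x x \<ge> 0} \<inter> P \<and>
    (\<forall>y a b. co_maximizers A B y a b \<longrightarrow> a \<in> cball c1 r \<longrightarrow> b \<in> cball c2 r \<longrightarrow> h (Smap y) = 0)"
proof -
  define K1 where "K1 = closure A \<inter> cball c1 r"
  define K2 where "K2 = closure B \<inter> cball c2 r"
  have compact: "compact K1" "compact K2" by (auto simp: K1_def K2_def)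
  have ne: "K1 \<noteq> {}" "K2 \<noteq> {}" using ne closure_subset[of A] closure_subset[of B] by (auto simp: K1_def K2_def)
  have cont: "continuous_on K (\<lambda>x. coord x j)" for K :: "'m pt set" by (intro continuous_intros)
  \<comment> \<open>The faces of the slab are the smallest \<open>j\<close>-th coordinate on
    \<open>K1\<close> and the largest on \<open>K2\<close>. Being attained, they inherit the strict
    inequality between points of the two balls.\<close>
  obtain a0 where a0: "a0 \<in> K1" "\<And>x. x \<in> K1 \<Longrightarrow> coord a0 j \<le> coord x j"
    using continuous_attains_inf[OF compact(1) ne(1) cont] by blast
  obtain b0 where b0: "b0 \<in> K2" "\<And>x. x \<in> K2 \<Longrightarrow> coord x j \<le> coord b0 j"
    using continuous_attains_sup[OF compact(2) ne(2) cont] by blast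
  define k where "k x = Sform x x / 2" for x :: "'m pt"
  have sepc: "separated_conjugates K1 K2 k (unit_vec j) (coord b0 j) (coord a0 j)"
  proof
    show "coord b0 j < coord a0 j" using good a0(1) b0(1) by (auto simp: K1_def K2_def)
    show "continuous_on UNIV k" unfolding k_def by (intro continuous_intros) auto
  qed (use a0 b0 ne compact in \<open>auto simp: coord_eq_inner\<close>)
  interpret separated_conjugates K1 K2 k "unit_vec j" "coord b0 j" "coord a0 j" by fact
  let ?h = "\<lambda>z. - crossing z" and ?C = "(\<lambda>(x1, x2). unit_slope j x1 x2) ` (K1 \<times> K2)"
  have H: "in_H j ?C ?h" using in_H_crossing[OF sepc] .
  moreover have "continuous_on UNIV ?h" by (intro continuous_intros continuous_crossing)
  moreover have "?C \<subseteq> {x. coord x j = 1 \<and> Sform x x \<ge> 0} \<inter> P"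
  proof -
    have "Sform (unit_slope j x1 x2) (unit_slope j x1 x2) \<ge> 0" if "x1 \<in> K1" "x2 \<in> K2" for x1 x2
      using cross_monotone_closure[OF cross] that
      by (auto simp: unit_slope_def Sform_scaleR K1_def K2_def cross_monotone_def)
    then show ?thesis using H good by (auto simp: in_H_def K1_def K2_def)
  qed
  moreover have "?h (Smap y) = 0"
    if y: "co_maximizers A B y a b" and ab: "a \<in> cball c1 r" "b \<in> cball c2 r" for y a b
  proof -
    have le: "x \<bullet> Smap y - k x \<le> minorant a y" if "x \<in> closure (A \<union> B)" for x
    proof -
      have "closed {x. x \<bullet> Smap y - k x \<le> minorant a y}"
        unfolding k_def by (intro closed_Collect_le continuous_intros) auto
      moreover have "A \<union> B \<subseteq> {x. x \<bullet> Smap y - k x \<le> minorant a y}"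
        using y by (auto simp: co_maximizers_def minorant_def k_def Sform_eq_inner)
      ultimately show ?thesis using closure_minimal that by blast
    qed
    have "a \<in> K1" "b \<in> K2"
      using y ab closure_subset[of A] closure_subset[of B] by (auto simp: co_maximizers_def K1_def K2_def)
    then have "minorant a y \<le> \<phi>1 (Smap y)" "minorant b y \<le> \<phi>2 (Smap y)"
      using upper1[of a "Smap y"] upper2[of b "Smap y"] by (auto simp: minorant_def k_def Sform_eq_inner)
    moreover have "\<phi>1 (Smap y) \<le> minorant a y"
      by (rule attained1[of "Smap y"]) (use le in \<open>auto simp: K1_def\<close>)
    moreover have "\<phi>2 (Smap y) \<le> minorant a y"
      by (rule attained2[of "Smap y"]) (use le in \<open>auto simp: K2_def\<close>)
    moreover have "minorant a y = minorant b y" using y by (simp add: co_maximizers_def)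
    ultimately show ?thesis
      using crossing_unique[of "Smap y" 0] by (simp add: gap_def)
  qed
  ultimately show ?thesis by blast
qed

text \<open>Continuity of \<open>h\<close> is carried along to make its zero set measurable.
  \<open>P\<close> restricts the normals: it will be the set where the form is positive, or where it
  is below a small bound.\<close>

definition surfaces :: "('m::finite) pt set \<Rightarrow> (('m + 'm) \<times> 'm pt set \<times> ('m pt \<Rightarrow> real)) set" where
  "surfaces P = {(j, C, h). in_H j C h \<and> continuous_on UNIV h \<and>
     C \<subseteq> {x. coord x j = 1 \<and> Sform x x \<ge> 0} \<inter> P}"

text \<open>The requirement on \<open>(a, b)\<close> is open, so it holds on a small product of
  balls around that pair. Centers in a countable dense set and radii \<open>1 / real (Suc n)\<close>
  leave countably many products.\<close>

lemma countable_separating_surfaces_oriented: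
  fixes A B :: "('m::finite) pt set"
  assumes cross: "cross_monotone A B" and "open P"
  shows "\<exists>T\<subseteq>surfaces P. countable T \<and>
    (\<forall>y a b j. co_maximizers A B y a b \<longrightarrow> coord b j < coord a j \<longrightarrow> unit_slope j a b \<in> P \<longrightarrow>
       (\<exists>(j, C, h)\<in>T. h (Smap y) = 0))"
proof -
  obtain Z :: "'m pt set" where Z: "countable Z" "\<And>X. open X \<Longrightarrow> X \<noteq> {} \<Longrightarrow> \<exists>d\<in>Z. d \<in> X"
    using countable_dense_exists by blast
  define good where "good = (\<lambda>(j, c1, c2, n).
     (\<forall>x1\<in>cball c1 (1 / real (Suc n)). \<forall>x2\<in>cball c2 (1 / real (Suc n)).
        coord x2 j < coord x1 j \<and> unit_slope j x1 x2 \<in> P) \<and>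
     A \<inter> cball c1 (1 / real (Suc n)) \<noteq> {} \<and> B \<inter> cball c2 (1 / real (Suc n)) \<noteq> {})"
  define I where "I = {i \<in> (UNIV :: ('m + 'm) set) \<times> Z \<times> Z \<times> (UNIV :: nat set). good i}"
  have "countable I"
    unfolding I_def using Z(1) by (intro countable_Collect countable_SIGMA) (auto intro: countable_finite)
  define ok where "ok = (\<lambda>(j, c1, c2, n) (C, h).
     in_H j C h \<and> continuous_on UNIV h \<and> C \<subseteq> {x. coord x j = 1 \<and> Sform x x \<ge> 0} \<inter> P \<and>
     (\<forall>y a b. co_maximizers A B y a b \<longrightarrow> a \<in> cball c1 (1 / real (Suc n)) \<longrightarrow>
        b \<in> cball c2 (1 / real (Suc n)) \<longrightarrow> h (Smap y) = 0))"
  have "\<exists>Ch. ok i Ch" if "i \<in> I" for i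
  proof -
    from that obtain j c1 c2 n where i: "i = (j, c1, c2, n)" "good (j, c1, c2, n)" by (auto simp: I_def)
    let ?r = "1 / real (Suc n)"
    have g: "\<forall>x1\<in>cball c1 ?r. \<forall>x2\<in>cball c2 ?r. coord x2 j < coord x1 j \<and> unit_slope j x1 x2 \<in> P"
      "A \<inter> cball c1 ?r \<noteq> {}" "B \<inter> cball c2 ?r \<noteq> {}"
      using i(2) unfolding good_def prod.case by blast+
    have "\<exists>C h. ok i (C, h)"
      unfolding ok_def i(1) prod.case by (rule separating_surface[OF cross _ g(2,3)]) (use g(1) in blast)
    then show ?thesis by blast
  qed
  then obtain F where F: "\<And>i. i \<in> I \<Longrightarrow> ok i (F i)" by metis
  let ?T = "(\<lambda>i. (fst i, F i)) ` I"
  show ?thesis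
  proof (intro exI[of _ ?T] conjI allI impI)
    show "countable ?T" using \<open>countable I\<close> by simp
    show "?T \<subseteq> surfaces P"
    proof
      fix t assume "t \<in> ?T"
      then obtain j c1 c2 n C h where t: "(j, c1, c2, n) \<in> I" "F (j, c1, c2, n) = (C, h)" "t = (j, C, h)"
        by (cases t) auto
      then have "ok (j, c1, c2, n) (C, h)" using F by metis
      then show "t \<in> surfaces P" unfolding ok_def surfaces_def t(3) prod.case by blast
    qed
    fix y a b j assume ab: "co_maximizers A B y a b" "coord b j < coord a j" "unit_slope j a b \<in> P"
    define W where "W = {p :: 'm pt \<times> 'm pt. coord (snd p) j < coord (fst p) j}"
    have "open W" unfolding W_def by (intro open_Collect_less continuous_intros)
    moreover have "continuous_on W (\<lambda>p. unit_slope j (fst p) (snd p))"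
      unfolding unit_slope_def W_def by (intro continuous_intros) auto
    ultimately have "open (W \<inter> (\<lambda>p. unit_slope j (fst p) (snd p)) -` P)"
      using \<open>open P\<close> by (intro continuous_open_preimage)
    moreover have "(a, b) \<in> W \<inter> (\<lambda>p. unit_slope j (fst p) (snd p)) -` P"
      using ab by (simp add: W_def)
    ultimately obtain X1 X2 where X: "open X1" "open X2" "(a, b) \<in> X1 \<times> X2"
      "X1 \<times> X2 \<subseteq> W \<inter> (\<lambda>p. unit_slope j (fst p) (snd p)) -` P"
      by (rule open_prod_elim)
    obtain e1 e2 where e: "e1 > 0" "e2 > 0" "ball a e1 \<subseteq> X1" "ball b e2 \<subseteq> X2"
      using X(1-3) by (meson open_contains_ball mem_Sigma_iff)
    \<comment> \<open>The center is within one radius of \<open>a\<close> (or \<open>b\<close>) and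
      the closed ball reaches one radius further, so two radii must fit.\<close>
    obtain n where n: "1 / real (Suc n) < min e1 e2 / 2"
      using e nat_approx_posE[of "min e1 e2 / 2"] by auto
    let ?r = "1 / real (Suc n)"
    obtain c1 where c1: "c1 \<in> Z" "dist a c1 < ?r"
      using Z(2)[of "ball a ?r"] by (auto simp del: of_nat_Suc)
    obtain c2 where c2: "c2 \<in> Z" "dist b c2 < ?r"
      using Z(2)[of "ball b ?r"] by (auto simp del: of_nat_Suc)
    have "cball c1 ?r \<subseteq> ball a e1"
    proof
      fix x assume "x \<in> cball c1 ?r"
      then show "x \<in> ball a e1" using c1(2) n dist_triangle[of a x c1] by (simp add: dist_commute del: of_nat_Suc)
    qed
    then have s1: "cball c1 ?r \<subseteq> X1" using e by blast
    have "cball c2 ?r \<subseteq> ball b e2"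
    proof
      fix x assume "x \<in> cball c2 ?r"
      then show "x \<in> ball b e2" using c2(2) n dist_triangle[of b x c2] by (simp add: dist_commute del: of_nat_Suc)
    qed
    then have s2: "cball c2 ?r \<subseteq> X2" using e by blast
    have in_balls: "a \<in> cball c1 ?r" "b \<in> cball c2 ?r" using c1 c2 by (auto simp: dist_commute)
    have "coord x2 j < coord x1 j \<and> unit_slope j x1 x2 \<in> P" if "x1 \<in> cball c1 ?r" "x2 \<in> cball c2 ?r" for x1 x2
    proof -
      have "(x1, x2) \<in> X1 \<times> X2" using that s1 s2 by blast
      then show ?thesis using X(4) by (auto simp: W_def)
    qed
    moreover have "a \<in> A" "b \<in> B" using ab(1) by (auto simp: co_maximizers_def)
    ultimately have "good (j, c1, c2, n)"
      unfolding good_def using in_balls by blast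
    then have "(j, c1, c2, n) \<in> I" using c1 c2 by (simp add: I_def)
    then have "ok (j, c1, c2, n) (F (j, c1, c2, n))" and T: "(j, F (j, c1, c2, n)) \<in> ?T"
      by (auto intro: F rev_image_eqI)
    then have "snd (F (j, c1, c2, n)) (Smap y) = 0"
      unfolding ok_def case_prod_unfold fst_conv snd_conv using in_balls ab(1) by blast
    then show "\<exists>(j, C, h)\<in>?T. h (Smap y) = 0"
      using T by (intro bexI[OF _ T]) (simp add: case_prod_unfold)
  qed
qed

text \<open>Distinct points differ in some coordinate, with either sign. For the other sign
  \<open>A\<close> and \<open>B\<close> change roles, which leaves the normalized difference
  unchanged. As the coordinate is not known in advance, membership in \<open>P\<close> is asked for
  every scaling of \<open>a - b\<close>.\<close>

lemma countable_separating_surfaces: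
  fixes A B :: "('m::finite) pt set"
  assumes cross: "cross_monotone A B" and "open P"
  obtains T where "T \<subseteq> surfaces P" "countable T"
    "\<And>y a b. co_maximizers A B y a b \<Longrightarrow> a \<noteq> b \<Longrightarrow> (\<And>c. c \<noteq> 0 \<Longrightarrow> (a - b) /\<^sub>R c \<in> P) \<Longrightarrow>
       \<exists>(j, C, h)\<in>T. h (Smap y) = 0"
proof -
  obtain T where T: "T \<subseteq> surfaces P" "countable T"
    "\<forall>y a b j. co_maximizers A B y a b \<longrightarrow> coord b j < coord a j \<longrightarrow> unit_slope j a b \<in> P \<longrightarrow>
       (\<exists>(j, C, h)\<in>T. h (Smap y) = 0)"
    using countable_separating_surfaces_oriented[OF assms] by blast
  obtain T' where T': "T' \<subseteq> surfaces P" "countable T'"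
    "\<forall>y a b j. co_maximizers B A y a b \<longrightarrow> coord b j < coord a j \<longrightarrow> unit_slope j a b \<in> P \<longrightarrow>
       (\<exists>(j, C, h)\<in>T'. h (Smap y) = 0)"
    using countable_separating_surfaces_oriented[OF cross[unfolded cross_monotone_commute[of A]] \<open>open P\<close>]
    by blast
  show ?thesis
  proof (rule that[of "T \<union> T'"])
    fix y a b assume ab: "co_maximizers A B y a b" "a \<noteq> b" "\<And>c. c \<noteq> 0 \<Longrightarrow> (a - b) /\<^sub>R c \<in> P"
    obtain j where j: "coord a j \<noteq> coord b j" using ab(2) pt_eq_iff_coord by blast
    then have P: "unit_slope j a b \<in> P" unfolding unit_slope_def by (intro ab(3)) simp
    show "\<exists>(j, C, h)\<in>T \<union> T'. h (Smap y) = 0"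
    proof (cases "coord b j < coord a j")
      case True
      then show ?thesis using T(3) ab(1) P by blast
    next
      case False
      then have "coord a j < coord b j" using j by simp
      moreover have "co_maximizers B A y b a" using ab(1) co_maximizers_commute by blast
      moreover have "unit_slope j b a \<in> P" using P by (simp only: unit_slope_commute[of j b a])
      ultimately show ?thesis using T'(3) by blast
    qed
  qed (use T T' in auto)
qed

section \<open>Almost sure uniqueness of maximizers\<close>

text \<open>Between two values \<open>s < s'\<close> over the same \<open>t\<close> lies a rational
  \<open>q\<close>. If one \<open>q\<close> served \<open>t < t'\<close>, the point of
  \<open>B\<close> over \<open>t\<close> above \<open>q\<close> and the point of \<open>A\<close>
  over \<open>t'\<close> below \<open>q\<close> would violate the assumption. So each rational
  serves at most one \<open>t\<close>.\<close>

lemma countable_double_fibres: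
  fixes A B :: "(real \<times> real) set"
  assumes "\<And>a b. a \<in> A \<Longrightarrow> b \<in> B \<Longrightarrow> 0 \<le> (fst a - fst b) * (snd a - snd b)"
  shows "countable {t. \<exists>s s'. (t, s) \<in> A \<and> (t, s') \<in> B \<and> s \<noteq> s'}"
proof -
  have half: "countable {t. \<exists>s s'. (t, s) \<in> A \<and> (t, s') \<in> B \<and> s < s'}"
    if mono: "\<And>a b. a \<in> A \<Longrightarrow> b \<in> B \<Longrightarrow> 0 \<le> (fst a - fst b) * (snd a - snd b)" for A B :: "(real \<times> real) set"
  proof -
    define E where "E q = {t. \<exists>s s'. (t, s) \<in> A \<and> (t, s') \<in> B \<and> s < q \<and> q < s'}" for q
    have "t = t'" if "t \<in> E q" "t' \<in> E q" for t t' q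
    proof -
      have False if lt: "t < t'" and t: "t \<in> E q" "t' \<in> E q" for t t'
      proof -
        obtain s' s where s: "(t, s') \<in> B" "q < s'" "(t', s) \<in> A" "s < q" using t by (auto simp: E_def)
        have "0 \<le> (t' - t) * (s - s')" using mono[OF s(3) s(1)] by simp
        then show False using lt s by (simp add: zero_le_mult_iff)
      qed
      then show ?thesis using that by (metis linorder_neqE_linordered_idom)
    qed
    then have "countable (E q)" for q
      by (metis countable_finite finite.emptyI finite.insertI ex_in_conv finite_subset subset_singleton_iff subsetI singletonI empty_iff insertI1)
    then have "countable (\<Union>q\<in>\<rat>. E q)" using countable_rat by (intro countable_UN) auto
    moreover have "{t. \<exists>s s'. (t, s) \<in> A \<and> (t, s') \<in> B \<and> s < s'} \<subseteq> (\<Union>q\<in>\<rat>. E q)"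
      unfolding E_def using Rats_dense_in_real by fastforce
    ultimately show ?thesis by (rule countable_subset[rotated])
  qed
  have flip: "0 \<le> (fst b - fst a) * (snd b - snd a)" if "a \<in> A" "b \<in> B" for a b
    using assms[OF that] by (simp add: algebra_simps)
  have "{t. \<exists>s s'. (t, s) \<in> A \<and> (t, s') \<in> B \<and> s \<noteq> s'} =
    {t. \<exists>s s'. (t, s) \<in> A \<and> (t, s') \<in> B \<and> s < s'} \<union> {t. \<exists>s s'. (t, s) \<in> B \<and> (t, s') \<in> A \<and> s < s'}"
    by (auto simp: neq_iff)
  then show ?thesis using half[OF assms] half[OF flip] by simp
qed

text \<open>For \<open>m = 1\<close> an isotropic difference has a vanishing component, so
  \<open>a\<close> and \<open>b\<close> share a coordinate, and if they are distinct, equality of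
  their minorants forces \<open>y\<close> to have the same coordinate. By
  \<open>countable_double_fibres\<close> the shared value ranges over a countable set; each value is
  avoided almost surely because the coordinate axes are isotropic.\<close>

lemma AE_not_isotropic_line_case:
  fixes \<nu> :: "('m::finite) pt measure"
  assumes card: "CARD('m) = 1" and cross: "cross_monotone A B"
    and lines: "\<And>w t. S_isotropic w \<Longrightarrow> AE y in \<nu>. Sform y w \<noteq> t"
  shows "AE y in \<nu>. \<forall>a b. co_maximizers A B y a b \<longrightarrow> Sform (a - b) (a - b) = 0 \<longrightarrow> a = b"
proof -
  obtain i where i: "(UNIV :: 'm set) = {i}" using card by (rule card_1_singletonE)
  have inner_i: "x \<bullet> y = x $ i * y $ i" for x y :: "real^'m"
    by (simp add: inner_vec_def i)
  have vec_i: "x = y \<longleftrightarrow> x $ i = y $ i" for x y :: "real^'m"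
    using i by (auto simp: vec_eq_iff)
  let ?p = "\<lambda>a :: 'm pt. (fst a $ i, snd a $ i)" and ?p' = "\<lambda>a :: 'm pt. (snd a $ i, fst a $ i)"
  have nonneg: "0 \<le> (fst a $ i - fst b $ i) * (snd a $ i - snd b $ i)" if "a \<in> A" "b \<in> B" for a b
    using cross that by (fastforce simp: cross_monotone_def Sform_def inner_i)
  define E where "E = {t. \<exists>s s'. (t, s) \<in> ?p ` A \<and> (t, s') \<in> ?p ` B \<and> s \<noteq> s'}"
  define E' where "E' = {t. \<exists>s s'. (t, s) \<in> ?p' ` A \<and> (t, s') \<in> ?p' ` B \<and> s \<noteq> s'}"
  have "countable E" unfolding E_def
    by (rule countable_double_fibres) (use nonneg in auto)
  moreover have "countable E'" unfolding E'_def
    by (rule countable_double_fibres) (use nonneg in \<open>auto simp: mult.commute\<close>)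
  moreover have "AE y in \<nu>. fst y $ i \<noteq> t" for t
    using lines[of "(0, axis i 1)" t]
    by (simp add: S_isotropic_def Sform_def inner_axis norm_Pair)
  moreover have "AE y in \<nu>. snd y $ i \<noteq> t" for t
    using lines[of "(axis i 1, 0)" t]
    by (simp add: S_isotropic_def Sform_def inner_axis norm_Pair)
  ultimately have "AE y in \<nu>. (\<forall>t\<in>E. fst y $ i \<noteq> t) \<and> (\<forall>t\<in>E'. snd y $ i \<noteq> t)"
    by (simp add: AE_ball_countable)
  then show ?thesis
  proof (rule AE_mp, intro AE_I2 impI allI)
    fix y a b
    assume y: "(\<forall>t\<in>E. fst y $ i \<noteq> t) \<and> (\<forall>t\<in>E'. snd y $ i \<noteq> t)"
      and ab: "co_maximizers A B y a b" and zero: "Sform (a - b) (a - b) = 0"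
    have AB: "a \<in> A" "b \<in> B" using ab by (auto simp: co_maximizers_def)
    have eq: "snd a $ i * fst y $ i + fst a $ i * snd y $ i - snd a $ i * fst a $ i
       = snd b $ i * fst y $ i + fst b $ i * snd y $ i - snd b $ i * fst b $ i"
      using ab by (simp add: co_maximizers_def minorant_def Sform_def inner_i algebra_simps)
    have "fst a $ i = fst b $ i \<or> snd a $ i = snd b $ i"
      using zero by (simp add: Sform_def inner_i)
    then show "a = b"
    proof
      assume f: "fst a $ i = fst b $ i"
      show ?thesis
      proof (rule ccontr)
        assume "a \<noteq> b"
        then have ne: "snd a $ i \<noteq> snd b $ i" using f by (simp add: prod_eq_iff vec_i)
        then have "fst a $ i \<in> E" unfolding E_def using AB f by (auto intro!: exI rev_image_eqI)
        moreover have "(snd a $ i - snd b $ i) * (fst y $ i - fst a $ i) = 0"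
          using eq f by (simp add: algebra_simps)
        ultimately show False using y ne by auto
      qed
    next
      assume f: "snd a $ i = snd b $ i"
      show ?thesis
      proof (rule ccontr)
        assume "a \<noteq> b"
        then have ne: "fst a $ i \<noteq> fst b $ i" using f by (simp add: prod_eq_iff vec_i)
        then have "snd a $ i \<in> E'" unfolding E'_def using AB f by (auto intro!: exI rev_image_eqI)
        moreover have "(fst a $ i - fst b $ i) * (snd y $ i - snd a $ i) = 0"
          using eq f by (simp add: algebra_simps)
        ultimately show False using y ne by auto
      qed
    qed
  qed
qed

text \<open>An isotropic difference stays isotropic under scaling, so it lies below every threshold
  \<open>1 / real (Suc n)\<close>. Intersecting the corresponding unions of surfaces over
  \<open>n\<close> gives one Borel set \<open>D\<close>, and for each \<open>\<delta>\<close> a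
  single large \<open>n\<close> supplies the cover that \<open>E0\<close> asks for.\<close>

lemma AE_not_isotropic_surface_case:
  fixes \<nu> :: "('m::finite) pt measure"
  assumes sets: "sets \<nu> = sets borel" and cross: "cross_monotone A B"
    and E0: "\<And>D. D \<in> E0 \<Longrightarrow> emeasure \<nu> D = 0"
  shows "AE y in \<nu>. \<forall>a b. co_maximizers A B y a b \<longrightarrow> Sform (a - b) (a - b) = 0 \<longrightarrow> a = b"
proof -
  let ?P = "\<lambda>n. {x :: 'm pt. Sform x x < 1 / real (Suc n)}"
  define good where "good n T \<longleftrightarrow> T \<subseteq> surfaces (?P n) \<and> countable T \<and>
    (\<forall>y a b. co_maximizers A B y a b \<longrightarrow> a \<noteq> b \<longrightarrow>
      Sform (a - b) (a - b) = 0 \<longrightarrow> (\<exists>(j, C, h)\<in>T. h (Smap y) = 0))" for n T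
  have "\<exists>T. good n T" for n
  proof -
    have "open (?P n)" by (intro open_Collect_less continuous_intros)
    with cross obtain T where T: "T \<subseteq> surfaces (?P n)" "countable T"
      "\<And>y a b. co_maximizers A B y a b \<Longrightarrow> a \<noteq> b \<Longrightarrow> (\<And>c. c \<noteq> 0 \<Longrightarrow> (a - b) /\<^sub>R c \<in> ?P n) \<Longrightarrow>
         \<exists>(j, C, h)\<in>T. h (Smap y) = 0"
      by (rule countable_separating_surfaces) blast
    show ?thesis
      unfolding good_def
    proof (intro exI[of _ T] conjI allI impI T(1,2))
      fix y a b assume ab: "co_maximizers A B y a b" "a \<noteq> b" and zero: "Sform (a - b) (a - b) = 0"
      have "(a - b) /\<^sub>R c \<in> ?P n" for c unfolding mem_Collect_eq Sform_scaleR zero by simp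
      with ab show "\<exists>(j, C, h)\<in>T. h (Smap y) = 0" by (rule T(3))
    qed
  qed
  then obtain T where "\<And>n. good n (T n)" by metis
  then have T: "T n \<subseteq> surfaces (?P n)" "countable (T n)"
    "co_maximizers A B y a b \<Longrightarrow> a \<noteq> b \<Longrightarrow> Sform (a - b) (a - b) = 0 \<Longrightarrow>
      \<exists>(j, C, h)\<in>T n. h (Smap y) = 0" for n y a b
    unfolding good_def by blast+
  define D where "D = (\<Inter>n. \<Union>(j, C, h)\<in>T n. {y. h (Smap y) = 0})"
  have "{y. h (Smap y) = 0} \<in> sets borel" if "(j, C, h) \<in> T n" for j C h n
  proof -
    have "continuous_on UNIV h" using that T(1) by (auto simp: surfaces_def)
    then have "continuous_on UNIV (\<lambda>y. h (Smap y))"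
      by (rule continuous_on_compose2) (auto intro: continuous_intros)
    then have "closed {y. h (Smap y) = 0}"
      by (intro closed_Collect_eq continuous_on_const)
    then show ?thesis by simp
  qed
  then have D_borel: "D \<in> sets borel"
    unfolding D_def using T(2) by (intro sets.countable_INT' sets.countable_UN') auto
  \<comment> \<open>\<open>E0\<close> asks for a sequence of surfaces, and an empty family cannot be
    enumerated; in that case \<open>D\<close> itself is empty.\<close>
  have "emeasure \<nu> D = 0"
  proof (cases "\<exists>n. T n = {}")
    case True
    then have "D = {}" by (force simp: D_def)
    then show ?thesis by simp
  next
    case False
    show ?thesis
    proof (rule E0, unfold E0_def, intro CollectI conjI D_borel allI impI)
      fix \<delta> :: real assume "\<delta> > 0"
      then obtain n where n: "1 / real (Suc n) < \<delta>" using nat_approx_posE by blast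
      define t where "t = from_nat_into (T n)"
      have t: "range t = T n" unfolding t_def using False T(2) by (intro range_from_nat_into) auto
      have sur: "t k \<in> surfaces (?P n)" for k using t T(1) by blast
      have props: "in_H (fst (t k)) (fst (snd (t k))) (snd (snd (t k)))"
        "fst (snd (t k)) \<subseteq> {x. coord x (fst (t k)) = 1 \<and> Sform x x \<ge> 0} \<inter> ?P n" for k
        using sur[of k] by (auto simp: surfaces_def case_prod_unfold simp del: of_nat_Suc)
      show "\<exists>(js :: nat \<Rightarrow> _) Cs hs. (\<forall>n. compact (Cs n) \<and>
          Cs n \<subseteq> {x. coord x (js n) = 1 \<and> 0 \<le> Sform x x \<and> Sform x x \<le> \<delta>} \<and>
          in_H (js n) (Cs n) (hs n)) \<and> D \<subseteq> (\<Union>n. {x. hs n (Smap x) = 0})"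
      proof (intro exI[of _ "\<lambda>k. fst (t k)"] exI[of _ "\<lambda>k. fst (snd (t k))"]
          exI[of _ "\<lambda>k. snd (snd (t k))"] conjI allI)
        fix k
        show "in_H (fst (t k)) (fst (snd (t k))) (snd (snd (t k)))" by (rule props)
        then show "compact (fst (snd (t k)))" by (simp add: in_H_def)
        show "fst (snd (t k)) \<subseteq> {x. coord x (fst (t k)) = 1 \<and> 0 \<le> Sform x x \<and> Sform x x \<le> \<delta>}"
          using props(2)[of k] n by (force simp del: of_nat_Suc)
      next
        show "D \<subseteq> (\<Union>k. {x. snd (snd (t k)) (Smap x) = 0})"
        proof
          fix x assume "x \<in> D"
          then have "x \<in> (\<Union>(j, C, h)\<in>T n. {y. h (Smap y) = 0})" unfolding D_def by blast
          then show "x \<in> (\<Union>k. {x. snd (snd (t k)) (Smap x) = 0})"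
            unfolding t[symmetric] by (auto simp: case_prod_unfold)
        qed
      qed
    qed
  qed
  then have "AE y in \<nu>. y \<notin> D"
    using D_borel sets by (intro AE_not_in) auto
  then show ?thesis
  proof (rule AE_mp, intro AE_I2 impI allI)
    fix y a b assume "y \<notin> D" "co_maximizers A B y a b" "Sform (a - b) (a - b) = 0"
    then show "a = b" using T(3)[of y a b] unfolding D_def by (fastforce simp: case_prod_unfold)
  qed
qed

text \<open>Across the pair the form is nonnegative on \<open>a - b\<close>. Positive values are
  covered by countably many surfaces whose normals have positive form, null by \<open>A1\<close>;
  the value zero is the isotropic case, split by dimension.\<close>

lemma AE_co_maximizers_unique:
  fixes \<nu> :: "('m::finite) pt measure"
  assumes sets: "sets \<nu> = sets borel" and cross: "cross_monotone A B"
    and A1: "\<And>j C h. C \<subseteq> {x. coord x j = 1 \<and> Sform x x > 0} \<Longrightarrow> in_H j C h \<Longrightarrow> continuous_on UNIV h \<Longrightarrow>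
       AE y in \<nu>. h (Smap y) \<noteq> 0"
    and A2: "\<And>w t. CARD('m) = 1 \<Longrightarrow> S_isotropic w \<Longrightarrow> AE y in \<nu>. Sform y w \<noteq> t"
    and A3: "\<And>D. CARD('m) > 1 \<Longrightarrow> D \<in> E0 \<Longrightarrow> emeasure \<nu> D = 0"
  shows "AE y in \<nu>. \<forall>a b. co_maximizers A B y a b \<longrightarrow> a = b"
proof -
  let ?P = "{x :: 'm pt. 0 < Sform x x}"
  have "open ?P" by (intro open_Collect_less continuous_intros)
  with cross obtain T where T: "T \<subseteq> surfaces ?P" "countable T"
    "\<And>y a b. co_maximizers A B y a b \<Longrightarrow> a \<noteq> b \<Longrightarrow> (\<And>c. c \<noteq> 0 \<Longrightarrow> (a - b) /\<^sub>R c \<in> ?P) \<Longrightarrow>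
       \<exists>(j, C, h)\<in>T. h (Smap y) = 0"
    by (rule countable_separating_surfaces) blast
  have "AE y in \<nu>. snd (snd t) (Smap y) \<noteq> 0" if "t \<in> T" for t
  proof (rule A1)
    have "t \<in> surfaces ?P" using T(1) that by blast
    then show "in_H (fst t) (fst (snd t)) (snd (snd t))" "continuous_on UNIV (snd (snd t))"
      "fst (snd t) \<subseteq> {x. coord x (fst t) = 1 \<and> Sform x x > 0}"
      by (auto simp: surfaces_def case_prod_unfold)
  qed
  then have pos: "AE y in \<nu>. \<forall>t\<in>T. snd (snd t) (Smap y) \<noteq> 0"
    using T(2) by (simp add: AE_ball_countable)
  have "CARD('m) = 1 \<or> CARD('m) > 1" by (metis One_nat_def Suc_lessI zero_less_card_finite)
  then have iso: "AE y in \<nu>. \<forall>a b. co_maximizers A B y a b \<longrightarrow> Sform (a - b) (a - b) = 0 \<longrightarrow> a = b"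
    using AE_not_isotropic_line_case[OF _ cross A2] AE_not_isotropic_surface_case[OF sets cross A3] by blast
  from pos iso show ?thesis
  proof eventually_elim
    case (elim y)
    show ?case
    proof (intro allI impI, rule ccontr)
      fix a b assume ab: "co_maximizers A B y a b" "a \<noteq> b"
      then have "Sform (a - b) (a - b) \<noteq> 0" using elim by blast
      moreover have "Sform (a - b) (a - b) \<ge> 0"
        using ab cross by (simp add: cross_monotone_def co_maximizers_def)
      ultimately have "(a - b) /\<^sub>R c \<in> ?P" if "c \<noteq> 0" for c
        using that by (auto simp: Sform_scaleR zero_less_mult_iff)
      then show False using T(3)[OF ab] elim(1) by (auto simp: case_prod_unfold)
    qed
  qed
qed

section \<open>Convex functions above the quadratic form\<close>

text \<open>Exact expansion about \<open>y\<close>. It makes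
  \<open>Sform (x - y) (x - y) \<ge> 0\<close> equivalent to
  \<open>minorant x y \<le> Sform y y / 2\<close>, which translates between monotone relations and
  values of \<open>psi\<close>.\<close>

lemma minorant_alt: "minorant x y = Sform y y / 2 - Sform (x - y) (x - y) / 2"
  by (simp add: minorant_def Sform_def inner_simps inner_commute field_simps)

lemma psi_eq: "psi A y = (SUP x\<in>A. ereal (minorant x y))"
  by (simp add: psi_def minorant_def)

lemma minorant_le_psi: "x \<in> A \<Longrightarrow> ereal (minorant x y) \<le> psi A y"
  unfolding psi_eq by (rule SUP_upper)

lemma psi_le_iff: "psi A y \<le> ereal c \<longleftrightarrow> (\<forall>x\<in>A. minorant x y \<le> c)"
  unfolding psi_eq by (simp add: SUP_le_iff)

lemma continuous_on_minorant [continuous_intros]: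
  "continuous_on S f \<Longrightarrow> continuous_on S g \<Longrightarrow> continuous_on S (\<lambda>x. minorant (f x) (g x))"
  unfolding minorant_def by (intro continuous_intros) auto

text \<open>Lets an almost sure bound on \<open>psi\<close> be collected from countably many points
  of \<open>A\<close>.\<close>

lemma psi_le_dense:
  assumes "A \<subseteq> closure Z" "\<And>z. z \<in> Z \<Longrightarrow> minorant z y \<le> c"
  shows "psi A y \<le> ereal c"
proof -
  have "closed {z. minorant z y \<le> c}" by (intro closed_Collect_le continuous_intros)
  then have "closure Z \<subseteq> {z. minorant z y \<le> c}" using assms(2) by (intro closure_minimal) auto
  then show ?thesis using assms(1) by (auto simp: psi_le_iff)
qed

text \<open>The supremum may run over an uncountable set; measurability comes from lower
  semicontinuity.\<close>

lemma measurable_psi [measurable]: "psi A \<in> borel_measurable borel"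
proof (rule borel_measurableI_greater)
  fix c
  have "{y \<in> space borel. c < psi A y} = (\<Union>x\<in>A. {y. c < ereal (minorant x y)})"
    by (auto simp: psi_eq less_SUP_iff)
  moreover have "open {y. c < ereal (minorant x y)}" for x
    by (intro open_Collect_less continuous_intros)
  then have "open (\<Union>x\<in>A. {y. c < ereal (minorant x y)})" by (intro open_UN ballI)
  ultimately show "{y \<in> space borel. c < psi A y} \<in> sets borel" by (simp only: borel_open)
qed

definition dominates_form :: "('m::finite) pt set \<Rightarrow> bool" where
  "dominates_form A \<longleftrightarrow> (\<forall>y. ereal (Sform y y / 2) \<le> psi A y)"

definition contact_set :: "('m::finite) pt set \<Rightarrow> 'm pt set" where
  "contact_set A = {y. psi A y = ereal (Sform y y / 2)}"

text \<open>The graph point over the first component of \<open>y\<close> differs from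
  \<open>y\<close> only in the second component. The form vanishes on this difference, so the
  tangent there takes the value of the form at \<open>y\<close>.\<close>

lemma dominates_form_graph: "dominates_form (graph f)"
  unfolding dominates_form_def
proof
  fix y :: "'a pt"
  have "(fst y, f (fst y)) \<in> graph f" by (auto simp: graph_def)
  moreover have "minorant (fst y, f (fst y)) y = Sform y y / 2"
    by (simp add: minorant_alt) (simp add: Sform_def)
  ultimately show "ereal (Sform y y / 2) \<le> psi (graph f) y"
    using minorant_le_psi by metis
qed

text \<open>The relation is between points of \<open>A\<close> and contact points and says nothing
  about two points of \<open>A\<close>, which suits a graph that may fail to be monotone.\<close>

lemma cross_monotone_contact_set: "cross_monotone A (contact_set A)"
proof -
  have "Sform (a - x) (a - x) \<ge> 0" if "a \<in> A" "psi A x = ereal (Sform x x / 2)" for a x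
    using minorant_le_psi[OF that(1), of x] that(2) by (simp add: minorant_alt)
  then show ?thesis by (auto simp: cross_monotone_def contact_set_def)
qed

text \<open>A convex function above the quadratic form that touches it at \<open>x\<close> has there
  the gradient of the form as a subgradient.\<close>

lemma minorant_le_psi_contact:
  assumes dom: "dominates_form A" and x: "x \<in> contact_set A"
  shows "ereal (minorant x y) \<le> psi A y"
proof (cases "psi A y")
  case (real c)
  let ?d = "y - x" and ?q = "\<lambda>x. Sform x x / 2"
  \<comment> \<open>On the segment from \<open>x\<close> to \<open>y\<close>, convexity bounds
    \<open>psi A\<close> from above and domination bounds it from below. Dividing by
    \<open>t\<close> and letting \<open>t\<close> tend to 0 removes the quadratic term.\<close>
  have bound: "Sform x ?d + t * ?q ?d \<le> c - ?q x" if t: "0 < t" "t < 1" for t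
  proof -
    have "minorant z (x + t *\<^sub>R ?d) \<le> (1 - t) * ?q x + t * c" if "z \<in> A" for z
    proof -
      have "minorant z (x + t *\<^sub>R ?d) = (1 - t) * minorant z x + t * minorant z y"
        by (simp add: minorant_def Sform_def inner_simps algebra_simps add_divide_distrib diff_divide_distrib)
      also have "\<dots> \<le> (1 - t) * ?q x + t * c"
        using minorant_le_psi[OF that, of x] minorant_le_psi[OF that, of y] x real t
        by (intro add_mono mult_left_mono) (auto simp: contact_set_def)
      finally show ?thesis .
    qed
    then have "psi A (x + t *\<^sub>R ?d) \<le> ereal ((1 - t) * ?q x + t * c)" by (simp add: psi_le_iff)
    then have "ereal (?q (x + t *\<^sub>R ?d)) \<le> ereal ((1 - t) * ?q x + t * c)"
      by (rule order_trans[OF dom[unfolded dominates_form_def, rule_format]])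
    then have "?q (x + t *\<^sub>R ?d) \<le> (1 - t) * ?q x + t * c" by (simp only: ereal_less_eq(3))
    moreover have "?q (x + t *\<^sub>R ?d) = ?q x + t * Sform x ?d + t * (t * ?q ?d)"
      by (simp add: Sform_def inner_simps inner_commute field_simps)
    ultimately have "t * (Sform x ?d + t * ?q ?d) \<le> t * (c - ?q x)"
      by (simp only: distrib_left right_diff_distrib left_diff_distrib mult_1_left)
    then show ?thesis using t by simp
  qed
  have "((\<lambda>t. Sform x ?d + t * ?q ?d) \<longlongrightarrow> Sform x ?d + 0 * ?q ?d) (at_right 0)"
    by (intro tendsto_intros)
  moreover have "eventually (\<lambda>t. Sform x ?d + t * ?q ?d \<le> c - ?q x) (at_right 0)"
    using bound by (auto simp: eventually_at_right[of 0 1] intro!: exI[of _ 1])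
  ultimately have "Sform x ?d + 0 * ?q ?d \<le> c - ?q x"
    by (rule tendsto_upperbound) simp
  moreover have "Sform x ?d = minorant x y - ?q x" by (simp add: minorant_def Sform_def inner_simps)
  ultimately show ?thesis using real by simp
next
  case MInf
  then show ?thesis using dom[unfolded dominates_form_def, rule_format, of y] by simp
qed simp

text \<open>The tangent at \<open>a\<close> lies below \<open>psi A\<close>, whose value at
  \<open>b\<close> is that of the form.\<close>

lemma contact_set_monotone: "dominates_form A \<Longrightarrow> cross_monotone (contact_set A) (contact_set A)"
  unfolding cross_monotone_def
proof (intro ballI)
  fix a b assume "dominates_form A" "a \<in> contact_set A" "b \<in> contact_set A"
  then show "Sform (a - b) (a - b) \<ge> 0"
    using minorant_le_psi_contact[of A a b] by (simp add: minorant_alt contact_set_def)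
qed

lemma psi_contact_set_le: "dominates_form A \<Longrightarrow> psi (contact_set A) y \<le> psi A y"
  unfolding psi_eq[of "contact_set A"] by (intro SUP_least minorant_le_psi_contact)

text \<open>\<open>psi G\<close> is the Fitzpatrick function of \<open>G\<close>: where it does not
  exceed the form, the point is in monotone relation to all of \<open>G\<close>, and maximality puts
  it into \<open>G\<close>.\<close>

lemma maximal_monotone_psi:
  assumes "G \<in> maxS"
  shows "dominates_form G" "contact_set G = G"
proof -
  have mono: "Sform (x - y) (x - y) \<ge> 0" if "x \<in> G" "y \<in> G" for x y
    using assms that by (auto simp: maxS_def S_monotone_def)
  have on: "psi G y = ereal (Sform y y / 2)" if "y \<in> G" for y
  proof (rule antisym)
    show "psi G y \<le> ereal (Sform y y / 2)"
      using mono that by (simp add: psi_le_iff minorant_alt)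
    show "ereal (Sform y y / 2) \<le> psi G y"
      using minorant_le_psi[OF that, of y] by (simp add: minorant_def)
  qed
  have off: "psi G y > ereal (Sform y y / 2)" if "y \<notin> G" for y
  proof (rule ccontr)
    assume "\<not> psi G y > ereal (Sform y y / 2)"
    then have "\<forall>x\<in>G. Sform (x - y) (x - y) \<ge> 0"
      by (simp add: not_less psi_le_iff minorant_alt)
    then have "S_monotone (insert y G)"
      using mono by (auto simp: S_monotone_def Sform_minus_commute[of y]) (simp add: Sform_def)
    then show False using assms that unfolding maxS_def by blast
  qed
  show "dominates_form G" unfolding dominates_form_def using on off by (metis less_imp_le order_refl)
  show "contact_set G = G" unfolding contact_set_def using on off by fastforce
qed

text \<open>A point \<open>y\<close> in monotone relation to the contact set satisfies
  \<open>psi (contact_set A) y \<le> Sform y y / 2\<close>. Since \<open>psi\<close> is the same for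
  \<open>A\<close> and its contact set, domination turns this into contact.\<close>

lemma maximal_monotoneI:
  assumes dom: "dominates_form A" and eq: "psi (contact_set A) = psi A"
  shows "contact_set A \<in> maxS"
  unfolding maxS_def
proof (intro CollectI conjI allI impI)
  show "S_monotone (contact_set A)"
    using contact_set_monotone[OF dom] by (simp add: S_monotone_def cross_monotone_def)
  fix G assume G: "S_monotone G \<and> contact_set A \<subseteq> G"
  have "y \<in> contact_set A" if "y \<in> G" for y
  proof -
    have "\<forall>x\<in>contact_set A. minorant x y \<le> Sform y y / 2"
      using G that by (auto simp: minorant_alt S_monotone_def)
    then have "psi (contact_set A) y \<le> ereal (Sform y y / 2)" by (simp only: psi_le_iff)
    then have "psi A y = ereal (Sform y y / 2)"
      unfolding eq using dom unfolding dominates_form_def by (intro antisym) blast+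
    then show ?thesis by (simp add: contact_set_def)
  qed
  then show "G = contact_set A" using G by blast
qed

section \<open>Conditional expectations and weak duality\<close>

lemma integrable_inner_L2:
  assumes "L2 M X" "L2 M Z"
  shows "integrable M (\<lambda>\<omega>. X \<omega> \<bullet> Z \<omega>)"
proof (rule Bochner_Integration.integrable_bound)
  show "integrable M (\<lambda>\<omega>. (norm (X \<omega>))\<^sup>2 + (norm (Z \<omega>))\<^sup>2)"
    using assms by (auto simp: L2_def)
  show "(\<lambda>\<omega>. X \<omega> \<bullet> Z \<omega>) \<in> borel_measurable M"
    using assms by (auto simp: L2_def)
  show "AE \<omega> in M. norm (X \<omega> \<bullet> Z \<omega>) \<le> norm ((norm (X \<omega>))\<^sup>2 + (norm (Z \<omega>))\<^sup>2)"
  proof (intro AE_I2)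
    fix \<omega>
    have "\<bar>X \<omega> \<bullet> Z \<omega>\<bar> \<le> norm (X \<omega>) * norm (Z \<omega>)" by (rule Cauchy_Schwarz_ineq2)
    moreover have "2 * (norm (X \<omega>) * norm (Z \<omega>)) \<le> (norm (X \<omega>))\<^sup>2 + (norm (Z \<omega>))\<^sup>2"
      using sum_squares_bound[of "norm (X \<omega>)" "norm (Z \<omega>)"] by (simp add: mult.assoc)
    moreover have "0 \<le> norm (X \<omega>) * norm (Z \<omega>)" by simp
    ultimately have "\<bar>X \<omega> \<bullet> Z \<omega>\<bar> \<le> (norm (X \<omega>))\<^sup>2 + (norm (Z \<omega>))\<^sup>2" by linarith
    then show "norm (X \<omega> \<bullet> Z \<omega>) \<le> norm ((norm (X \<omega>))\<^sup>2 + (norm (Z \<omega>))\<^sup>2)" by simp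
  qed
qed

lemma L2_const: "finite_measure M \<Longrightarrow> L2 M (\<lambda>_. c)"
  by (simp add: L2_def finite_measure.integrable_const)

lemma L2_Pair:
  "L2 M X \<Longrightarrow> L2 M Z \<Longrightarrow> L2 M (\<lambda>\<omega>. (X \<omega>, Z \<omega>))"
  by (auto simp: L2_def norm_Pair intro!: borel_measurable_Pair)

lemma L2_componentsI:
  fixes X :: "'a \<Rightarrow> 'b::euclidean_space"
  assumes "\<And>i. i \<in> Basis \<Longrightarrow> (\<lambda>\<omega>. X \<omega> \<bullet> i) \<in> borel_measurable M"
    "\<And>i. i \<in> Basis \<Longrightarrow> integrable M (\<lambda>\<omega>. (X \<omega> \<bullet> i)\<^sup>2)"
  shows "L2 M X"
proof -
  have "X \<in> borel_measurable M" using assms(1) borel_measurable_euclidean_space by blast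
  moreover have "integrable M (\<lambda>\<omega>. \<Sum>i\<in>Basis. (X \<omega> \<bullet> i)\<^sup>2)" using assms(2) by auto
  moreover have "(norm (X \<omega>))\<^sup>2 = (\<Sum>i\<in>Basis. (X \<omega> \<bullet> i)\<^sup>2)" for \<omega>
    unfolding power2_norm_eq_inner by (subst euclidean_inner) (simp add: power2_eq_square)
  ultimately show ?thesis by (simp add: L2_def)
qed

lemma L2_Smap: "L2 M X \<Longrightarrow> L2 M (\<lambda>\<omega>. Smap (X \<omega>))"
proof -
  assume X: "L2 M X"
  have "(norm (Smap x))\<^sup>2 = (norm x)\<^sup>2" for x :: "'b pt" by (cases x) (simp add: Smap_def norm_Pair)
  moreover have "Smap \<in> borel_measurable (borel :: 'b pt measure)"
    by (intro borel_measurable_continuous_onI continuous_intros)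
  ultimately show ?thesis using X by (auto simp: L2_def intro: measurable_compose)
qed

lemma integrable_Sform: "L2 M X \<Longrightarrow> L2 M Z \<Longrightarrow> integrable M (\<lambda>\<omega>. Sform (X \<omega>) (Z \<omega>))"
  unfolding Sform_eq_inner by (intro integrable_inner_L2 L2_Smap)

context finite_measure_subalgebra
begin

lemma integrable_component: "L2 M X \<Longrightarrow> integrable M (\<lambda>\<omega>. X \<omega> \<bullet> c)"
  using integrable_inner_L2[OF _ L2_const] finite_measure_axioms by blast

lemma cond_exp_is_inner:
  assumes Y: "L2 M Y" and ce: "cond_exp_is M F Y X"
  shows "AE \<omega> in M. real_cond_exp M F (\<lambda>\<omega>. c \<bullet> Y \<omega>) \<omega> = c \<bullet> X \<omega>"
proof -
  have int: "integrable M (\<lambda>\<omega>. (c \<bullet> i) * (Y \<omega> \<bullet> i))" for i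
    using integrable_component[OF Y] by simp
  have "AE \<omega> in M. real_cond_exp M F (\<lambda>\<omega>. \<Sum>i\<in>Basis. (c \<bullet> i) * (Y \<omega> \<bullet> i)) \<omega> =
     (\<Sum>i\<in>Basis. real_cond_exp M F (\<lambda>\<omega>. (c \<bullet> i) * (Y \<omega> \<bullet> i)) \<omega>)"
    by (rule real_cond_exp_sum[OF int])
  moreover have "AE \<omega> in M. \<forall>i\<in>Basis. real_cond_exp M F (\<lambda>\<omega>. (c \<bullet> i) * (Y \<omega> \<bullet> i)) \<omega> = (c \<bullet> i) * (X \<omega> \<bullet> i)"
  proof (intro AE_finite_allI finite_Basis)
    fix i :: 'b assume i: "i \<in> Basis"
    have "AE \<omega> in M. real_cond_exp M F (\<lambda>\<omega>. (c \<bullet> i) * (Y \<omega> \<bullet> i)) \<omega> = (c \<bullet> i) * real_cond_exp M F (\<lambda>\<omega>. Y \<omega> \<bullet> i) \<omega>"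
      by (rule real_cond_exp_cmult[OF integrable_component[OF Y]])
    moreover have "AE \<omega> in M. real_cond_exp M F (\<lambda>\<omega>. Y \<omega> \<bullet> i) \<omega> = X \<omega> \<bullet> i"
      using ce i by (simp add: cond_exp_is_def)
    ultimately show "AE \<omega> in M. real_cond_exp M F (\<lambda>\<omega>. (c \<bullet> i) * (Y \<omega> \<bullet> i)) \<omega> = (c \<bullet> i) * (X \<omega> \<bullet> i)"
      by eventually_elim simp
  qed
  ultimately have "AE \<omega> in M. real_cond_exp M F (\<lambda>\<omega>. \<Sum>i\<in>Basis. (c \<bullet> i) * (Y \<omega> \<bullet> i)) \<omega> = (\<Sum>i\<in>Basis. (c \<bullet> i) * (X \<omega> \<bullet> i))"
    by eventually_elim simp
  moreover have "(\<lambda>\<omega>. c \<bullet> Y \<omega>) = (\<lambda>\<omega>. \<Sum>i\<in>Basis. (c \<bullet> i) * (Y \<omega> \<bullet> i))"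
    "(\<lambda>\<omega>. c \<bullet> X \<omega>) = (\<lambda>\<omega>. \<Sum>i\<in>Basis. (c \<bullet> i) * (X \<omega> \<bullet> i))"
    by (intro ext euclidean_inner)+
  ultimately show ?thesis by metis
qed

lemma integral_inner_cond_exp:
  assumes Y: "L2 M Y" and X: "L2 M X" and Z: "L2 M Z" "Z \<in> borel_measurable F" and ce: "cond_exp_is M F Y X"
  shows "(\<integral>\<omega>. Z \<omega> \<bullet> Y \<omega> \<partial>M) = (\<integral>\<omega>. Z \<omega> \<bullet> X \<omega> \<partial>M)"
proof -
  have prod: "integrable M (\<lambda>\<omega>. (Z \<omega> \<bullet> i) * (W \<omega> \<bullet> i))" if "L2 M W" "i \<in> Basis" for i and W :: "'a \<Rightarrow> 'b"
  proof -
    have "L2 M (\<lambda>\<omega>. (V \<omega> \<bullet> i))" if V: "L2 M V" for V :: "'a \<Rightarrow> 'b"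
    proof -
      have [measurable]: "V \<in> borel_measurable M" using V by (simp add: L2_def)
      have "integrable M (\<lambda>\<omega>. (V \<omega> \<bullet> i)\<^sup>2)"
      proof (rule Bochner_Integration.integrable_bound)
        show "integrable M (\<lambda>\<omega>. (norm (V \<omega>))\<^sup>2)" using V by (simp add: L2_def)
        show "AE \<omega> in M. norm ((V \<omega> \<bullet> i)\<^sup>2) \<le> norm ((norm (V \<omega>))\<^sup>2)"
          using Basis_le_norm[OF \<open>i \<in> Basis\<close>] by (auto intro: power2_le_iff_abs_le[THEN iffD2] simp: power2_le_iff_abs_le)
      qed measurable
      then show ?thesis by (simp add: L2_def)
    qed
    from integrable_inner_L2[OF this[OF Z(1)] this[OF that(1)]] show ?thesis by simp
  qed
  have expand: "(\<integral>\<omega>. Z \<omega> \<bullet> W \<omega> \<partial>M) = (\<Sum>i\<in>Basis. \<integral>\<omega>. (Z \<omega> \<bullet> i) * (W \<omega> \<bullet> i) \<partial>M)"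
    if W: "L2 M W" for W
  proof -
    have "(\<lambda>\<omega>. Z \<omega> \<bullet> W \<omega>) = (\<lambda>\<omega>. \<Sum>i\<in>Basis. (Z \<omega> \<bullet> i) * (W \<omega> \<bullet> i))"
      by (intro ext euclidean_inner)
    then show ?thesis using Bochner_Integration.integral_sum[OF prod[OF W]] by simp
  qed
  have "(\<integral>\<omega>. Z \<omega> \<bullet> Y \<omega> \<partial>M) = (\<Sum>i\<in>Basis. \<integral>\<omega>. (Z \<omega> \<bullet> i) * (Y \<omega> \<bullet> i) \<partial>M)"
    by (rule expand[OF Y])
  also have "\<dots> = (\<Sum>i\<in>Basis. \<integral>\<omega>. (Z \<omega> \<bullet> i) * (X \<omega> \<bullet> i) \<partial>M)"
  proof (rule sum.cong[OF refl])
    fix i :: 'b assume i: "i \<in> Basis"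
    have [measurable]: "(\<lambda>\<omega>. Z \<omega> \<bullet> i) \<in> borel_measurable F" "(\<lambda>\<omega>. Y \<omega> \<bullet> i) \<in> borel_measurable M"
      "Z \<in> borel_measurable M" "X \<in> borel_measurable M"
      using X Y Z by (auto simp: L2_def)
    have "(\<integral>\<omega>. (Z \<omega> \<bullet> i) * (Y \<omega> \<bullet> i) \<partial>M) = (\<integral>\<omega>. (Z \<omega> \<bullet> i) * real_cond_exp M F (\<lambda>\<omega>. Y \<omega> \<bullet> i) \<omega> \<partial>M)"
      by (rule real_cond_exp_intg(2)[OF prod[OF Y i], symmetric]) measurable
    also have "\<dots> = (\<integral>\<omega>. (Z \<omega> \<bullet> i) * (X \<omega> \<bullet> i) \<partial>M)"
    proof (rule integral_cong_AE)
      show "AE \<omega> in M. (Z \<omega> \<bullet> i) * real_cond_exp M F (\<lambda>\<omega>. Y \<omega> \<bullet> i) \<omega> = (Z \<omega> \<bullet> i) * (X \<omega> \<bullet> i)"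
        using ce i by (auto simp: cond_exp_is_def elim!: AE_mp)
    qed measurable
    finally show "(\<integral>\<omega>. (Z \<omega> \<bullet> i) * (Y \<omega> \<bullet> i) \<partial>M) = (\<integral>\<omega>. (Z \<omega> \<bullet> i) * (X \<omega> \<bullet> i) \<partial>M)" .
  qed
  also have "\<dots> = (\<integral>\<omega>. Z \<omega> \<bullet> X \<omega> \<partial>M)"
    by (rule expand[OF X, symmetric])
  finally show ?thesis .
qed

lemma integral_Sform_cond_exp:
  assumes "L2 M Y" "L2 M X" "X \<in> borel_measurable F" "cond_exp_is M F Y X"
  shows "(\<integral>\<omega>. Sform (X \<omega>) (Y \<omega>) \<partial>M) = (\<integral>\<omega>. Sform (X \<omega>) (X \<omega>) \<partial>M)"
proof -
  have "Sform x y = Smap x \<bullet> y" for x y :: "'b pt"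
    by (cases x, cases y) (simp add: Sform_def Smap_def)
  moreover have "(\<lambda>\<omega>. Smap (X \<omega>)) \<in> borel_measurable F"
    using assms(3) by (rule measurable_compose)
      (intro borel_measurable_continuous_onI continuous_intros)
  ultimately show ?thesis
    using integral_inner_cond_exp[OF assms(1,2) L2_Smap[OF assms(2)] _ assms(4)] by simp
qed

text \<open>Conditional Jensen through tangents: each affine minorant passes to the conditional
  expectation, and a countable dense part of \<open>A\<close> suffices. The second claim reads off
  where equality is forced: \<open>psi A\<close> touches the form at \<open>X\<close>, and the
  tangent at \<open>X\<close>, already below \<open>\<Psi>\<close>, has the same integral as
  \<open>\<Psi>\<close>. A general sub-sigma-algebra serves equilibria, admissible maps and plans
  alike.\<close>

lemma weak_duality:
  assumes Y: "L2 M Y" and X: "L2 M X" "X \<in> borel_measurable F" and ce: "cond_exp_is M F Y X"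
    and dom: "dominates_form A" and int: "integrable M \<Psi>"
    and \<Psi>: "AE \<omega> in M. psi A (Y \<omega>) = ereal (\<Psi> \<omega>)"
  shows "(\<integral>\<omega>. Sform (X \<omega>) (X \<omega>) / 2 \<partial>M) \<le> (\<integral>\<omega>. \<Psi> \<omega> \<partial>M)" (is "?Q \<le> _")
    and "(\<integral>\<omega>. \<Psi> \<omega> \<partial>M) \<le> (\<integral>\<omega>. Sform (X \<omega>) (X \<omega>) / 2 \<partial>M) \<Longrightarrow>
      AE \<omega> in M. X \<omega> \<in> contact_set A \<and> \<Psi> \<omega> = minorant (X \<omega>) (Y \<omega>)"
proof -
  let ?q = "\<lambda>\<omega>. Sform (X \<omega>) (X \<omega>) / 2" and ?E = "real_cond_exp M F \<Psi>"
  obtain Z where Z: "countable Z" "Z \<subseteq> A" "A \<subseteq> closure Z" using separable by blast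
  have "AE \<omega> in M. minorant z (X \<omega>) \<le> ?E \<omega>" if "z \<in> Z" for z
  proof -
    have min: "minorant z y = Smap z \<bullet> y - Sform z z / 2" for y
      by (cases y) (simp add: minorant_def Sform_def Smap_def)
    have i: "integrable M (\<lambda>\<omega>. Smap z \<bullet> Y \<omega>)" using integrable_component[OF Y, of "Smap z"] by (simp add: inner_commute)
    have "AE \<omega> in M. minorant z (Y \<omega>) \<le> \<Psi> \<omega>"
      using \<Psi> by eventually_elim (use minorant_le_psi that Z(2) in \<open>metis ereal_less_eq(3) subsetD\<close>)
    then have "AE \<omega> in M. real_cond_exp M F (\<lambda>\<omega>. minorant z (Y \<omega>)) \<omega> \<le> ?E \<omega>"
      by (rule real_cond_exp_mono) (use i int in \<open>auto simp: min\<close>)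
    moreover have "AE \<omega> in M. real_cond_exp M F (\<lambda>\<omega>. minorant z (Y \<omega>)) \<omega> =
        real_cond_exp M F (\<lambda>\<omega>. Smap z \<bullet> Y \<omega>) \<omega> - real_cond_exp M F (\<lambda>\<omega>. Sform z z / 2) \<omega>"
      unfolding min by (rule real_cond_exp_diff) (use i in auto)
    moreover have "AE \<omega> in M. real_cond_exp M F (\<lambda>\<omega>. Sform z z / 2) \<omega> = Sform z z / 2"
      by (rule real_cond_exp_F_meas) auto
    moreover note cond_exp_is_inner[OF Y ce, of "Smap z"]
    ultimately show ?thesis by eventually_elim (simp add: min)
  qed
  then have "AE \<omega> in M. \<forall>z\<in>Z. minorant z (X \<omega>) \<le> ?E \<omega>"
    using Z(1) by (simp add: AE_ball_countable)
  then have up: "AE \<omega> in M. psi A (X \<omega>) \<le> ereal (?E \<omega>)"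
    by eventually_elim (rule psi_le_dense[OF Z(3)], blast)
  have low: "ereal (?q \<omega>) \<le> psi A (X \<omega>)" for \<omega>
    using dom unfolding dominates_form_def by blast
  have le: "AE \<omega> in M. ?q \<omega> \<le> ?E \<omega>"
    using up by eventually_elim (use low order_trans in \<open>fastforce simp flip: ereal_less_eq(3)\<close>)
  have int_q: "integrable M ?q" using integrable_Sform[OF X(1) X(1)] by simp
  have int_E: "integrable M ?E" "(\<integral>\<omega>. ?E \<omega> \<partial>M) = (\<integral>\<omega>. \<Psi> \<omega> \<partial>M)" using real_cond_exp_int[OF int] by auto
  show weak: "?Q \<le> (\<integral>\<omega>. \<Psi> \<omega> \<partial>M)" using integral_mono_AE[OF int_q int_E(1) le] int_E(2) by simp
  assume "(\<integral>\<omega>. \<Psi> \<omega> \<partial>M) \<le> ?Q"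
  then have eq: "(\<integral>\<omega>. \<Psi> \<omega> \<partial>M) = ?Q" using weak by simp
  have "AE \<omega> in M. ?q \<omega> = ?E \<omega>"
    by (rule integral_ineq_eq_0_then_AE[OF le int_q int_E(1)]) (simp add: int_E(2) eq)
  with up have contact: "AE \<omega> in M. X \<omega> \<in> contact_set A"
  proof eventually_elim
    case (elim \<omega>)
    show ?case
      unfolding contact_set_def mem_Collect_eq by (rule antisym[OF _ low]) (use elim in \<open>simp only:\<close>)
  qed
  have "AE \<omega> in M. minorant (X \<omega>) (Y \<omega>) \<le> \<Psi> \<omega>"
    using contact \<Psi> by eventually_elim (use minorant_le_psi_contact[OF dom] in \<open>metis ereal_less_eq(3)\<close>)
  moreover have int_m: "integrable M (\<lambda>\<omega>. minorant (X \<omega>) (Y \<omega>))"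
    unfolding minorant_def using integrable_Sform[OF X(1) Y] int_q by auto
  \<comment> \<open>Conditioning replaces \<open>Y\<close> by \<open>X\<close> in the integral of
    \<open>S(X,Y)\<close>, so the minorant integrates to half the integral of
    \<open>S(X,X)\<close>.\<close>
  moreover have "(\<integral>\<omega>. minorant (X \<omega>) (Y \<omega>) \<partial>M) = (\<integral>\<omega>. \<Psi> \<omega> \<partial>M)"
    unfolding minorant_def eq using integrable_Sform[OF X(1) Y] int_q integral_Sform_cond_exp[OF Y X ce]
    by (subst Bochner_Integration.integral_diff) auto
  ultimately have "AE \<omega> in M. minorant (X \<omega>) (Y \<omega>) = \<Psi> \<omega>"
    using int by (intro integral_ineq_eq_0_then_AE)
  with contact show "AE \<omega> in M. X \<omega> \<in> contact_set A \<and> \<Psi> \<omega> = minorant (X \<omega>) (Y \<omega>)"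
    by eventually_elim simp
qed

lemma L2_cond_exp:
  assumes "L2 M X" "i \<in> Basis"
  shows "integrable M (\<lambda>\<omega>. (real_cond_exp M F (\<lambda>\<omega>. X \<omega> \<bullet> i) \<omega>)\<^sup>2)"
proof (rule integrable_convex_cond_exp[where I = UNIV])
  have [measurable]: "X \<in> borel_measurable M" using assms by (simp add: L2_def)
  show "integrable M (\<lambda>\<omega>. X \<omega> \<bullet> i)" by (rule integrable_component[OF assms(1)])
  show "integrable M (\<lambda>\<omega>. (X \<omega> \<bullet> i)\<^sup>2)"
  proof (rule Bochner_Integration.integrable_bound)
    show "integrable M (\<lambda>\<omega>. (norm (X \<omega>))\<^sup>2)" using assms by (simp add: L2_def)
    show "AE \<omega> in M. norm ((X \<omega> \<bullet> i)\<^sup>2) \<le> norm ((norm (X \<omega>))\<^sup>2)"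
      using Basis_le_norm[OF assms(2)] by (auto simp: power2_le_iff_abs_le)
  qed measurable
  show "convex_on UNIV (\<lambda>x :: real. x\<^sup>2)" by (rule convex_power2)
qed auto

end

section \<open>Equilibria\<close>

lemma subalgebra_sigma_of:
  assumes "X \<in> borel_measurable M"
  shows "subalgebra M (sigma_of M X)"
  unfolding subalgebra_def sigma_of_def
  using assms by (auto simp: sets_vimage_algebra2 intro: measurable_sets)

lemma measurable_sigma_of: "X \<in> borel_measurable (sigma_of M X)"
  unfolding sigma_of_def by (rule measurable_vimage_algebra1) simp

lemma cond_exp_is_Pair:
  assumes "cond_exp_is M F U T" "cond_exp_is M F V W"
  shows "cond_exp_is M F (\<lambda>\<omega>. (U \<omega>, V \<omega>)) (\<lambda>\<omega>. (T \<omega>, W \<omega>))"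
  using assms by (auto simp: cond_exp_is_def Basis_prod_def)

text \<open>The term \<open>u \<bullet> v\<close> does not depend on \<open>(r, s)\<close>, so
  maximizing the insider's profit at \<open>(u, v)\<close> means maximizing minorants over the
  graph.\<close>

lemma minorant_graph: "minorant (r, s) (u, v) = u \<bullet> v + (r - u) \<bullet> (v - s)"
  by (simp add: minorant_def Sform_def inner_simps inner_commute)

locale equilibrium = prob_space M for M :: "'a measure" +
  fixes U V R :: "'a \<Rightarrow> real^'m" and f :: "real^'m \<Rightarrow> real^'m"
  assumes U: "L2 M U" and V: "L2 M V" and eq: "Y_equilibrium M U V R f"
begin

definition Y :: "'a \<Rightarrow> 'm pt" where "Y \<omega> = (U \<omega>, V \<omega>)"

text \<open>The insider's profit shifted by \<open>U \<omega> \<bullet> V \<omega>\<close>, a shift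
  common to all equilibria.\<close>

definition profit :: "'a \<Rightarrow> real" where "profit \<omega> = minorant (R \<omega>, f (R \<omega>)) (Y \<omega>)"

definition mean_U :: "'a \<Rightarrow> real^'m" where
  "mean_U \<omega> = (\<Sum>i\<in>Basis. real_cond_exp M (sigma_of M R) (\<lambda>\<omega>. U \<omega> \<bullet> i) \<omega> *\<^sub>R i)"

definition X :: "'a \<Rightarrow> 'm pt" where "X \<omega> = (mean_U \<omega>, f (R \<omega>))"

lemma R: "L2 M R"
  and f_measurable [measurable]: "f \<in> borel_measurable borel"
  and cond_exp_V: "cond_exp_is M (sigma_of M R) V (\<lambda>\<omega>. f (R \<omega>))"
  and optimal: "AE \<omega> in M. \<forall>r. inner (r - U \<omega>) (V \<omega> - f r) \<le> inner (R \<omega> - U \<omega>) (V \<omega> - f (R \<omega>))"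
  using eq by (auto simp: Y_equilibrium_def)

lemma measurable_UVR [measurable]:
  "R \<in> borel_measurable M" "U \<in> borel_measurable M" "V \<in> borel_measurable M"
  "R \<in> borel_measurable (sigma_of M R)"
  using R U V measurable_sigma_of[of R M] by (auto simp: L2_def)

sublocale finite_measure_subalgebra M "sigma_of M R"
  by unfold_locales (rule subalgebra_sigma_of, measurable)

lemma Y: "L2 M Y"
  unfolding Y_def using U V by (rule L2_Pair)

lemma Y_measurable [measurable]: "Y \<in> borel_measurable M"
  using Y by (simp add: L2_def)

lemma mean_U_inner: "i \<in> Basis \<Longrightarrow> mean_U \<omega> \<bullet> i = real_cond_exp M (sigma_of M R) (\<lambda>\<omega>. U \<omega> \<bullet> i) \<omega>"
  by (simp add: mean_U_def)

lemma X_measurable: "X \<in> borel_measurable (sigma_of M R)"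
  unfolding X_def mean_U_def by measurable

lemma cond_exp_U: "cond_exp_is M (sigma_of M R) U mean_U"
  by (simp add: cond_exp_is_def mean_U_inner)

lemma cond_exp_Y: "cond_exp_is M (sigma_of M R) Y X"
  unfolding Y_def X_def by (rule cond_exp_is_Pair[OF cond_exp_U cond_exp_V])

lemma L2_mean_U: "L2 M mean_U"
  using L2_cond_exp[OF U] by (intro L2_componentsI) (auto simp: mean_U_inner)

text \<open>Inherited from \<open>V\<close>, of which \<open>f (R \<omega>)\<close> is a conditional
  expectation.\<close>

lemma L2_fR: "L2 M (\<lambda>\<omega>. f (R \<omega>))"
proof (rule L2_componentsI)
  fix i :: "real^'m" assume i: "i \<in> Basis"
  show "(\<lambda>\<omega>. f (R \<omega>) \<bullet> i) \<in> borel_measurable M" by measurable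
  show "integrable M (\<lambda>\<omega>. (f (R \<omega>) \<bullet> i)\<^sup>2)"
  proof (rule integrable_cong_AE_imp[OF L2_cond_exp[OF V i]])
    show "AE \<omega> in M. (real_cond_exp M (sigma_of M R) (\<lambda>\<omega>. V \<omega> \<bullet> i) \<omega>)\<^sup>2 = (f (R \<omega>) \<bullet> i)\<^sup>2"
      using cond_exp_V i by (auto simp: cond_exp_is_def elim!: AE_mp)
  qed measurable
qed

lemma L2_X: "L2 M X"
  unfolding X_def by (rule L2_Pair[OF L2_mean_U L2_fR])

lemma profit_eq: "profit \<omega> = f (R \<omega>) \<bullet> U \<omega> + R \<omega> \<bullet> V \<omega> - R \<omega> \<bullet> f (R \<omega>)"
  by (simp add: profit_def Y_def minorant_graph inner_simps inner_commute)

lemmas integrable_terms =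
  integrable_inner_L2[OF L2_fR U] integrable_inner_L2[OF R V] integrable_inner_L2[OF R L2_fR]

lemma integrable_profit: "integrable M profit"
  unfolding profit_eq[abs_def] using integrable_terms by auto

lemma psi_graph_Y: "AE \<omega> in M. psi (graph f) (Y \<omega>) = ereal (profit \<omega>)"
  using optimal
proof eventually_elim
  case (elim \<omega>)
  have "psi (graph f) (Y \<omega>) \<le> ereal (profit \<omega>)"
    using elim unfolding psi_le_iff by (auto simp: graph_def profit_def Y_def minorant_graph)
  moreover have "ereal (profit \<omega>) \<le> psi (graph f) (Y \<omega>)"
    unfolding profit_def by (rule minorant_le_psi) (auto simp: graph_def)
  ultimately show ?case by (rule antisym)
qed

text \<open>Projection onto the sigma-algebra of \<open>R\<close> replaces \<open>V\<close> by
  \<open>f (R \<omega>)\<close>, which cancels the two terms containing \<open>R\<close> as a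
  factor, and replaces \<open>U\<close> by \<open>mean_U\<close>. What remains is half the form at
  \<open>X\<close>.\<close>

lemma integral_profit: "(\<integral>\<omega>. profit \<omega> \<partial>M) = (\<integral>\<omega>. Sform (X \<omega>) (X \<omega>) / 2 \<partial>M)"
proof -
  have "(\<integral>\<omega>. profit \<omega> \<partial>M) =
      (\<integral>\<omega>. f (R \<omega>) \<bullet> U \<omega> \<partial>M) + (\<integral>\<omega>. R \<omega> \<bullet> V \<omega> \<partial>M) - (\<integral>\<omega>. R \<omega> \<bullet> f (R \<omega>) \<partial>M)"
    unfolding profit_eq using integrable_terms by simp
  also have "(\<integral>\<omega>. R \<omega> \<bullet> V \<omega> \<partial>M) = (\<integral>\<omega>. R \<omega> \<bullet> f (R \<omega>) \<partial>M)"
    by (rule integral_inner_cond_exp[OF V L2_fR R _ cond_exp_V]) measurable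
  also have "(\<integral>\<omega>. f (R \<omega>) \<bullet> U \<omega> \<partial>M) = (\<integral>\<omega>. f (R \<omega>) \<bullet> mean_U \<omega> \<partial>M)"
    by (rule integral_inner_cond_exp[OF U L2_mean_U L2_fR _ cond_exp_U]) measurable
  finally show ?thesis by (simp add: X_def Sform_def inner_commute)
qed

lemma dual_bound:
  assumes "dominates_form A" "integrable M \<Psi>" "AE \<omega> in M. psi A (Y \<omega>) = ereal (\<Psi> \<omega>)"
  shows "(\<integral>\<omega>. profit \<omega> \<partial>M) \<le> (\<integral>\<omega>. \<Psi> \<omega> \<partial>M)"
  unfolding integral_profit using weak_duality(1)[OF Y L2_X X_measurable cond_exp_Y assms] .

lemma dual_contact:
  assumes "dominates_form A" "integrable M \<Psi>" "AE \<omega> in M. psi A (Y \<omega>) = ereal (\<Psi> \<omega>)"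
    and "(\<integral>\<omega>. \<Psi> \<omega> \<partial>M) \<le> (\<integral>\<omega>. profit \<omega> \<partial>M)"
  shows "AE \<omega> in M. X \<omega> \<in> contact_set A \<and> \<Psi> \<omega> = minorant (X \<omega>) (Y \<omega>)"
  using weak_duality(2)[OF Y L2_X X_measurable cond_exp_Y assms(1-3)] assms(4) unfolding integral_profit .

lemmas contact = dual_contact[OF dominates_form_graph integrable_profit psi_graph_Y order_refl]

end

locale equilibrium_pair = f: equilibrium M U V R f + g: equilibrium M U V Q g
  for M :: "'a measure" and U V R Q :: "'a \<Rightarrow> real^'m" and f g
begin

text \<open>\<open>psi (graph g)\<close> is a dual competitor for the first equilibrium and
  \<open>psi (graph f)\<close> for the second, so each expected profit is bounded by the
  other.\<close>

lemma integral_profit_eq: "(\<integral>\<omega>. f.profit \<omega> \<partial>M) = (\<integral>\<omega>. g.profit \<omega> \<partial>M)"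
  using f.dual_bound[OF dominates_form_graph g.integrable_profit, of g] g.psi_graph_Y
    g.dual_bound[OF dominates_form_graph f.integrable_profit, of f] f.psi_graph_Y
  by (simp add: antisym)

lemma contact_other: "AE \<omega> in M. g.X \<omega> \<in> contact_set (graph f) \<and> f.profit \<omega> = minorant (g.X \<omega>) (f.Y \<omega>)"
  using g.dual_contact[OF dominates_form_graph f.integrable_profit, of f] f.psi_graph_Y integral_profit_eq
  by simp

text \<open>Both profits are the minorant of \<open>g.X\<close> at \<open>Y\<close>.\<close>

lemma profit_AE_eq: "AE \<omega> in M. f.profit \<omega> = g.profit \<omega>"
  using contact_other g.contact by eventually_elim simp

end

section \<open>The dual problem under full support\<close>

lemma dense_of_AE:
  fixes \<nu> :: "'b::metric_space measure"
  assumes "msupp \<nu> = UNIV" "sets \<nu> = sets borel" "AE y in \<nu>. P y"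
  shows "closure {y. P y} = UNIV"
proof -
  obtain N where N: "{y \<in> space \<nu>. \<not> P y} \<subseteq> N" "emeasure \<nu> N = 0" "N \<in> sets \<nu>"
    using assms(3) by (rule AE_E)
  have space: "space \<nu> = UNIV" using sets_eq_imp_space_eq[OF assms(2)] by simp
  have "x \<in> closure {y. P y}" for x
    unfolding closure_approachable
  proof (intro allI impI)
    fix e :: real assume "e > 0"
    then have "emeasure \<nu> (ball x e) > 0" using assms(1) by (auto simp: msupp_def)
    then have "\<not> ball x e \<subseteq> N" using N(2,3) emeasure_mono[of "ball x e" N \<nu>] by force
    then obtain y where "y \<in> ball x e" "y \<notin> N" by blast
    then show "\<exists>y\<in>{y. P y}. dist y x < e" using N(1) space by (auto simp: dist_commute)
  qed
  then show ?thesis by blast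
qed

lemma minorant_convex_comb:
  "minorant x ((1 - t) *\<^sub>R y + t *\<^sub>R z) = (1 - t) * minorant x y + t * minorant x z"
  by (simp add: minorant_def Sform_def inner_simps algebra_simps add_divide_distrib diff_divide_distrib)

lemma psi_convex_comb:
  assumes "psi A y = ereal a" "psi A z = ereal b" "0 \<le> t" "t \<le> 1"
  shows "psi A ((1 - t) *\<^sub>R y + t *\<^sub>R z) \<le> ereal ((1 - t) * a + t * b)"
  unfolding psi_le_iff minorant_convex_comb
proof
  fix x assume "x \<in> A"
  then have "minorant x y \<le> a" "minorant x z \<le> b"
    using minorant_le_psi[of x A] assms(1,2) by (metis ereal_less_eq(3))+
  then show "(1 - t) * minorant x y + t * minorant x z \<le> (1 - t) * a + t * b"
    using assms(3,4) by (intro add_mono mult_left_mono) auto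
qed

lemma psi_not_MInf: "A \<noteq> {} \<Longrightarrow> psi A y \<noteq> - \<infinity>"
  using minorant_le_psi[of _ A y] by force

lemma psi_ereal: "A \<noteq> {} \<Longrightarrow> psi A y \<noteq> \<infinity> \<Longrightarrow> psi A y = ereal (real_of_ereal (psi A y))"
  using psi_not_MInf[of A y] by (cases "psi A y") auto

text \<open>A dense convex subset of a Euclidean space is the whole space.\<close>

lemma psi_finite_everywhere:
  assumes "A \<noteq> {}" "closure {y. psi A y \<noteq> \<infinity>} = UNIV"
  shows "psi A y \<noteq> \<infinity>"
proof -
  let ?D = "{y. psi A y \<noteq> \<infinity>}"
  have "convex ?D"
    unfolding convex_alt
  proof (intro ballI allI impI)
    fix y z and t :: real assume yz: "y \<in> ?D" "z \<in> ?D" and t: "0 \<le> t \<and> t \<le> 1"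
    then obtain a b where "psi A y = ereal a" "psi A z = ereal b"
      using psi_ereal[OF assms(1)] by blast
    then have "psi A ((1 - t) *\<^sub>R y + t *\<^sub>R z) \<le> ereal ((1 - t) * a + t * b)"
      using t by (intro psi_convex_comb) auto
    then show "(1 - t) *\<^sub>R y + t *\<^sub>R z \<in> ?D" using ereal_infty_less_eq(1) by fastforce
  qed
  then have "interior ?D = UNIV" using convex_interior_closure[of ?D] assms(2) by simp
  then show ?thesis using interior_subset[of ?D] by blast
qed

lemma continuous_psi:
  assumes "A \<noteq> {}" and fin: "\<And>y. psi A y \<noteq> \<infinity>"
  shows "continuous_on UNIV (\<lambda>y. real_of_ereal (psi A y))"
proof (rule convex_on_continuous)
  show "convex_on UNIV (\<lambda>y. real_of_ereal (psi A y))"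
  proof (intro convex_onI)
    fix t :: real and y z assume "0 < t" "t < 1"
    then have "psi A ((1 - t) *\<^sub>R y + t *\<^sub>R z) \<le>
        ereal ((1 - t) * real_of_ereal (psi A y) + t * real_of_ereal (psi A z))"
      using psi_ereal[OF assms(1) fin] by (intro psi_convex_comb) auto
    then show "real_of_ereal (psi A ((1 - t) *\<^sub>R y + t *\<^sub>R z)) \<le>
        (1 - t) * real_of_ereal (psi A y) + t * real_of_ereal (psi A z)"
      using psi_ereal[OF assms(1) fin] by (metis ereal_less_eq(3))
  qed auto
qed auto

text \<open>Under full support an almost sure property holds on a dense set. Finiteness there
  spreads to the whole space by convexity and yields continuity, after which equality spreads as
  well.\<close>

lemma psi_eq_of_AE:
  fixes \<nu> :: "('m::finite) pt measure"
  assumes \<nu>: "msupp \<nu> = UNIV" "sets \<nu> = sets borel" and ne: "A \<noteq> {}" "B \<noteq> {}"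
    and AE: "AE y in \<nu>. psi A y = psi B y" and fin: "AE y in \<nu>. psi A y \<noteq> \<infinity>"
  shows "psi A = psi B"
proof -
  have finA: "psi A y \<noteq> \<infinity>" for y
    by (rule psi_finite_everywhere[OF ne(1) dense_of_AE[OF \<nu> fin]])
  have "AE y in \<nu>. psi B y \<noteq> \<infinity>" using AE fin by eventually_elim simp
  then have finB: "psi B y \<noteq> \<infinity>" for y
    by (rule psi_finite_everywhere[OF ne(2) dense_of_AE[OF \<nu>]])
  let ?E = "{y. real_of_ereal (psi A y) = real_of_ereal (psi B y)}"
  have "closed ?E"
    by (intro closed_Collect_eq continuous_psi ne finA finB)
  moreover have "AE y in \<nu>. real_of_ereal (psi A y) = real_of_ereal (psi B y)"
    using AE by eventually_elim simp
  then have "closure ?E = UNIV" by (rule dense_of_AE[OF \<nu>])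
  ultimately have "real_of_ereal (psi A y) = real_of_ereal (psi B y)" for y by (auto simp: closure_closed)
  then show ?thesis using psi_ereal[OF ne(1) finA] psi_ereal[OF ne(2) finB] by (intro ext) metis
qed

section \<open>Extended integrals of functions bounded below, and graphs in monotone
  relation\<close>

lemma eintegral_ereal:
  assumes int: "integrable N \<Psi>" and AE: "AE y in N. \<phi> y = ereal (\<Psi> y)"
  shows "eintegral N \<phi> = ereal (\<integral>y. \<Psi> y \<partial>N)"
proof -
  have "(\<integral>\<^sup>+ y. e2ennreal (\<phi> y) \<partial>N) = (\<integral>\<^sup>+ y. ennreal (\<Psi> y) \<partial>N)"
    using AE by (intro nn_integral_cong_AE) (auto simp: e2ennreal_ereal)
  moreover have "(\<integral>\<^sup>+ y. e2ennreal (- \<phi> y) \<partial>N) = (\<integral>\<^sup>+ y. ennreal (- \<Psi> y) \<partial>N)"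
    using AE by (intro nn_integral_cong_AE) (auto simp: e2ennreal_ereal)
  moreover have "enn2ereal p = ereal (enn2real p)" if "p \<noteq> \<infinity>" for p
    using that by (cases p) (auto simp: enn2ereal_ennreal)
  ultimately show ?thesis
    using int by (simp add: eintegral_def real_integrable_def real_lebesgue_integral_def[OF int])
qed

text \<open>The integrable lower bound excludes a difference of two infinities. Dual competitors
  thus have infinite value or a real integrable version to which weak duality applies.\<close>

lemma eintegral_cases:
  assumes meas: "\<phi> \<in> borel_measurable N" and l: "integrable N l" "\<And>y. ereal (l y) \<le> \<phi> y"
  obtains "eintegral N \<phi> = \<infinity>"
  | \<Psi> where "integrable N \<Psi>" "AE y in N. \<phi> y = ereal (\<Psi> y)" "eintegral N \<phi> = ereal (\<integral>y. \<Psi> y \<partial>N)"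
proof -
  note [measurable] = meas
  have "(\<integral>\<^sup>+ y. e2ennreal (- \<phi> y) \<partial>N) \<le> (\<integral>\<^sup>+ y. ennreal (- l y) \<partial>N)"
  proof (intro nn_integral_mono)
    fix y
    have "- \<phi> y \<le> ereal (- l y)" using l(2)[of y] by (metis ereal_minus_le_minus uminus_ereal.simps(1))
    then show "e2ennreal (- \<phi> y) \<le> ennreal (- l y)" by (metis e2ennreal_mono e2ennreal_ereal)
  qed
  also have "\<dots> < \<infinity>" using l(1) by (simp add: real_integrable_def less_top)
  finally have neg: "(\<integral>\<^sup>+ y. e2ennreal (- \<phi> y) \<partial>N) < \<infinity>" .
  show thesis
  proof (cases "(\<integral>\<^sup>+ y. e2ennreal (\<phi> y) \<partial>N) = \<infinity>")
    case True
    then have "eintegral N \<phi> = \<infinity>"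
      using neg by (cases "\<integral>\<^sup>+ y. e2ennreal (- \<phi> y) \<partial>N") (auto simp: eintegral_def enn2ereal_ennreal)
    then show thesis by (rule that)
  next
    case False
    let ?\<Psi> = "\<lambda>y. real_of_ereal (\<phi> y)"
    have "AE y in N. e2ennreal (\<phi> y) \<noteq> \<infinity>" by (rule nn_integral_PInf_AE[OF _ False]) measurable
    then have AE: "AE y in N. \<phi> y = ereal (?\<Psi> y)"
    proof eventually_elim
      case (elim y)
      then show ?case using l(2)[of y] by (cases "\<phi> y") auto
    qed
    have "(\<integral>\<^sup>+ y. e2ennreal (\<phi> y) \<partial>N) = (\<integral>\<^sup>+ y. ennreal (?\<Psi> y) \<partial>N)"
      by (rule nn_integral_cong_AE) (use AE in eventually_elim, metis e2ennreal_ereal)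
    moreover have "(\<integral>\<^sup>+ y. e2ennreal (- \<phi> y) \<partial>N) = (\<integral>\<^sup>+ y. ennreal (- ?\<Psi> y) \<partial>N)"
      by (rule nn_integral_cong_AE) (use AE in eventually_elim, metis e2ennreal_ereal uminus_ereal.simps(1))
    ultimately have "integrable N ?\<Psi>" unfolding real_integrable_def using False neg by auto
    then show thesis using that(2) AE eintegral_ereal by blast
  qed
qed

text \<open>Test the relation at a point \<open>w\<close> displaced from \<open>r\<close> in the
  direction of \<open>g r - f u\<close>: this bounds \<open>norm (g r - f u)\<close> by
  \<open>norm (f w - f u)\<close>, which continuity of \<open>f\<close> makes small. So
  \<open>g r\<close> tends to \<open>f u\<close>, and \<open>r = u\<close> gives equality.\<close>

lemma cross_graph_bound:
  assumes mono: "\<And>u r. (u - r) \<bullet> (f u - g r) \<ge> 0" and cont: "isCont f u"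
  shows "f u = g u" "isCont g u"
proof -
  have key: "\<exists>\<delta>>0. \<forall>r. dist r u < \<delta> \<longrightarrow> dist (g r) (f u) < e" if "e > 0" for e
  proof -
    obtain \<delta> where \<delta>: "\<delta> > 0" "\<And>w. dist w u < \<delta> \<Longrightarrow> dist (f w) (f u) < e"
      using cont \<open>e > 0\<close> unfolding continuous_at_eps_delta by blast
    have "dist (g r) (f u) < e" if r: "dist r u < \<delta> / 2" for r
    proof (cases "g r = f u")
      case False
      define d where "d = (g r - f u) /\<^sub>R norm (g r - f u)"
      define w where "w = r + (\<delta> / 2) *\<^sub>R d"
      have d: "norm d = 1" using False by (simp add: d_def)
      have gd: "d \<bullet> (g r - f u) = norm (g r - f u)"
        using False by (simp add: d_def dot_square_norm power2_eq_square)
      have "dist w u \<le> dist r u + \<delta> / 2"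
        using norm_triangle_ineq[of "r - u" "(\<delta> / 2) *\<^sub>R d"] d \<delta>(1)
        by (simp add: w_def dist_norm algebra_simps)
      then have fw: "norm (f w - f u) < e" using \<delta>(2)[of w] r by (simp add: dist_norm)
      have "0 \<le> (w - r) \<bullet> (f w - g r)" by (rule mono)
      then have "0 \<le> d \<bullet> (f w - g r)" using \<delta>(1) by (simp add: w_def zero_le_mult_iff)
      then have "norm (g r - f u) \<le> d \<bullet> (f w - f u)" using gd by (simp add: inner_simps)
      also have "\<dots> \<le> norm (f w - f u)" using norm_cauchy_schwarz[of d "f w - f u"] d by simp
      finally show ?thesis using fw by (simp add: dist_norm)
    qed (use \<open>e > 0\<close> in simp)
    then show ?thesis using \<delta>(1) by (intro exI[of _ "\<delta> / 2"]) auto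
  qed
  have "dist (g u) (f u) \<le> 0"
  proof (rule field_le_epsilon)
    fix e :: real assume "e > 0"
    then show "dist (g u) (f u) \<le> 0 + e" using key[of e] by (metis dist_self less_imp_le add_0)
  qed
  then show eq: "f u = g u" by simp
  show "isCont g u"
    unfolding continuous_at_eps_delta using key by (simp add: eq)
qed

section \<open>The contact set of the graph as the dual optimizer\<close>

context equilibrium
begin

definition \<nu> :: "'m pt measure" where "\<nu> = distr M borel Y"

lemma sets_\<nu>: "sets \<nu> = sets borel" and space_\<nu>: "space \<nu> = UNIV"
  by (simp_all add: \<nu>_def)

lemma AE_\<nu>_iff: "{y. P y} \<in> sets borel \<Longrightarrow> (AE y in \<nu>. P y) \<longleftrightarrow> (AE \<omega> in M. P (Y \<omega>))"
  unfolding \<nu>_def by (rule AE_distr_iff) auto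

lemma AE_\<nu>D: "AE y in \<nu>. P y \<Longrightarrow> AE \<omega> in M. P (Y \<omega>)"
  unfolding \<nu>_def by (rule AE_distrD) auto

lemma integrable_\<nu>D: fixes \<Psi> :: "'m pt \<Rightarrow> real" shows "integrable \<nu> \<Psi> \<Longrightarrow> integrable M (\<lambda>\<omega>. \<Psi> (Y \<omega>))"
  unfolding \<nu>_def by (rule integrable_distr[OF Y_measurable])

lemma integral_\<nu>: fixes \<Psi> :: "'m pt \<Rightarrow> real" shows "integrable \<nu> \<Psi> \<Longrightarrow> (\<integral>y. \<Psi> y \<partial>\<nu>) = (\<integral>\<omega>. \<Psi> (Y \<omega>) \<partial>M)"
  unfolding \<nu>_def by (intro integral_distr) (auto dest: borel_measurable_integrable)

lemma form_measurable: "(\<lambda>y. Sform y y / 2) \<in> borel_measurable borel"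
  by (intro borel_measurable_continuous_onI continuous_intros) auto

lemma integrable_form: "integrable \<nu> (\<lambda>y. Sform y y / 2)"
  unfolding \<nu>_def using integrable_Sform[OF Y Y] form_measurable by (subst integrable_distr_eq) auto

lemma psi_\<nu>_cases:
  assumes "dominates_form A"
  obtains "eintegral \<nu> (psi A) = \<infinity>"
  | \<Psi> where "integrable M \<Psi>" "AE \<omega> in M. psi A (Y \<omega>) = ereal (\<Psi> \<omega>)"
      "eintegral \<nu> (psi A) = ereal (\<integral>\<omega>. \<Psi> \<omega> \<partial>M)"
proof -
  have meas: "psi A \<in> borel_measurable \<nu>" using measurable_psi by (simp add: \<nu>_def)
  show thesis
  proof (rule eintegral_cases[OF meas integrable_form])
    show "ereal (Sform y y / 2) \<le> psi A y" for y using assms unfolding dominates_form_def by blast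
  next
    assume "eintegral \<nu> (psi A) = \<infinity>"
    then show thesis by (rule that)
  next
    fix \<Psi> assume "integrable \<nu> \<Psi>" "AE y in \<nu>. psi A y = ereal (\<Psi> y)" "eintegral \<nu> (psi A) = ereal (\<integral>y. \<Psi> y \<partial>\<nu>)"
    then show thesis
      using that(2)[of "\<lambda>\<omega>. \<Psi> (Y \<omega>)"] integrable_\<nu>D[of \<Psi>]
        AE_\<nu>D[of "\<lambda>y. psi A y = ereal (\<Psi> y)"] integral_\<nu>[of \<Psi>] by simp
  qed
qed

lemma graph_psi_\<nu>:
  "AE y in \<nu>. psi (graph f) y \<noteq> \<infinity>" "eintegral \<nu> (psi (graph f)) = ereal (\<integral>\<omega>. profit \<omega> \<partial>M)"
proof -
  have "{y. psi (graph f) y \<noteq> \<infinity>} \<in> sets borel"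
    using measurable_psi[of "graph f"] by measurable
  then show fin: "AE y in \<nu>. psi (graph f) y \<noteq> \<infinity>"
    using psi_graph_Y by (subst AE_\<nu>_iff) (auto elim!: AE_mp)
  let ?\<Psi> = "\<lambda>y. real_of_ereal (psi (graph f) y)"
  have ne: "graph f \<noteq> {}" by (auto simp: graph_def)
  have AE: "AE y in \<nu>. psi (graph f) y = ereal (?\<Psi> y)"
    using fin by eventually_elim (rule psi_ereal[OF ne])
  have pull: "AE \<omega> in M. ?\<Psi> (Y \<omega>) = profit \<omega>"
    using psi_graph_Y by eventually_elim simp
  have meas: "?\<Psi> \<in> borel_measurable borel" using measurable_psi[of "graph f"] by measurable
  have "integrable M (\<lambda>\<omega>. ?\<Psi> (Y \<omega>))"
    by (rule integrable_cong_AE_imp[OF integrable_profit]) (use pull meas in \<open>auto elim!: AE_mp\<close>)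
  then have int: "integrable \<nu> ?\<Psi>"
    unfolding \<nu>_def using meas by (subst integrable_distr_eq) auto
  have "(\<integral>\<omega>. ?\<Psi> (Y \<omega>) \<partial>M) = (\<integral>\<omega>. profit \<omega> \<partial>M)"
    using pull meas integrable_profit by (intro integral_cong_AE) auto
  then show "eintegral \<nu> (psi (graph f)) = ereal (\<integral>\<omega>. profit \<omega> \<partial>M)"
    using eintegral_ereal[OF int AE] integral_\<nu>[OF int] by simp
qed

lemma psi_eq_graph:
  assumes supp: "msupp \<nu> = UNIV" and ne: "A \<noteq> {}"
    and AE: "AE \<omega> in M. psi A (Y \<omega>) = ereal (profit \<omega>)"
  shows "psi A = psi (graph f)"
proof (rule psi_eq_of_AE[symmetric, OF supp sets_\<nu> _ ne _ graph_psi_\<nu>(1)])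
  show "graph f \<noteq> {}" by (auto simp: graph_def)
  have "{y. psi (graph f) y = psi A y} \<in> sets borel"
    using measurable_psi[of "graph f"] measurable_psi[of A] by measurable
  moreover have "AE \<omega> in M. psi (graph f) (Y \<omega>) = psi A (Y \<omega>)"
    using AE psi_graph_Y by eventually_elim simp
  ultimately show "AE y in \<nu>. psi (graph f) y = psi A y" by (simp add: AE_\<nu>_iff)
qed

text \<open>\<open>X\<close> is almost surely a contact point whose tangent attains
  \<open>psi (graph f)\<close> at \<open>Y\<close>, so restricting the supremum to contact points
  loses nothing there, and full support extends this to all points. Maximality of the contact set
  rests on this equality.\<close>

lemma psi_contact_graph:
  assumes supp: "msupp \<nu> = UNIV"
  shows "psi (contact_set (graph f)) = psi (graph f)"
proof (rule psi_eq_graph[OF supp])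
  let ?H = "contact_set (graph f)"
  have "AE \<omega> in M. X \<omega> \<in> ?H" using contact by eventually_elim simp
  then show "?H \<noteq> {}" using AE_False by fastforce
  show "AE \<omega> in M. psi ?H (Y \<omega>) = ereal (profit \<omega>)"
    using contact psi_graph_Y
  proof eventually_elim
    case (elim \<omega>)
    then have "ereal (profit \<omega>) \<le> psi ?H (Y \<omega>)" using minorant_le_psi by metis
    moreover have "psi ?H (Y \<omega>) \<le> ereal (profit \<omega>)"
      using psi_contact_set_le[OF dominates_form_graph, of f "Y \<omega>"] elim by simp
    ultimately show ?case by simp
  qed
qed

lemma contact_graph_maxS: "msupp \<nu> = UNIV \<Longrightarrow> contact_set (graph f) \<in> maxS"
  by (intro maximal_monotoneI dominates_form_graph psi_contact_graph)

lemma dual_optimal_contact_graph: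
  assumes supp: "msupp \<nu> = UNIV"
  shows "dual_optimal \<nu> (contact_set (graph f))"
  unfolding dual_optimal_def psi_contact_graph[OF supp] graph_psi_\<nu>(2)
proof (intro conjI ballI contact_graph_maxS[OF supp])
  fix G :: "'m pt set" assume "G \<in> maxS"
  then have dom: "dominates_form G" by (rule maximal_monotone_psi)
  from dom show "ereal (\<integral>\<omega>. profit \<omega> \<partial>M) \<le> eintegral \<nu> (psi G)"
    by (rule psi_\<nu>_cases) (use dual_bound[OF dom] in auto)
qed

text \<open>The value of an optimal \<open>H\<close> is at most the expected profit, so there is no
  gap and \<open>X\<close> is a contact point of \<open>H\<close> too. Hence \<open>psi H\<close> at
  \<open>Y\<close> is the profit, and full support identifies \<open>psi H\<close> with
  \<open>psi (graph f)\<close>. A maximal set is recovered from its \<open>psi\<close> as the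
  contact set.\<close>

lemma dual_optimal_unique:
  assumes supp: "msupp \<nu> = UNIV" and H: "dual_optimal \<nu> H"
  shows "H = contact_set (graph f)"
proof -
  have "H \<in> maxS" using H by (simp add: dual_optimal_def)
  note dom = maximal_monotone_psi(1)[OF this] and H_eq = maximal_monotone_psi(2)[OF this]
  have le: "eintegral \<nu> (psi H) \<le> ereal (\<integral>\<omega>. profit \<omega> \<partial>M)"
    using H contact_graph_maxS[OF supp] unfolding dual_optimal_def
    by (metis graph_psi_\<nu>(2) psi_contact_graph[OF supp])
  from dom have "psi H = psi (graph f)"
  proof (rule psi_\<nu>_cases)
    assume "eintegral \<nu> (psi H) = \<infinity>"
    then show ?thesis using le by simp
  next
    fix \<Psi> assume \<Psi>: "integrable M \<Psi>" "AE \<omega> in M. psi H (Y \<omega>) = ereal (\<Psi> \<omega>)"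
      "eintegral \<nu> (psi H) = ereal (\<integral>\<omega>. \<Psi> \<omega> \<partial>M)"
    have c: "AE \<omega> in M. X \<omega> \<in> contact_set H \<and> \<Psi> \<omega> = minorant (X \<omega>) (Y \<omega>)"
      using le \<Psi>(3) by (intro dual_contact[OF dom \<Psi>(1,2)]) simp
    show ?thesis
    proof (rule psi_eq_graph[OF supp])
      have "AE \<omega> in M. X \<omega> \<in> H" using c unfolding H_eq by eventually_elim simp
      then show "H \<noteq> {}" using AE_False by fastforce
      show "AE \<omega> in M. psi H (Y \<omega>) = ereal (profit \<omega>)"
        using c contact \<Psi>(2) by eventually_elim simp
    qed
  qed
  then show ?thesis using H_eq by (simp add: contact_set_def)
qed

text \<open>A graph point is in monotone relation to the contact set, so adding it keeps
  monotonicity; maximality shows that it was already there.\<close>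

lemma graph_subset_contact:
  assumes supp: "msupp \<nu> = UNIV"
  shows "graph f \<subseteq> contact_set (graph f)"
proof
  let ?H = "contact_set (graph f)"
  fix x assume x: "x \<in> graph f"
  have "S_monotone (insert x ?H)"
    using cross_monotone_contact_set[of "graph f"] x contact_set_monotone[OF dominates_form_graph, of f]
    by (auto simp: S_monotone_def cross_monotone_def Sform_minus_commute[of _ x]) (simp add: Sform_def)
  then show "x \<in> ?H" using contact_graph_maxS[OF supp] unfolding maxS_def by blast
qed

end

context equilibrium_pair
begin

lemma contact_graphs_eq:
  assumes "msupp f.\<nu> = UNIV" shows "contact_set (graph g) = contact_set (graph f)"
  by (rule f.dual_optimal_unique[OF assms g.dual_optimal_contact_graph[OF assms]])

lemma cross_graphs:
  assumes "msupp f.\<nu> = UNIV" shows "(u - r) \<bullet> (f u - g r) \<ge> 0"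
proof -
  have "(u, f u) \<in> graph f" "(r, g r) \<in> graph g" by (auto simp: graph_def)
  then have "(u, f u) \<in> contact_set (graph f)" "(r, g r) \<in> contact_set (graph f)"
    using f.graph_subset_contact[OF assms] g.graph_subset_contact[OF assms] contact_graphs_eq[OF assms] by auto
  then have "0 \<le> Sform ((u, f u) - (r, g r)) ((u, f u) - (r, g r))"
    using contact_set_monotone[OF dominates_form_graph, of f] unfolding cross_monotone_def by blast
  then show ?thesis by (simp add: Sform_def inner_commute)
qed

lemma cont_points_eq:
  assumes "msupp f.\<nu> = UNIV"
  shows "cont_points f = cont_points g" "u \<in> cont_points f \<Longrightarrow> f u = g u"
proof -
  have cross: "(u - r) \<bullet> (g u - f r) \<ge> 0" for u r
    using cross_graphs[OF assms, of r u] by (simp add: inner_simps)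
  show "cont_points f = cont_points g"
    using cross_graph_bound(2)[of f g, OF cross_graphs[OF assms]] cross_graph_bound(2)[of g f, OF cross]
    by (auto simp: cont_points_def)
  show "u \<in> cont_points f \<Longrightarrow> f u = g u"
    using cross_graph_bound(1)[of f g, OF cross_graphs[OF assms]] by (auto simp: cont_points_def)
qed

end

section \<open>Optimal maps and plans\<close>

lemma sigma_of_cong:
  assumes "\<And>A. A \<in> sets borel \<Longrightarrow> \<exists>B\<in>sets borel. X -` A \<inter> space M = Z -` B \<inter> space M"
    and "\<And>B. B \<in> sets borel \<Longrightarrow> \<exists>A\<in>sets borel. Z -` B \<inter> space M = X -` A \<inter> space M"
  shows "sigma_of M X = sigma_of M Z"
proof -
  have "{X -` A \<inter> space M |A. A \<in> sets borel} = {Z -` B \<inter> space M |B. B \<in> sets borel}"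
  proof (intro equalityI subsetI; elim CollectE exE conjE)
    fix S A assume "S = X -` A \<inter> space M" "A \<in> sets borel"
    then show "S \<in> {Z -` B \<inter> space M |B. B \<in> sets borel}" using assms(1)[of A] by auto
  next
    fix S B assume "S = Z -` B \<inter> space M" "B \<in> sets borel"
    then show "S \<in> {X -` A \<inter> space M |A. A \<in> sets borel}" using assms(2)[of B] by auto
  qed
  then show ?thesis by (simp add: sigma_of_def vimage_algebra_def)
qed

text \<open>Makes conditioning on the price pair, as in \<open>admissible_maps\<close>, the same as
  conditioning on \<open>R\<close>, as in an equilibrium.\<close>

lemma sigma_of_graph:
  fixes R :: "'a \<Rightarrow> 'b::euclidean_space" and f :: "'b \<Rightarrow> 'c::euclidean_space"
  assumes [measurable]: "f \<in> borel_measurable borel"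
  shows "sigma_of M (\<lambda>\<omega>. (R \<omega>, f (R \<omega>))) = sigma_of M R"
proof (rule sigma_of_cong)
  fix A :: "('b \<times> 'c) set" assume A: "A \<in> sets borel"
  have "(\<lambda>r. (r, f r)) \<in> borel_measurable borel" by measurable
  from measurable_sets[OF this A] have "(\<lambda>r. (r, f r)) -` A \<in> sets borel" by simp
  then show "\<exists>B\<in>sets borel. (\<lambda>\<omega>. (R \<omega>, f (R \<omega>))) -` A \<inter> space M = R -` B \<inter> space M"
    by (rule bexI[rotated]) auto
next
  fix B :: "'b set" assume B: "B \<in> sets borel"
  have "(fst :: 'b \<times> 'c \<Rightarrow> 'b) \<in> borel_measurable borel"
    by (intro borel_measurable_continuous_onI continuous_intros)
  from measurable_sets[OF this B] have "(fst :: 'b \<times> 'c \<Rightarrow> 'b) -` B \<in> sets borel" by simp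
  then show "\<exists>A\<in>sets borel. R -` B \<inter> space M = (\<lambda>\<omega>. (R \<omega>, f (R \<omega>))) -` A \<inter> space M"
    by (rule bexI[rotated]) auto
qed

lemma sets_sigma_of: "sets (sigma_of M X) = {X -` A \<inter> space M | A. A \<in> sets borel}"
  unfolding sigma_of_def by (subst sets_vimage_algebra2) auto

lemma space_sigma_of [simp]: "space (sigma_of M X) = space M"
  by (simp add: sigma_of_def)

text \<open>A real number is the infimum of the rationals above it, and each event
  \<open>X < c\<close> is the preimage under \<open>Y\<close> of a Borel set \<open>B c\<close>; the
  factor \<open>\<xi>\<close> takes this infimum over the sets \<open>B c\<close>.\<close>

lemma doob_dynkin_real:
  fixes X :: "'a \<Rightarrow> real"
  assumes "X \<in> borel_measurable (sigma_of M Y)"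
  shows "\<exists>\<xi>\<in>borel_measurable borel. \<forall>\<omega>\<in>space M. X \<omega> = \<xi> (Y \<omega>)"
proof -
  have "\<exists>B\<in>sets borel. {\<omega> \<in> space M. X \<omega> < c} = Y -` B \<inter> space M" for c
  proof -
    have "{\<omega> \<in> space (sigma_of M Y). X \<omega> < c} \<in> sets (sigma_of M Y)"
      using assms by measurable
    then show ?thesis by (auto simp: sets_sigma_of)
  qed
  then obtain B where B: "\<And>c. B c \<in> sets borel" "\<And>c. {\<omega> \<in> space M. X \<omega> < c} = Y -` B c \<inter> space M"
    by metis
  \<comment> \<open>Rationals \<open>c\<close> with \<open>y\<close> outside \<open>B c\<close>
    contribute infinity. Off the range of \<open>Y\<close> the infimum may be infinite, and
    \<open>real_of_ereal\<close> then returns 0.\<close>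
  define \<xi> where "\<xi> y = real_of_ereal (INF c\<in>\<rat>. if y \<in> B c then ereal c else \<infinity>)" for y
  have "(\<lambda>y. INF c\<in>\<rat>. if y \<in> B c then ereal c else \<infinity>) \<in> borel_measurable borel"
    using countable_rat B(1) by (intro borel_measurable_INF measurable_If_set) auto
  then have "\<xi> \<in> borel_measurable borel" unfolding \<xi>_def by measurable
  moreover have "X \<omega> = \<xi> (Y \<omega>)" if \<omega>: "\<omega> \<in> space M" for \<omega>
  proof -
    have mem: "Y \<omega> \<in> B c \<longleftrightarrow> X \<omega> < c" for c using B(2)[of c] \<omega> by blast
    have "(INF c\<in>\<rat>. if X \<omega> < c then ereal c else \<infinity>) = ereal (X \<omega>)"
    proof (rule antisym)
      show "ereal (X \<omega>) \<le> (INF c\<in>\<rat>. if X \<omega> < c then ereal c else \<infinity>)"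
        by (intro INF_greatest) auto
      show "(INF c\<in>\<rat>. if X \<omega> < c then ereal c else \<infinity>) \<le> ereal (X \<omega>)"
      proof (rule ereal_le_epsilon2)
        fix e :: real assume "0 < e"
        then obtain c where c: "c \<in> \<rat>" "X \<omega> < c" "c < X \<omega> + e"
          using Rats_dense_in_real[of "X \<omega>" "X \<omega> + e"] by auto
        have "(INF c\<in>\<rat>. if X \<omega> < c then ereal c else \<infinity>) \<le> (if X \<omega> < c then ereal c else \<infinity>)"
          by (rule INF_lower[OF c(1)])
        also have "\<dots> \<le> ereal (X \<omega>) + ereal e" using c by simp
        finally show "(INF c\<in>\<rat>. if X \<omega> < c then ereal c else \<infinity>) \<le> ereal (X \<omega>) + ereal e" .
      qed
    qed
    then show ?thesis by (simp add: \<xi>_def mem)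
  qed
  ultimately show ?thesis by blast
qed

lemma doob_dynkin:
  fixes X :: "'a \<Rightarrow> 'b::euclidean_space"
  assumes "meas_wrt M Y X"
  obtains \<xi> where "\<xi> \<in> borel_measurable borel" "\<And>\<omega>. \<omega> \<in> space M \<Longrightarrow> X \<omega> = \<xi> (Y \<omega>)"
proof -
  have "(\<lambda>\<omega>. X \<omega> \<bullet> i) \<in> borel_measurable (sigma_of M Y)" for i
    using assms by (simp add: meas_wrt_def)
  then have "\<exists>\<xi>\<in>borel_measurable borel. \<forall>\<omega>\<in>space M. X \<omega> \<bullet> i = \<xi> (Y \<omega>)" for i
    by (rule doob_dynkin_real)
  then obtain \<xi> where \<xi>: "\<And>i. \<xi> i \<in> borel_measurable borel" "\<And>i \<omega>. \<omega> \<in> space M \<Longrightarrow> X \<omega> \<bullet> i = \<xi> i (Y \<omega>)"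
    by metis
  note [measurable] = \<xi>(1)
  show ?thesis
  proof (rule that)
    show "(\<lambda>y. \<Sum>i\<in>Basis. \<xi> i y *\<^sub>R i) \<in> borel_measurable borel" by measurable
    show "X \<omega> = (\<Sum>i\<in>Basis. \<xi> i (Y \<omega>) *\<^sub>R i)" if "\<omega> \<in> space M" for \<omega>
      using \<xi>(2)[OF that] by (simp flip: \<xi>(2)[OF that] add: euclidean_representation)
  qed
qed

text \<open>Events generated by \<open>fst\<close> pull back under \<open>(X, Y)\<close> to events
  generated by \<open>X\<close>, so the integral identities that characterize the conditional
  expectation carry over.\<close>

lemma (in prob_space) cond_exp_is_distr:
  fixes X Y :: "'a \<Rightarrow> ('m::finite) pt"
  assumes X: "L2 M X" and Y: "L2 M Y" and ce: "cond_exp_is M (sigma_of M X) Y X"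
  defines "\<gamma> \<equiv> distr M borel (\<lambda>\<omega>. (X \<omega>, Y \<omega>))"
  shows "cond_exp_is \<gamma> (sigma_of \<gamma> fst) snd fst"
  unfolding cond_exp_is_def
proof
  fix i :: "'m pt" assume i: "i \<in> Basis"
  have X_meas [measurable]: "X \<in> borel_measurable M" and [measurable]: "Y \<in> borel_measurable M"
    using X Y by (auto simp: L2_def)
  have XY [measurable]: "(\<lambda>\<omega>. (X \<omega>, Y \<omega>)) \<in> measurable M borel" by measurable
  interpret \<gamma>: prob_space \<gamma> unfolding \<gamma>_def by (rule prob_space_distr) measurable
  have fst [measurable]: "fst \<in> borel_measurable \<gamma>" and snd [measurable]: "snd \<in> borel_measurable \<gamma>"
    unfolding \<gamma>_def by (auto intro!: borel_measurable_continuous_onI continuous_intros)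
  interpret F: finite_measure_subalgebra M "sigma_of M X"
    by unfold_locales (rule subalgebra_sigma_of[OF X_meas])
  interpret G: finite_measure_subalgebra \<gamma> "sigma_of \<gamma> fst"
    by unfold_locales (rule subalgebra_sigma_of[OF fst])
  have int: "integrable M (\<lambda>\<omega>. X \<omega> \<bullet> i)" "integrable M (\<lambda>\<omega>. Y \<omega> \<bullet> i)"
    using F.integrable_component X Y by auto
  have fst_b: "(\<lambda>p :: 'm pt \<times> 'm pt. fst p \<bullet> i) \<in> borel_measurable borel"
    and snd_b: "(\<lambda>p :: 'm pt \<times> 'm pt. snd p \<bullet> i) \<in> borel_measurable borel"
    by (auto intro!: borel_measurable_continuous_onI continuous_intros)
  show "AE p in \<gamma>. real_cond_exp \<gamma> (sigma_of \<gamma> fst) (\<lambda>p. snd p \<bullet> i) p = fst p \<bullet> i"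
  proof (rule G.real_cond_exp_charact)
    show "integrable \<gamma> (\<lambda>p. snd p \<bullet> i)"
      unfolding \<gamma>_def using snd_b int(2) by (subst integrable_distr_eq) auto
    show "integrable \<gamma> (\<lambda>p. fst p \<bullet> i)"
      unfolding \<gamma>_def using fst_b int(1) by (subst integrable_distr_eq) auto
    show "(\<lambda>p. fst p \<bullet> i) \<in> borel_measurable (sigma_of \<gamma> fst)"
      using measurable_sigma_of[of fst \<gamma>] by measurable
    fix A assume "A \<in> sets (sigma_of \<gamma> fst)"
    then obtain B :: "'m pt set" where B: "B \<in> sets borel" "A = fst -` B"
      by (auto simp: sets_sigma_of \<gamma>_def)
    have "(fst :: 'm pt \<times> 'm pt \<Rightarrow> 'm pt) \<in> borel_measurable borel"
      by (intro borel_measurable_continuous_onI continuous_intros)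
    from measurable_sets[OF this B(1)] have A: "A \<in> sets borel" by (simp add: B(2))
    let ?A = "X -` B \<inter> space M"
    have "?A \<in> sets (sigma_of M X)" using B(1) by (auto simp: sets_sigma_of)
    have ind: "indicat_real A (X \<omega>, Y \<omega>) = indicat_real ?A \<omega>" if "\<omega> \<in> space M" for \<omega>
      using that by (simp add: B(2) indicator_def)
    have "(\<integral>p\<in>A. snd p \<bullet> i \<partial>\<gamma>) = (\<integral>\<omega>\<in>?A. Y \<omega> \<bullet> i \<partial>M)"
      unfolding \<gamma>_def set_lebesgue_integral_def using A snd_b
      by (subst integral_distr) (auto simp: ind intro!: Bochner_Integration.integral_cong)
    also have "\<dots> = (\<integral>\<omega>\<in>?A. real_cond_exp M (sigma_of M X) (\<lambda>\<omega>. Y \<omega> \<bullet> i) \<omega> \<partial>M)"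
      by (rule F.real_cond_exp_intA[OF int(2)]) fact
    also have "\<dots> = (\<integral>\<omega>\<in>?A. X \<omega> \<bullet> i \<partial>M)"
      unfolding set_lebesgue_integral_def
    proof (rule integral_cong_AE)
      show "AE \<omega> in M. indicat_real ?A \<omega> *\<^sub>R real_cond_exp M (sigma_of M X) (\<lambda>\<omega>. Y \<omega> \<bullet> i) \<omega> = indicat_real ?A \<omega> *\<^sub>R (X \<omega> \<bullet> i)"
        using ce i by (auto simp: cond_exp_is_def elim!: AE_mp)
    qed (use B(1) in measurable)
    also have "\<dots> = (\<integral>p\<in>A. fst p \<bullet> i \<partial>\<gamma>)"
      unfolding \<gamma>_def set_lebesgue_integral_def using A fst_b
      by (subst integral_distr) (auto simp: ind intro!: Bochner_Integration.integral_cong)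
    finally show "(\<integral>p\<in>A. snd p \<bullet> i \<partial>\<gamma>) = (\<integral>p\<in>A. fst p \<bullet> i \<partial>\<gamma>)" .
  qed
qed

context equilibrium
begin

abbreviation price_pair :: "'a \<Rightarrow> 'm pt" where "price_pair \<omega> \<equiv> (R \<omega>, f (R \<omega>))"

lemma minorant_le_profit:
  "AE \<omega> in M. \<forall>x\<in>graph f \<union> contact_set (graph f). minorant x (Y \<omega>) \<le> profit \<omega>"
  using psi_graph_Y
proof eventually_elim
  case (elim \<omega>)
  then show ?case
    using minorant_le_psi[of _ "graph f" "Y \<omega>"] minorant_le_psi_contact[OF dominates_form_graph, of _ f "Y \<omega>"]
    by auto
qed

lemma L2_price_pair: "L2 M price_pair"
  using R L2_fR by (rule L2_Pair)

lemma sigma_of_price_pair: "sigma_of M price_pair = sigma_of M R"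
  by (rule sigma_of_graph) measurable

text \<open>Moves the conditions from \<open>M\<close> to the law of \<open>Y\<close>; continuity of
  the distribution function enters as absence of atoms.\<close>

lemma AE_co_maximizers_unique_\<nu>:
  assumes A1: "\<And>j C h. compact C \<Longrightarrow> C \<subseteq> {x. coord x j = 1 \<and> Sform x x > 0} \<Longrightarrow> in_H j C h \<Longrightarrow>
       AE \<omega> in M. h (Smap (Y \<omega>)) \<noteq> 0"
    and A2: "\<And>w t. CARD('m) = 1 \<Longrightarrow> S_isotropic w \<Longrightarrow>
       isCont (cdf (distr M borel (\<lambda>\<omega>. Sform (Y \<omega>) w))) t"
    and A3: "\<And>D. CARD('m) > 1 \<Longrightarrow> D \<in> E0 \<Longrightarrow> emeasure \<nu> D = 0"
    and cross: "cross_monotone A B"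
  shows "AE y in \<nu>. \<forall>a b. co_maximizers A B y a b \<longrightarrow> a = b"
proof (rule AE_co_maximizers_unique[OF sets_\<nu> cross _ _ A3])
  fix j C and h :: "'m pt \<Rightarrow> real"
  assume h: "C \<subseteq> {x. coord x j = 1 \<and> Sform x x > 0}" "in_H j C h" "continuous_on UNIV h"
  have "compact C" using h(2) by (simp add: in_H_def)
  then have AE: "AE \<omega> in M. h (Smap (Y \<omega>)) \<noteq> 0" using h(1,2) by (rule A1)
  have "continuous_on UNIV (\<lambda>y. h (Smap y))"
    using h(3) by (rule continuous_on_compose2) (auto intro: continuous_intros)
  then have "open {y. h (Smap y) \<noteq> 0}"
    by (intro open_Collect_neq continuous_on_const)
  with AE show "AE y in \<nu>. h (Smap y) \<noteq> 0" by (simp add: AE_\<nu>_iff)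
next
  fix w t assume w: "CARD('m) = 1" "S_isotropic (w :: 'm pt)"
  have cont: "continuous_on UNIV (\<lambda>y. Sform y w)" by (intro continuous_intros)
  then have [measurable]: "(\<lambda>y. Sform y w) \<in> borel_measurable borel" by (rule borel_measurable_continuous_onI)
  let ?D = "distr M borel (\<lambda>\<omega>. Sform (Y \<omega>) w)"
  interpret D: real_distribution ?D by (rule real_distribution_distr) measurable
  have "measure ?D {t} = 0" using A2[OF w, of t] by (simp add: D.isCont_cdf)
  then have "emeasure ?D {t} = 0" by (simp add: D.emeasure_eq_measure)
  then have "AE z in ?D. z \<notin> {t}" by (intro AE_not_in) auto
  then have AE: "AE \<omega> in M. Sform (Y \<omega>) w \<noteq> t" by (subst (asm) AE_distr_iff) auto
  moreover have "open {y. Sform y w \<noteq> t}"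
    using cont by (intro open_Collect_neq continuous_on_const)
  ultimately show "AE y in \<nu>. Sform y w \<noteq> t" by (simp add: AE_\<nu>_iff)
qed

end

text \<open>\<open>unique_co_maximizers\<close> is the form in which (A1), (A2) and (A3) enter from
  here on.\<close>

locale nondegenerate_equilibrium = equilibrium M U V R f
  for M :: "'a measure" and U V R :: "'a \<Rightarrow> real^'m" and f +
  assumes unique_co_maximizers:
    "\<And>A B. cross_monotone A B \<Longrightarrow> AE y in \<nu>. \<forall>a b. co_maximizers A B y a b \<longrightarrow> a = b"
begin

text \<open>Serves all points that close the duality gap: the conditional mean \<open>X\<close>,
  every optimal map, and the conditional mean of another equilibrium.\<close>

lemma dual_contact_unique:
  assumes "AE \<omega> in M. Z \<omega> \<in> contact_set (graph f) \<and> profit \<omega> = minorant (Z \<omega>) (Y \<omega>)"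
  shows "AE \<omega> in M. Z \<omega> = price_pair \<omega>"
  using assms minorant_le_profit AE_\<nu>D[OF unique_co_maximizers[OF cross_monotone_contact_set[of "graph f"]]]
proof eventually_elim
  case (elim \<omega>)
  have "co_maximizers (graph f) (contact_set (graph f)) (Y \<omega>) (price_pair \<omega>) (Z \<omega>)"
    unfolding co_maximizers_def using elim(1,2) by (auto simp: graph_def profit_def)
  then show ?case using elim(3) by metis
qed

lemma X_eq_price_pair: "AE \<omega> in M. X \<omega> = price_pair \<omega>"
  by (rule dual_contact_unique[OF contact])

lemma cond_exp_price_pair: "cond_exp_is M (sigma_of M R) Y price_pair"
  unfolding cond_exp_is_def
proof
  fix i :: "'m pt" assume "i \<in> Basis"
  then have "AE \<omega> in M. real_cond_exp M (sigma_of M R) (\<lambda>\<omega>. Y \<omega> \<bullet> i) \<omega> = X \<omega> \<bullet> i"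
    using cond_exp_Y by (simp add: cond_exp_is_def)
  then show "AE \<omega> in M. real_cond_exp M (sigma_of M R) (\<lambda>\<omega>. Y \<omega> \<bullet> i) \<omega> = price_pair \<omega> \<bullet> i"
    using X_eq_price_pair by eventually_elim simp
qed

lemma price_pair_admissible: "price_pair \<in> admissible_maps M Y"
proof -
  have "R \<in> borel_measurable (sigma_of M Y)"
    using eq by (simp add: Y_equilibrium_def meas_wrt_def Y_def[abs_def])
  then have "meas_wrt M Y price_pair"
    unfolding meas_wrt_def by measurable
  then show ?thesis
    using L2_price_pair cond_exp_price_pair by (simp add: admissible_maps_def sigma_of_price_pair)
qed

lemma price_pair_value: "(\<integral>\<omega>. Sform (price_pair \<omega>) (Y \<omega>) \<partial>M) / 2 = (\<integral>\<omega>. profit \<omega> \<partial>M)"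
proof -
  have "(\<integral>\<omega>. Sform (price_pair \<omega>) (Y \<omega>) \<partial>M) = (\<integral>\<omega>. Sform (X \<omega>) (Y \<omega>) \<partial>M)"
    using X_eq_price_pair integrable_Sform[OF L2_price_pair Y] integrable_Sform[OF L2_X Y]
    by (intro integral_cong_AE) (auto elim!: AE_mp)
  also have "\<dots> = (\<integral>\<omega>. Sform (X \<omega>) (X \<omega>) \<partial>M)"
    by (rule integral_Sform_cond_exp[OF Y L2_X X_measurable cond_exp_Y])
  finally show ?thesis by (simp add: integral_profit)
qed

lemma optimal_map_price_pair:
  "optimal_map M Y price_pair" "optimal_map M Y Z \<Longrightarrow> AE \<omega> in M. Z \<omega> = price_pair \<omega>"
proof -
  have bound: "(\<integral>\<omega>. Sform (Z \<omega>) (Y \<omega>) \<partial>M) / 2 \<le> (\<integral>\<omega>. profit \<omega> \<partial>M)" (is ?bound)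
    "(\<integral>\<omega>. profit \<omega> \<partial>M) \<le> (\<integral>\<omega>. Sform (Z \<omega>) (Y \<omega>) \<partial>M) / 2 \<Longrightarrow> AE \<omega> in M. Z \<omega> = price_pair \<omega>"
    if Z: "Z \<in> admissible_maps M Y" for Z
  proof -
    have Z: "L2 M Z" "cond_exp_is M (sigma_of M Z) Y Z" and [measurable]: "Z \<in> borel_measurable M"
      using Z by (auto simp: admissible_maps_def L2_def)
    interpret Z: finite_measure_subalgebra M "sigma_of M Z"
      by unfold_locales (rule subalgebra_sigma_of, measurable)
    note prems = Y Z(1) measurable_sigma_of Z(2)
    note duality = Z.weak_duality[OF prems dominates_form_graph integrable_profit psi_graph_Y]
    have value_eq: "(\<integral>\<omega>. Sform (Z \<omega>) (Y \<omega>) \<partial>M) / 2 = (\<integral>\<omega>. Sform (Z \<omega>) (Z \<omega>) / 2 \<partial>M)"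
      using Z.integral_Sform_cond_exp[OF prems] by simp
    show ?bound unfolding value_eq by (rule duality(1))
    assume "(\<integral>\<omega>. profit \<omega> \<partial>M) \<le> (\<integral>\<omega>. Sform (Z \<omega>) (Y \<omega>) \<partial>M) / 2"
    then show "AE \<omega> in M. Z \<omega> = price_pair \<omega>"
      unfolding value_eq by (intro dual_contact_unique duality(2))
  qed
  show "optimal_map M Y price_pair"
    unfolding optimal_map_def price_pair_value using price_pair_admissible bound(1) by blast
  assume "optimal_map M Y Z"
  then have Z: "Z \<in> admissible_maps M Y"
    and max: "\<forall>X'\<in>admissible_maps M Y. (\<integral>\<omega>. Sform (X' \<omega>) (Y \<omega>) \<partial>M) / 2 \<le> (\<integral>\<omega>. Sform (Z \<omega>) (Y \<omega>) \<partial>M) / 2"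
    unfolding optimal_map_def by blast+
  have "(\<integral>\<omega>. profit \<omega> \<partial>M) \<le> (\<integral>\<omega>. Sform (Z \<omega>) (Y \<omega>) \<partial>M) / 2"
    using bspec[OF max price_pair_admissible] unfolding price_pair_value .
  with Z show "AE \<omega> in M. Z \<omega> = price_pair \<omega>" by (rule bound(2))
qed

definition plan :: "('m pt \<times> 'm pt) measure" where
  "plan = distr M borel (\<lambda>\<omega>. (price_pair \<omega>, Y \<omega>))"

lemma price_pair_measurable [measurable]: "price_pair \<in> borel_measurable M"
  by measurable

lemma integrable_norms: "integrable M (\<lambda>\<omega>. (norm (price_pair \<omega>))\<^sup>2 + (norm (Y \<omega>))\<^sup>2)"
  using L2_price_pair Y by (auto simp: L2_def)

lemma plan_in_Gamma: "plan \<in> Gamma \<nu>"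
  unfolding Gamma_def
proof (intro CollectI conjI)
  have pair [measurable]: "(\<lambda>\<omega>. (price_pair \<omega>, Y \<omega>)) \<in> measurable M borel" by measurable
  show "prob_space plan" unfolding plan_def by (rule prob_space_distr[OF pair])
  show "sets plan = sets borel" by (simp add: plan_def)
  have norms: "(\<lambda>p :: 'm pt \<times> 'm pt. (norm (fst p))\<^sup>2 + (norm (snd p))\<^sup>2) \<in> borel_measurable borel"
    by (intro borel_measurable_continuous_onI continuous_intros)
  show "integrable plan (\<lambda>p. (norm (fst p))\<^sup>2 + (norm (snd p))\<^sup>2)"
    unfolding plan_def using integrable_distr_eq[OF pair norms] integrable_norms by simp
  have "snd \<in> borel_measurable (borel :: ('m pt \<times> 'm pt) measure)"
    by (intro borel_measurable_continuous_onI continuous_intros)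
  from distr_distr[OF this pair] show "distr plan borel snd = \<nu>"
    unfolding plan_def \<nu>_def by (simp add: comp_def)
  show "cond_exp_is plan (sigma_of plan fst) snd fst"
    unfolding plan_def
    by (rule cond_exp_is_distr[OF L2_price_pair Y])
      (simp add: sigma_of_price_pair cond_exp_price_pair)
qed

lemma plan_value: "(\<integral>p. Sform (fst p) (snd p) \<partial>plan) / 2 = (\<integral>\<omega>. profit \<omega> \<partial>M)"
proof -
  have pair: "(\<lambda>\<omega>. (price_pair \<omega>, Y \<omega>)) \<in> measurable M borel" by measurable
  have "(\<lambda>p :: 'm pt \<times> 'm pt. Sform (fst p) (snd p)) \<in> borel_measurable borel"
    by (intro borel_measurable_continuous_onI continuous_intros)
  from integral_distr[OF pair this] show ?thesis
    by (simp add: plan_def price_pair_value)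
qed

text \<open>The real version is a function of \<open>y\<close> rather than of the scenario, because
  a plan lives on another space and shares only its second marginal with \<open>Y\<close>.\<close>

lemma psi_\<nu>_real:
  obtains \<Psi> where "integrable \<nu> \<Psi>" "AE y in \<nu>. psi (graph f) y = ereal (\<Psi> y)"
    "(\<integral>y. \<Psi> y \<partial>\<nu>) = (\<integral>\<omega>. profit \<omega> \<partial>M)"
proof (rule eintegral_cases[where N = \<nu> and \<phi> = "psi (graph f)"])
  show "psi (graph f) \<in> borel_measurable \<nu>" using measurable_psi by (simp add: \<nu>_def)
  show "integrable \<nu> (\<lambda>y. Sform y y / 2)" by (rule integrable_form)
  show "ereal (Sform y y / 2) \<le> psi (graph f) y" for y
    using dominates_form_graph[of f] unfolding dominates_form_def by blast
qed (use that graph_psi_\<nu>(2) in auto)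

text \<open>The price pair factors as \<open>\<xi> (Y \<omega>)\<close>. For an optimal
  \<open>\<gamma>\<close> both \<open>fst p\<close> and \<open>\<xi> (snd p)\<close> are contact
  points whose tangents attain \<open>psi (graph f)\<close> at \<open>snd p\<close>, so they
  coincide, and \<open>\<gamma>\<close> is the image of \<open>\<nu>\<close> under \<open>y\<close>
  to \<open>(\<xi> y, y)\<close>.\<close>

lemma optimal_plan_price_pair:
  "optimal_plan \<nu> plan" "optimal_plan \<nu> \<gamma> \<Longrightarrow> \<gamma> = plan"
proof -
  obtain \<Psi> where \<Psi>: "integrable \<nu> \<Psi>" "AE y in \<nu>. psi (graph f) y = ereal (\<Psi> y)"
    "(\<integral>y. \<Psi> y \<partial>\<nu>) = (\<integral>\<omega>. profit \<omega> \<partial>M)" by (rule psi_\<nu>_real)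
  let ?H = "contact_set (graph f)"
  have bound: "(\<integral>p. Sform (fst p) (snd p) \<partial>\<gamma>) / 2 \<le> (\<integral>\<omega>. profit \<omega> \<partial>M)" (is ?bound)
    "(\<integral>\<omega>. profit \<omega> \<partial>M) \<le> (\<integral>p. Sform (fst p) (snd p) \<partial>\<gamma>) / 2 \<Longrightarrow>
      AE p in \<gamma>. fst p \<in> ?H \<and> psi (graph f) (snd p) = ereal (minorant (fst p) (snd p))"
    if \<gamma>: "\<gamma> \<in> Gamma \<nu>" for \<gamma>
  proof -
    have sets: "sets \<gamma> = sets borel" and int: "integrable \<gamma> (\<lambda>p. (norm (fst p))\<^sup>2 + (norm (snd p))\<^sup>2)"
      and snd_\<nu>: "distr \<gamma> borel snd = \<nu>" and ce: "cond_exp_is \<gamma> (sigma_of \<gamma> fst) snd fst"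
      and prob: "prob_space \<gamma>"
      using \<gamma> by (auto simp: Gamma_def)
    interpret \<gamma>: prob_space \<gamma> by (rule prob)
    have fst: "fst \<in> borel_measurable \<gamma>" and snd: "snd \<in> borel_measurable \<gamma>"
      unfolding measurable_cong_sets[OF sets refl]
      by (auto intro!: borel_measurable_continuous_onI continuous_intros)
    interpret G: finite_measure_subalgebra \<gamma> "sigma_of \<gamma> fst"
      by unfold_locales (rule subalgebra_sigma_of[OF fst])
    have L2: "L2 \<gamma> fst" "L2 \<gamma> snd"
      unfolding L2_def using fst snd
      by (auto intro!: Bochner_Integration.integrable_bound[OF int])
    have int: "integrable \<gamma> (\<lambda>p. \<Psi> (snd p))"
      by (rule integrable_distr[OF snd]) (simp add: snd_\<nu> \<Psi>(1))
    have AE: "AE p in \<gamma>. psi (graph f) (snd p) = ereal (\<Psi> (snd p))"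
      using \<Psi>(2)[folded snd_\<nu>] by (rule AE_distrD[OF snd])
    have "(\<integral>y. \<Psi> y \<partial>(distr \<gamma> borel snd)) = (\<integral>p. \<Psi> (snd p) \<partial>\<gamma>)"
      using \<Psi>(1) snd by (intro integral_distr) (auto simp: \<nu>_def dest: borel_measurable_integrable)
    then have eq: "(\<integral>p. \<Psi> (snd p) \<partial>\<gamma>) = (\<integral>\<omega>. profit \<omega> \<partial>M)" by (simp add: snd_\<nu> \<Psi>(3))
    note prems = L2(2,1) measurable_sigma_of ce
    note duality = G.weak_duality[OF prems dominates_form_graph int AE, unfolded eq]
    have value_eq: "(\<integral>p. Sform (fst p) (snd p) \<partial>\<gamma>) / 2 = (\<integral>p. Sform (fst p) (fst p) / 2 \<partial>\<gamma>)"
      using G.integral_Sform_cond_exp[OF prems] by simp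
    show ?bound unfolding value_eq by (rule duality(1))
    assume "(\<integral>\<omega>. profit \<omega> \<partial>M) \<le> (\<integral>p. Sform (fst p) (snd p) \<partial>\<gamma>) / 2"
    then have "AE p in \<gamma>. fst p \<in> ?H \<and> \<Psi> (snd p) = minorant (fst p) (snd p)"
      unfolding value_eq by (rule duality(2))
    with AE show "AE p in \<gamma>. fst p \<in> ?H \<and> psi (graph f) (snd p) = ereal (minorant (fst p) (snd p))"
      by eventually_elim simp
  qed
  show "optimal_plan \<nu> plan"
    unfolding optimal_plan_def plan_value using plan_in_Gamma bound(1) by blast
  assume "optimal_plan \<nu> \<gamma>"
  then have \<gamma>: "\<gamma> \<in> Gamma \<nu>" and le: "(\<integral>\<omega>. profit \<omega> \<partial>M) \<le> (\<integral>p. Sform (fst p) (snd p) \<partial>\<gamma>) / 2"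
    using plan_in_Gamma unfolding optimal_plan_def plan_value[symmetric] by blast+
  have sets: "sets \<gamma> = sets borel" and snd_\<nu>: "distr \<gamma> borel snd = \<nu>"
    using \<gamma> by (auto simp: Gamma_def)
  have snd: "snd \<in> borel_measurable \<gamma>"
    unfolding measurable_cong_sets[OF sets refl]
    by (intro borel_measurable_continuous_onI continuous_intros)
  have "meas_wrt M Y price_pair" using price_pair_admissible by (simp add: admissible_maps_def)
  then obtain \<xi> where \<xi>: "\<xi> \<in> borel_measurable borel" "\<forall>\<omega>\<in>space M. price_pair \<omega> = \<xi> (Y \<omega>)"
    by (rule doob_dynkin) blast
  have pair: "(\<lambda>y. (\<xi> y, y)) \<in> measurable borel borel" using \<xi>(1) by measurable
  \<comment> \<open>Contact and attainment are stated for \<open>\<xi> y\<close> under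
    \<open>\<nu>\<close>, so that they transfer to the second marginal of
    \<open>\<gamma>\<close>.\<close>
  let ?P = "\<lambda>y. psi (graph f) (\<xi> y) = ereal (Sform (\<xi> y) (\<xi> y) / 2) \<and> psi (graph f) y = ereal (minorant (\<xi> y) y)"
  have P: "AE y in \<nu>. ?P y"
  proof (subst AE_\<nu>_iff)
    have [measurable]: "(\<lambda>y. psi (graph f) (\<xi> y)) \<in> borel_measurable borel"
      "(\<lambda>y. Sform (\<xi> y) (\<xi> y) / 2) \<in> borel_measurable borel"
      using measurable_compose[OF \<xi>(1) measurable_psi] measurable_compose[OF \<xi>(1) form_measurable] .
    have "(\<lambda>p. minorant (fst p) (snd p)) \<in> borel_measurable (borel :: ('m pt \<times> 'm pt) measure)"
      by (intro borel_measurable_continuous_onI continuous_intros)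
    from measurable_compose[OF pair this] have [measurable]: "(\<lambda>y. minorant (\<xi> y) y) \<in> borel_measurable borel"
      by simp
    have [measurable]: "psi (graph f) \<in> borel_measurable borel" by (rule measurable_psi)
    show "{y. ?P y} \<in> sets borel" by measurable
    show "AE \<omega> in M. ?P (Y \<omega>)"
      using contact X_eq_price_pair psi_graph_Y AE_space
      by eventually_elim (use \<xi>(2) in \<open>auto simp: contact_set_def\<close>)
  qed
  have "AE p in \<gamma>. ?P (snd p)"
    using P[folded snd_\<nu>] by (rule AE_distrD[OF snd])
  \<comment> \<open>Both candidates are contact points, so uniqueness is used with the contact set
    in both places.\<close>
  moreover have "AE p in \<gamma>. \<forall>a b. co_maximizers ?H ?H (snd p) a b \<longrightarrow> a = b"
    using unique_co_maximizers[OF contact_set_monotone[OF dominates_form_graph], folded snd_\<nu>]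
    by (rule AE_distrD[OF snd])
  ultimately have "AE p in \<gamma>. p = (\<xi> (snd p), snd p)"
    using bound(2)[OF \<gamma> le]
  proof eventually_elim
    case (elim p)
    have "minorant x (snd p) \<le> minorant (fst p) (snd p)" if "x \<in> ?H" for x
      using minorant_le_psi_contact[OF dominates_form_graph that, of "snd p"] elim(3) by simp
    then have "co_maximizers ?H ?H (snd p) (fst p) (\<xi> (snd p))"
      using elim(1,3) by (auto simp: co_maximizers_def contact_set_def)
    then have "fst p = \<xi> (snd p)" using elim(2) by blast
    then show ?case by (simp add: prod_eq_iff)
  qed
  moreover have "(\<lambda>p. p) \<in> measurable \<gamma> borel" unfolding measurable_cong_sets[OF sets refl] by simp
  ultimately have "distr \<gamma> borel (\<lambda>p. p) = distr \<gamma> borel (\<lambda>p. (\<xi> (snd p), snd p))"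
    using measurable_compose[OF snd pair] by (intro distr_cong_AE) auto
  also have "\<dots> = distr \<nu> borel (\<lambda>y. (\<xi> y, y))"
    using distr_distr[OF pair snd] by (simp add: snd_\<nu> comp_def)
  also have "\<dots> = distr M borel (\<lambda>\<omega>. (\<xi> (Y \<omega>), Y \<omega>))"
    using distr_distr[OF pair Y_measurable] by (simp add: \<nu>_def comp_def)
  also have "\<dots> = plan"
    unfolding plan_def by (rule distr_cong) (use \<xi>(2) in auto)
  also have "distr \<gamma> borel (\<lambda>p. p) = \<gamma>" by (rule distr_id2) (simp add: sets)
  finally show "\<gamma> = plan" by simp
qed

end

theorem theorem10:
  fixes M :: "'a measure" and U V R Q :: "'a \<Rightarrow> real^'m" and f g :: "real^'m \<Rightarrow> real^'m"
  assumes "prob_space M"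
    and "L2 M U" and "L2 M V"
    and "Y_equilibrium M U V R f" and "Y_equilibrium M U V Q g"
  defines "Y \<equiv> (\<lambda>\<omega>. (U \<omega>, V \<omega>))"
    and "\<nu> \<equiv> distr M borel (\<lambda>\<omega>. (U \<omega>, V \<omega>))"
  shows
    "(AE \<omega> in M. inner (R \<omega> - U \<omega>) (V \<omega> - f (R \<omega>)) = inner (Q \<omega> - U \<omega>) (V \<omega> - g (Q \<omega>)))
  \<and>
    (msupp \<nu> = UNIV \<longrightarrow>
       (\<exists>H. dual_optimal \<nu> H \<and> (\<forall>H'. dual_optimal \<nu> H' \<longrightarrow> H' = H) \<and>
            graph f \<subseteq> H \<and> graph g \<subseteq> H) \<and>
       cont_points f = cont_points g \<and> (\<forall>u\<in>cont_points f. f u = g u))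
  \<and>
    (interior (convex hull (msupp \<nu>)) \<noteq> {} \<and>
       \<comment> \<open>(A1)\<close>
       (\<forall>j C h. compact C \<and> C \<subseteq> {x. coord x j = 1 \<and> Sform x x > 0} \<and> in_H j C h \<longrightarrow>
         (AE \<omega> in M. h (Smap (Y \<omega>)) \<noteq> 0)) \<and>
       \<comment> \<open>(A2)\<close>
       (CARD('m) = 1 \<longrightarrow> (\<forall>w. S_isotropic w \<longrightarrow>
          (\<forall>t. isCont (cdf (distr M borel (\<lambda>\<omega>. Sform (Y \<omega>) w))) t))) \<and>
       \<comment> \<open>(A3)\<close>
       (CARD('m) > 1 \<longrightarrow> (\<forall>D\<in>E0. emeasure \<nu> D = 0)) \<longrightarrow>
     (
     (AE \<omega> in M. f (R \<omega>) = g (Q \<omega>)) \<and>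
     ((monotone_map f \<and> monotone_map g) \<or> (AE \<omega> in M. Y \<omega> \<in> interior (msupp \<nu>)) \<longrightarrow>
        (AE \<omega> in M. R \<omega> = Q \<omega>) \<and>
        optimal_map M Y (\<lambda>\<omega>. (R \<omega>, f (R \<omega>))) \<and>
        (\<forall>X'. optimal_map M Y X' \<longrightarrow> (AE \<omega> in M. X' \<omega> = (R \<omega>, f (R \<omega>)))) \<and>
        optimal_plan \<nu> (distr M borel (\<lambda>\<omega>. ((R \<omega>, f (R \<omega>)), Y \<omega>))) \<and>
        (\<forall>\<gamma>. optimal_plan \<nu> \<gamma> \<longrightarrow> \<gamma> = distr M borel (\<lambda>\<omega>. ((R \<omega>, f (R \<omega>)), Y \<omega>))))))"
proof -
  interpret prob_space M by fact
  interpret equilibrium_pair M U V R Q f g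
    using assms(2-5) by unfold_locales
  have Y: "f.Y = Y" by (simp add: f.Y_def[abs_def] Y_def)
  have \<nu>: "f.\<nu> = \<nu>" by (simp add: f.\<nu>_def f.Y_def[abs_def] \<nu>_def)
  have a: "AE \<omega> in M. inner (R \<omega> - U \<omega>) (V \<omega> - f (R \<omega>)) = inner (Q \<omega> - U \<omega>) (V \<omega> - g (Q \<omega>))"
    using profit_AE_eq
    by eventually_elim (simp add: f.profit_def g.profit_def f.Y_def minorant_graph)
  have b: "(\<exists>H. dual_optimal \<nu> H \<and> (\<forall>H'. dual_optimal \<nu> H' \<longrightarrow> H' = H) \<and>
        graph f \<subseteq> H \<and> graph g \<subseteq> H) \<and>
      cont_points f = cont_points g \<and> (\<forall>u\<in>cont_points f. f u = g u)"
    if "msupp \<nu> = UNIV"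
  proof -
    have supp: "msupp f.\<nu> = UNIV" using that by (simp add: \<nu>)
    let ?H = "contact_set (graph f)"
    have "dual_optimal \<nu> ?H" "\<forall>H'. dual_optimal \<nu> H' \<longrightarrow> H' = ?H"
      using f.dual_optimal_contact_graph[OF supp] f.dual_optimal_unique[OF supp] unfolding \<nu> by blast+
    moreover have "graph f \<subseteq> ?H" "graph g \<subseteq> ?H"
      using f.graph_subset_contact[OF supp] g.graph_subset_contact[OF supp]
      by (simp_all only: contact_graphs_eq[OF supp])
    ultimately show ?thesis
      using cont_points_eq[OF supp] by (intro conjI exI[of _ ?H] ballI)
  qed
  have c: "(AE \<omega> in M. f (R \<omega>) = g (Q \<omega>)) \<and> (AE \<omega> in M. R \<omega> = Q \<omega>) \<and>
      optimal_map M Y (\<lambda>\<omega>. (R \<omega>, f (R \<omega>))) \<and>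
      (\<forall>X'. optimal_map M Y X' \<longrightarrow> (AE \<omega> in M. X' \<omega> = (R \<omega>, f (R \<omega>)))) \<and>
      optimal_plan \<nu> (distr M borel (\<lambda>\<omega>. ((R \<omega>, f (R \<omega>)), Y \<omega>))) \<and>
      (\<forall>\<gamma>. optimal_plan \<nu> \<gamma> \<longrightarrow> \<gamma> = distr M borel (\<lambda>\<omega>. ((R \<omega>, f (R \<omega>)), Y \<omega>)))"
    if A1: "\<forall>j C h. compact C \<and> C \<subseteq> {x. coord x j = 1 \<and> Sform x x > 0} \<and> in_H j C h \<longrightarrow>
        (AE \<omega> in M. h (Smap (Y \<omega>)) \<noteq> 0)"
      and A2: "CARD('m) = 1 \<longrightarrow> (\<forall>w. S_isotropic w \<longrightarrow>
        (\<forall>t. isCont (cdf (distr M borel (\<lambda>\<omega>. Sform (Y \<omega>) w))) t))"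
      and A3: "CARD('m) > 1 \<longrightarrow> (\<forall>D\<in>E0. emeasure \<nu> D = 0)"
  proof -
    have unique: "AE y in f.\<nu>. \<forall>a b. co_maximizers A B y a b \<longrightarrow> a = b" if "cross_monotone A B" for A B
      by (rule f.AE_co_maximizers_unique_\<nu>[OF _ _ _ that], unfold Y \<nu>)
        (use A1 A2 A3 in blast)+
    interpret f: nondegenerate_equilibrium M U V R f
      by unfold_locales (rule unique)
    interpret g: nondegenerate_equilibrium M U V Q g
      by unfold_locales (rule unique)
    \<comment> \<open>The conditional mean \<open>g.X\<close> closes the gap for both equilibria and
      therefore equals both price pairs.\<close>
    have pair: "AE \<omega> in M. (R \<omega>, f (R \<omega>)) = (Q \<omega>, g (Q \<omega>))"
      using f.dual_contact_unique[OF contact_other] g.X_eq_price_pair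
      by eventually_elim (rule trans[OF sym])
    have "AE \<omega> in M. f (R \<omega>) = g (Q \<omega>)" using pair by eventually_elim blast
    moreover have "AE \<omega> in M. R \<omega> = Q \<omega>" using pair by eventually_elim blast
    moreover have "optimal_map M Y (\<lambda>\<omega>. (R \<omega>, f (R \<omega>)))"
      "\<forall>X'. optimal_map M Y X' \<longrightarrow> (AE \<omega> in M. X' \<omega> = (R \<omega>, f (R \<omega>)))"
      using f.optimal_map_price_pair unfolding Y by blast+
    moreover have plan: "f.plan = distr M borel (\<lambda>\<omega>. ((R \<omega>, f (R \<omega>)), Y \<omega>))"
      unfolding f.plan_def Y ..
    moreover have "optimal_plan \<nu> (distr M borel (\<lambda>\<omega>. ((R \<omega>, f (R \<omega>)), Y \<omega>)))"
      "\<forall>\<gamma>. optimal_plan \<nu> \<gamma> \<longrightarrow> \<gamma> = distr M borel (\<lambda>\<omega>. ((R \<omega>, f (R \<omega>)), Y \<omega>))"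
      using f.optimal_plan_price_pair unfolding \<nu> plan by blast+
    ultimately show ?thesis by blast
  qed
  show ?thesis
    by (rule conjI[OF a], rule conjI, rule impI, erule b, intro conjI impI)
      (elim conjE, drule (2) c, elim conjE, assumption)+
qed

end
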